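(* Let $q>0$. The operator $\mathbb A$ generates a unitary group on $\mathbb H$, and $\mathbb B_1,\mathbb B_2$ are admissible control operators for it. Suppose that $f:\mathbb H\to\mathbb R$ satisfies a global Lipschitz condition on $\mathbb H$ and $f(0,0)=0$. Then for any $(w_0,w_1)\in\mathbb H$ and $u,d\in L^2_{loc}[0,\infty)$, there exists a unique global solution to $$w_{tt}(x,t)=w_{xx}(x,t),\quad w_x(0,t)=-q\,w(0,t),\quad w_x(1,t)=u(t)+f(w(\cdot,t),w_t(\cdot,t))+d(t),$$ $$w(x,0)=w_0(x),\quad w_t(x,0)=w_1(x)\qquad (x\in(0,1),\ t\ge0),$$ such that $(w(\cdot,t),w_t(\cdot,t))\in C(0,\infty;\mathbb H)$.
   Context: $\mathbb H=H^1(0,1)\times L^2(0,1)$ with inner product $\langle(\phi_1,\psi_1),(\phi_2,\psi_2)\rangle_{\mathbb H}=\int_0^1[\phi_1'(x)\overline{\phi_2'(x)}+\psi_1(x)\overline{\psi_2(x)}]\,dx+\phi_1(0)\overline{\phi_2(0)}$. The operator $\mathbb A:\mathcal D(\mathbb A)\to\mathbb H$ is $\mathbb A(\phi,\psi)=(\psi,\phi'')$ with $\mathcal D(\mathbb A)=\{(\phi,\psi)\in H^2(0,1)\times H^1(0,1):\phi'(0)=\phi(0),\ \phi'(1)=0\}$; it satisfies $\mathbb A^*=-\mathbb A$. The operators $\mathbb B_1,\mathbb B_2:\mathbb C\to\mathcal D(\mathbb A^* )'$ (dual with respect to the pivot space $\mathbb H$) are $\mathbb B_1=(0,-\delta_0)$,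 $\mathbb B_2=(0,\delta_1)$, where $\delta_a$ is the Dirac pulse at $x=a$; precisely, $\mathbb B_1^*(\phi,\psi)=-\psi(0)$ and $\mathbb B_2^*(\phi,\psi)=\psi(1)$ for $(\phi,\psi)\in\mathcal D(\mathbb A^* )$. $C(0,\infty;\mathbb H)$ denotes the continuous functions $[0,\infty)\to\mathbb H$. The wave system is equivalently written $$\frac{d}{dt}\begin{pmatrix}w\\ w_t\end{pmatrix}=\mathbb A\begin{pmatrix}w\\ w_t\end{pmatrix}-\mathbb B_1\big((q+1)w(0,t)\big)+\mathbb B_2\big[f(w(\cdot,t),w_t(\cdot,t))+u(t)+d(t)\big],$$ and solutions are understood as mild solutions of this equation (the variation-of-constants formula with the group $e^{\mathbb At}$). *)

theory Defs
  imports "HOL-Analysis.Analysis"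
begin

section \<open>Complex inner product spaces\<close>

class complex_inner = real_inner +
  fixes scaleC :: "complex \<Rightarrow> 'a \<Rightarrow> 'a" (infixr "*\<^sub>C" 75)
    and cinner :: "'a \<Rightarrow> 'a \<Rightarrow> complex"
  assumes scaleC_add_right: "c *\<^sub>C (x + y) = c *\<^sub>C x + c *\<^sub>C y"
    and scaleC_add_left: "(c + d) *\<^sub>C x = c *\<^sub>C x + d *\<^sub>C x"
    and scaleC_scaleC: "c *\<^sub>C (d *\<^sub>C x) = (c * d) *\<^sub>C x"
    and scaleC_one: "1 *\<^sub>C x = x"
    and scaleR_scaleC: "r *\<^sub>R x = complex_of_real r *\<^sub>C x"
    and cinner_commute: "cinner x y = cnj (cinner y x)"
    and cinner_add_left: "cinner (x + y) z = cinner x z + cinner y z"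
    and cinner_scaleC_left: "cinner (c *\<^sub>C x) y = c * cinner x y"
    and inner_Re_cinner: "inner x y = Re (cinner x y)"

definition clinear :: "('a::complex_inner \<Rightarrow> 'a) \<Rightarrow> bool" where
  "clinear S \<longleftrightarrow> (\<forall>x y. S (x + y) = S x + S y) \<and> (\<forall>c x. S (c *\<^sub>C x) = c *\<^sub>C S x)"

definition unitary :: "('a::complex_inner \<Rightarrow> 'a) \<Rightarrow> bool" where
  "unitary S \<longleftrightarrow> clinear S \<and> surj S \<and> (\<forall>x y. cinner (S x) (S y) = cinner x y)"


section \<open>The space \<open>L\<^sup>2(0,1)\<close>\<close>

text \<open>Every Lebesgue measurable function agrees almost everywhere with a Borel function, so the
  Borel measure below yields the usual space of classes.\<close>

abbreviation leb01 :: "real measure" where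
  "leb01 \<equiv> restrict_space lborel {0<..<1}"

lemma finite_leb01: "finite_measure leb01"
  by (rule finite_measureI) (simp add: emeasure_restrict_space space_restrict_space)

definition sq_integrable01 :: "(real \<Rightarrow> complex) \<Rightarrow> bool" where
  "sq_integrable01 f \<longleftrightarrow> f \<in> borel_measurable leb01 \<and> integrable leb01 (\<lambda>x. (cmod (f x))\<^sup>2)"

lemma sq_integrable01_prod:
  assumes "sq_integrable01 f" "sq_integrable01 g"
  shows "integrable leb01 (\<lambda>x. f x * cnj (g x))"
proof -
  have [measurable]: "f \<in> borel_measurable leb01" "g \<in> borel_measurable leb01"
    and i: "integrable leb01 (\<lambda>x. (cmod (f x))\<^sup>2 + (cmod (g x))\<^sup>2)"
    using assms by (auto simp: sq_integrable01_def)
  show ?thesis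
  proof (rule Bochner_Integration.integrable_bound[OF i])
    show "AE x in leb01. norm (f x * cnj (g x)) \<le> norm ((cmod (f x))\<^sup>2 + (cmod (g x))\<^sup>2)"
    proof (rule AE_I2)
      fix x
      have "0 \<le> (cmod (f x) - cmod (g x))\<^sup>2" "0 \<le> (cmod (f x))\<^sup>2" "0 \<le> (cmod (g x))\<^sup>2"
        by simp_all
      then show "norm (f x * cnj (g x)) \<le> norm ((cmod (f x))\<^sup>2 + (cmod (g x))\<^sup>2)"
        unfolding norm_mult complex_mod_cnj real_norm_def power2_diff by linarith
    qed
    have "(\<lambda>x. cnj (g x)) \<in> borel_measurable leb01"
      by (rule borel_measurable_continuous_on[of cnj]) (auto intro: continuous_intros)
    then show "(\<lambda>x. f x * cnj (g x)) \<in> borel_measurable leb01" by measurable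
  qed
qed

lemma sq_integrable01_add:
  assumes "sq_integrable01 f" "sq_integrable01 g"
  shows "sq_integrable01 (\<lambda>x. f x + g x)"
proof -
  have [measurable]: "f \<in> borel_measurable leb01" "g \<in> borel_measurable leb01"
    and i: "integrable leb01 (\<lambda>x. 2 * (cmod (f x))\<^sup>2 + 2 * (cmod (g x))\<^sup>2)"
    using assms by (auto simp: sq_integrable01_def)
  have "integrable leb01 (\<lambda>x. (cmod (f x + g x))\<^sup>2)"
  proof (rule Bochner_Integration.integrable_bound[OF i])
    show "AE x in leb01. norm ((cmod (f x + g x))\<^sup>2) \<le> norm (2 * (cmod (f x))\<^sup>2 + 2 * (cmod (g x))\<^sup>2)"
    proof (rule AE_I2)
      fix x
      have "(cmod (f x + g x))\<^sup>2 \<le> (cmod (f x) + cmod (g x))\<^sup>2"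
        by (intro power_mono norm_triangle_ineq) simp
      moreover have "0 \<le> (cmod (f x) - cmod (g x))\<^sup>2" by simp
      ultimately show "norm ((cmod (f x + g x))\<^sup>2) \<le> norm (2 * (cmod (f x))\<^sup>2 + 2 * (cmod (g x))\<^sup>2)"
        by (simp add: power2_diff power2_sum)
    qed
  qed measurable
  then show ?thesis by (simp add: sq_integrable01_def)
qed

lemma sq_integrable01_scale:
  assumes "sq_integrable01 f"
  shows "sq_integrable01 (\<lambda>x. c * f x)"
  using assms by (auto simp: sq_integrable01_def norm_mult power_mult_distrib)

lemma sq_integrable01_const: "sq_integrable01 (\<lambda>x. c)"
  by (simp add: sq_integrable01_def finite_measure.integrable_const[OF finite_leb01])

lemma sq_integrable01_integrable:
  assumes "sq_integrable01 f"
  shows "integrable leb01 f"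
  using sq_integrable01_prod[OF assms sq_integrable01_const[of 1]] by simp

definition l2_rel :: "(real \<Rightarrow> complex) \<Rightarrow> (real \<Rightarrow> complex) \<Rightarrow> bool" where
  "l2_rel f g \<longleftrightarrow> sq_integrable01 f \<and> sq_integrable01 g \<and> (AE x in leb01. f x = g x)"

quotient_type l2 = "real \<Rightarrow> complex" / partial: l2_rel
proof (rule part_equivpI)
  show "\<exists>f. l2_rel f f"
    using sq_integrable01_const by (auto simp: l2_rel_def)
  show "symp l2_rel"
    by (auto intro!: sympI simp: l2_rel_def elim: AE_mp)
  show "transp l2_rel"
    by (auto intro!: transpI simp: l2_rel_def)
qed

lemma sq_rep_l2: "sq_integrable01 (rep_l2 f)"
  using Quotient3_l2 unfolding Quotient3_def l2_rel_def by blast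

instantiation l2 :: complex_inner
begin

lift_definition zero_l2 :: l2 is "\<lambda>x. 0"
  by (auto simp: l2_rel_def sq_integrable01_const)

lift_definition plus_l2 :: "l2 \<Rightarrow> l2 \<Rightarrow> l2" is "\<lambda>f g x. f x + g x"
  by (auto simp: l2_rel_def sq_integrable01_add)

lift_definition scaleC_l2 :: "complex \<Rightarrow> l2 \<Rightarrow> l2" is "\<lambda>c f x. c * f x"
  by (auto simp: l2_rel_def sq_integrable01_scale)

definition uminus_l2 :: "l2 \<Rightarrow> l2" where "uminus_l2 f = (-1) *\<^sub>C f"

definition minus_l2 :: "l2 \<Rightarrow> l2 \<Rightarrow> l2" where "minus_l2 f g = f + (- g)"

definition scaleR_l2 :: "real \<Rightarrow> l2 \<Rightarrow> l2" where "scaleR_l2 r f = complex_of_real r *\<^sub>C f"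

lift_definition cinner_l2 :: "l2 \<Rightarrow> l2 \<Rightarrow> complex" is "\<lambda>f g. LINT x|leb01. f x * cnj (g x)"
proof -
  fix f f' g g' assume "l2_rel f f'" "l2_rel g g'"
  then have s: "sq_integrable01 f" "sq_integrable01 f'" "sq_integrable01 g" "sq_integrable01 g'"
    and "AE x in leb01. f x = f' x" "AE x in leb01. g x = g' x"
    by (auto simp: l2_rel_def)
  then have "AE x in leb01. f x * cnj (g x) = f' x * cnj (g' x)" by auto
  then show "(LINT x|leb01. f x * cnj (g x)) = (LINT x|leb01. f' x * cnj (g' x))"
    using sq_integrable01_prod[OF s(1,3)] sq_integrable01_prod[OF s(2,4)]
    by (intro integral_cong_AE) auto
qed

definition inner_l2 :: "l2 \<Rightarrow> l2 \<Rightarrow> real" where "inner_l2 f g = Re (cinner f g)"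
definition norm_l2 :: "l2 \<Rightarrow> real" where "norm_l2 f = sqrt (inner f f)"
definition dist_l2 :: "l2 \<Rightarrow> l2 \<Rightarrow> real" where "dist_l2 f g = norm (f - g)"
definition sgn_l2 :: "l2 \<Rightarrow> l2" where "sgn_l2 f = inverse (norm f) *\<^sub>R f"
definition uniformity_l2 :: "(l2 \<times> l2) filter" where
  "uniformity_l2 = (INF e\<in>{0<..}. principal {(x, y). dist x y < e})"
definition open_l2 :: "l2 set \<Rightarrow> bool" where
  "open_l2 U \<longleftrightarrow> (\<forall>x\<in>U. eventually (\<lambda>(x', y). x' = x \<longrightarrow> y \<in> U) uniformity)"

instance
proof
  fix f g h :: l2 and r s :: real and c d :: complex
  note sq = l2_rel_def sq_integrable01_add sq_integrable01_scale sq_integrable01_const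
  show C1: "c *\<^sub>C (f + g) = c *\<^sub>C f + c *\<^sub>C g" for c :: complex and f g :: l2
    by transfer (auto simp: sq algebra_simps)
  show C2: "(c + d) *\<^sub>C f = c *\<^sub>C f + d *\<^sub>C f" for c d :: complex and f :: l2
    by transfer (auto simp: sq algebra_simps)
  show C3: "c *\<^sub>C (d *\<^sub>C f) = (c * d) *\<^sub>C f" for c d :: complex and f :: l2
    by transfer (auto simp: sq algebra_simps)
  show C4: "1 *\<^sub>C f = f" for f :: l2
    by transfer (auto simp: sq)
  show "r *\<^sub>R f = complex_of_real r *\<^sub>C f"
    by (rule scaleR_l2_def)
  show "f + g + h = f + (g + h)"
    by transfer (auto simp: sq algebra_simps)
  show "f + g = g + f"
    by transfer (auto simp: sq algebra_simps)
  show "0 + f = f"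
    by transfer (auto simp: sq)
  show "- f + f = 0"
    unfolding uminus_l2_def by transfer (auto simp: sq)
  show "f - g = f + - g"
    by (rule minus_l2_def)
  show "r *\<^sub>R (f + g) = r *\<^sub>R f + r *\<^sub>R g" "(r + s) *\<^sub>R f = r *\<^sub>R f + s *\<^sub>R f"
    "r *\<^sub>R s *\<^sub>R f = (r * s) *\<^sub>R f" "1 *\<^sub>R f = f"
    by (simp_all add: scaleR_l2_def C1 C2 C3 C4)
  show I1: "cinner f g = cnj (cinner g f)" for f g :: l2
  proof transfer
    fix f g :: "real \<Rightarrow> complex"
    have "cnj (LINT x|leb01. g x * cnj (f x)) = (LINT x|leb01. cnj (g x * cnj (f x)))"
      by (rule Bochner_Integration.integral_cnj[symmetric])
    then show "(LINT x|leb01. f x * cnj (g x)) = cnj (LINT x|leb01. g x * cnj (f x))"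
      by (simp add: mult.commute)
  qed
  show I2: "cinner (f + g) h = cinner f h + cinner g h" for f g h :: l2
    by transfer (simp add: sq_integrable01_prod l2_rel_def algebra_simps)
  show I3: "cinner (c *\<^sub>C f) g = c * cinner f g" for c :: complex and f g :: l2
    by transfer (simp add: mult.assoc)
  show "inner f g = Re (cinner f g)"
    by (rule inner_l2_def)
  show "inner f g = inner g f"
    unfolding inner_l2_def by (subst I1) simp
  show "inner (f + g) h = inner f h + inner g h"
    by (simp add: inner_l2_def I2)
  show "inner (r *\<^sub>R f) g = r * inner f g"
    by (simp add: inner_l2_def scaleR_l2_def I3)
  have eq: "Re (cinner f f) = (LINT x|leb01. (cmod (rep_l2 f x))\<^sup>2)" for f
  proof -
    have "cinner f f = (LINT x|leb01. complex_of_real ((cmod (rep_l2 f x))\<^sup>2))"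
      unfolding cinner_l2.rep_eq by (simp add: complex_norm_square del: of_real_power)
    then show ?thesis by (simp del: of_real_power)
  qed
  show "0 \<le> inner f f"
    unfolding inner_l2_def eq by simp
  show "inner f f = 0 \<longleftrightarrow> f = 0"
  proof
    assume "inner f f = 0"
    then have "(LINT x|leb01. (cmod (rep_l2 f x))\<^sup>2) = 0"
      unfolding inner_l2_def eq .
    moreover have "integrable leb01 (\<lambda>x. (cmod (rep_l2 f x))\<^sup>2)"
      using sq_rep_l2[of f] by (simp add: sq_integrable01_def)
    ultimately have "AE x in leb01. (cmod (rep_l2 f x))\<^sup>2 = 0"
      by (subst (asm) integral_nonneg_eq_0_iff_AE) auto
    then have "l2_rel (rep_l2 f) (\<lambda>x. 0)"
      by (simp add: l2_rel_def sq_rep_l2 sq_integrable01_const)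
    then show "f = 0"
      unfolding zero_l2_def by (metis Quotient3_abs_rep Quotient3_l2 Quotient3_rel)
  next
    assume "f = 0"
    then show "inner f f = 0"
      unfolding inner_l2_def by (simp, transfer) simp
  qed
  show "norm f = sqrt (inner f f)" by (rule norm_l2_def)
  show "dist f g = norm (f - g)" by (rule dist_l2_def)
  show "sgn f = inverse (norm f) *\<^sub>R f" by (rule sgn_l2_def)
  show "(uniformity :: (l2 \<times> l2) filter) = (INF e\<in>{0<..}. principal {(x, y). dist x y < e})"
    by (rule uniformity_l2_def)
  show "open U \<longleftrightarrow> (\<forall>x\<in>U. eventually (\<lambda>(x', y). x' = x \<longrightarrow> y \<in> U) uniformity)" for U :: "l2 set"
    by (rule open_l2_def)
qed

end

lemma rep_abs_l2:
  assumes "sq_integrable01 f"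
  shows "AE x in leb01. rep_l2 (abs_l2 f) x = f x"
proof -
  have "l2_rel f f" using assms by (simp add: l2_rel_def)
  then have "l2_rel (rep_l2 (abs_l2 f)) f"
    by (rule Quotient3_rep_abs[OF Quotient3_l2])
  then show ?thesis by (simp add: l2_rel_def)
qed

lemma abs_rep_l2: "abs_l2 (rep_l2 f) = f"
  by (rule Quotient3_abs_rep[OF Quotient3_l2])

lemma l2_rel_rep: "l2_rel (rep_l2 f) (rep_l2 f)"
  by (simp add: l2_rel_def sq_rep_l2)

lemma l2_eqI:
  assumes "AE x in leb01. rep_l2 f x = rep_l2 g x"
  shows "f = g"
  using assms Quotient3_rel_rep[OF Quotient3_l2, of f g] by (simp add: l2_rel_def sq_rep_l2)

lemma rep_l2_add: "AE x in leb01. rep_l2 (f + g) x = rep_l2 f x + rep_l2 g x"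
proof -
  have "f + g = abs_l2 (\<lambda>x. rep_l2 f x + rep_l2 g x)"
    using plus_l2.abs_eq[OF l2_rel_rep l2_rel_rep, of f g] by (simp add: abs_rep_l2)
  then show ?thesis by (simp add: rep_abs_l2 sq_integrable01_add sq_rep_l2)
qed

lemma rep_l2_scaleC: "AE x in leb01. rep_l2 (c *\<^sub>C f) x = c * rep_l2 f x"
proof -
  have "c *\<^sub>C f = abs_l2 (\<lambda>x. c * rep_l2 f x)"
    using scaleC_l2.abs_eq[OF l2_rel_rep, of c f] by (simp add: abs_rep_l2)
  then show ?thesis by (simp add: rep_abs_l2 sq_integrable01_scale sq_rep_l2)
qed

lemma rep_l2_zero: "AE x in leb01. rep_l2 0 x = 0"
  unfolding zero_l2_def by (rule rep_abs_l2) (rule sq_integrable01_const)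

section \<open>The Sobolev spaces \<open>H\<^sup>1(0,1)\<close> and \<open>H\<^sup>2(0,1)\<close>\<close>

text \<open>\<open>ac_rep h \<phi> g\<close>: the class \<open>\<phi>\<close> has the representative \<open>h\<close>, which is absolutely continuous
  on \<open>[0,1]\<close> with derivative \<open>g \<in> L\<^sup>2(0,1)\<close>, i.e. an indefinite integral of \<open>g\<close>. In one dimension
  the classes with such a representative are exactly the elements of \<open>H\<^sup>1(0,1)\<close>, and \<open>g\<close> is the
  weak derivative. Only the values of \<open>h\<close> on \<open>[0,1]\<close> matter.\<close>

definition ac_rep :: "(real \<Rightarrow> complex) \<Rightarrow> l2 \<Rightarrow> l2 \<Rightarrow> bool" where
  "ac_rep h \<phi> g \<longleftrightarrow> (AE x in leb01. rep_l2 \<phi> x = h x) \<and>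
     (\<forall>x\<in>{0..1}. h x = h 0 + (LINT y:{0..x}|leb01. rep_l2 g y))"

definition H1 :: "l2 set" where
  "H1 = {\<phi>. \<exists>h g. ac_rep h \<phi> g}"

definition h1_deriv :: "l2 \<Rightarrow> l2" where
  "h1_deriv \<phi> = (THE g. \<exists>h. ac_rep h \<phi> g)"

text \<open>Value at \<open>x \<in> [0,1]\<close> of the continuous representative of \<open>\<phi> \<in> H\<^sup>1(0,1)\<close>.\<close>

definition h1_value :: "l2 \<Rightarrow> real \<Rightarrow> complex" where
  "h1_value \<phi> x = (THE c. \<exists>h g. ac_rep h \<phi> g \<and> h x = c)"

definition H2 :: "l2 set" where
  "H2 = {\<phi> \<in> H1. h1_deriv \<phi> \<in> H1}"

lemma set_integrable_leb01:
  assumes "A \<in> sets borel" "integrable leb01 (G :: real \<Rightarrow> complex)"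
  shows "set_integrable leb01 A G"
  unfolding set_integrable_def
proof (rule Bochner_Integration.integrable_bound[OF assms(2)])
  have [measurable]: "(indicator A :: real \<Rightarrow> real) \<in> borel_measurable leb01"
    using assms(1) by (intro measurable_restrict_space1) simp
  show "(\<lambda>x. indicat_real A x *\<^sub>R G x) \<in> borel_measurable leb01"
    using assms(2) by measurable
qed (auto simp: indicator_def)

lemma set_integrable_rep_l2: "A \<in> sets borel \<Longrightarrow> set_integrable leb01 A (rep_l2 g)"
  by (intro set_integrable_leb01 sq_integrable01_integrable sq_rep_l2)

lemma ac_rep_add:
  assumes "ac_rep h \<phi> g" "ac_rep k \<eta> e"
  shows "ac_rep (\<lambda>x. h x + k x) (\<phi> + \<eta>) (g + e)"
proof -
  have lin: "(LINT y:{0..x}|leb01. rep_l2 (g + e) y) =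
      (LINT y:{0..x}|leb01. rep_l2 g y) + (LINT y:{0..x}|leb01. rep_l2 e y)" for x
  proof -
    have "(LINT y:{0..x}|leb01. rep_l2 (g + e) y) = (LINT y:{0..x}|leb01. rep_l2 g y + rep_l2 e y)"
      using rep_l2_add[of g e] set_integrable_rep_l2[of "{0..x}" "g + e"]
        set_integral_add(1)[OF set_integrable_rep_l2[of "{0..x}" g] set_integrable_rep_l2[of "{0..x}" e]]
      unfolding set_lebesgue_integral_def set_integrable_def
      by (intro integral_cong_AE) auto
    also have "\<dots> = (LINT y:{0..x}|leb01. rep_l2 g y) + (LINT y:{0..x}|leb01. rep_l2 e y)"
      by (intro set_integral_add set_integrable_rep_l2) auto
    finally show ?thesis .
  qed
  have "AE x in leb01. rep_l2 (\<phi> + \<eta>) x = h x + k x"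
    using assms rep_l2_add[of \<phi> \<eta>] by (auto simp: ac_rep_def)
  then show ?thesis
    unfolding ac_rep_def
  proof (intro conjI ballI)
    fix x :: real assume x: "x \<in> {0..1}"
    have h: "h x = h 0 + (LINT y:{0..x}|leb01. rep_l2 g y)"
      and k: "k x = k 0 + (LINT y:{0..x}|leb01. rep_l2 e y)"
      using assms x by (auto simp only: ac_rep_def)
    show "h x + k x = h 0 + k 0 + (LINT y:{0..x}|leb01. rep_l2 (g + e) y)"
      unfolding lin by (subst h, subst k) (simp only: add_ac)
  qed
qed

lemma ac_rep_scaleC:
  assumes "ac_rep h \<phi> g"
  shows "ac_rep (\<lambda>x. c * h x) (c *\<^sub>C \<phi>) (c *\<^sub>C g)"
proof -
  have lin: "(LINT y:{0..x}|leb01. rep_l2 (c *\<^sub>C g) y) = c * (LINT y:{0..x}|leb01. rep_l2 g y)" for x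
  proof -
    have "(LINT y:{0..x}|leb01. rep_l2 (c *\<^sub>C g) y) = (LINT y:{0..x}|leb01. c * rep_l2 g y)"
      using rep_l2_scaleC[of c g] set_integrable_rep_l2[of "{0..x}" "c *\<^sub>C g"]
        set_integrable_mult_right[OF set_integrable_rep_l2[of "{0..x}" g], of c]
      unfolding set_lebesgue_integral_def set_integrable_def
      by (intro integral_cong_AE) auto
    then show ?thesis by simp
  qed
  have "AE x in leb01. rep_l2 (c *\<^sub>C \<phi>) x = c * h x"
    using assms rep_l2_scaleC[of c \<phi>] by (auto simp: ac_rep_def)
  then show ?thesis
    unfolding ac_rep_def
  proof (intro conjI ballI)
    fix x :: real assume x: "x \<in> {0..1}"
    have h: "h x = h 0 + (LINT y:{0..x}|leb01. rep_l2 g y)"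
      using assms x by (auto simp only: ac_rep_def)
    show "c * h x = c * h 0 + (LINT y:{0..x}|leb01. rep_l2 (c *\<^sub>C g) y)"
      unfolding lin by (subst h) (simp only: distrib_left)
  qed
qed

lemma continuous_on_primitive:
  assumes "integrable leb01 G"
  shows "continuous_on UNIV (\<lambda>x. LINT y:{0..x}|leb01. (G y :: complex))"
  unfolding continuous_on_sequentially
proof (intro ballI allI impI, unfold comp_def)
  fix u :: "nat \<Rightarrow> real" and a :: real
  assume "(\<forall>n. u n \<in> UNIV) \<and> u \<longlonglongrightarrow> a"
  then have u: "u \<longlonglongrightarrow> a" by simp
  have [measurable]: "G \<in> borel_measurable leb01" using assms by auto
  have [measurable]: "(\<lambda>y. indicator {0..x} y :: real) \<in> borel_measurable leb01" for x :: real
    by (rule measurable_restrict_space1) simp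
  show "(\<lambda>n. LINT y:{0..u n}|leb01. G y) \<longlonglongrightarrow> (LINT y:{0..a}|leb01. G y)"
    unfolding set_lebesgue_integral_def
  proof (rule integral_dominated_convergence[where w = "\<lambda>y. norm (G y)"])
    have "AE y in lborel. y \<noteq> a" by (rule AE_lborel_singleton)
    then have "AE y in leb01. y \<noteq> a" by (subst AE_restrict_space_iff) auto
    then show "AE y in leb01. (\<lambda>n. indicat_real {0..u n} y *\<^sub>R G y) \<longlonglongrightarrow> indicat_real {0..a} y *\<^sub>R G y"
    proof eventually_elim
      fix y assume "y \<noteq> a"
      then consider "y < a" | "a < y" by linarith
      then have "eventually (\<lambda>n. indicat_real {0..u n} y = indicat_real {0..a} y) sequentially"
      proof cases
        case 1
        from order_tendstoD(1)[OF u 1] show ?thesis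
          by eventually_elim (use 1 in \<open>auto simp: indicator_def\<close>)
      next
        case 2
        from order_tendstoD(2)[OF u 2] show ?thesis
          by eventually_elim (use 2 in \<open>auto simp: indicator_def\<close>)
      qed
      then show "(\<lambda>n. indicat_real {0..u n} y *\<^sub>R G y) \<longlonglongrightarrow> indicat_real {0..a} y *\<^sub>R G y"
        by (intro tendsto_eventually) (auto elim: eventually_mono)
    qed
  next
    show "AE y in leb01. norm (indicat_real {0..u n} y *\<^sub>R G y) \<le> norm (G y)" for n
      by (simp add: indicator_def)
  qed (use assms in \<open>simp_all, measurable\<close>)
qed

lemma primitive_zero_imp_AE_zero:
  assumes G: "integrable leb01 (G :: real \<Rightarrow> complex)"
    and zero: "\<And>x. x \<in> {0..1} \<Longrightarrow> (LINT y:{0..x}|leb01. G y) = 0"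
  shows "AE x in leb01. G x = 0"
proof (rule sigma_finite_measure.density_zero[OF _ G])
  show "sigma_finite_measure leb01"
    using finite_leb01 by (simp add: finite_measure_def)
  have z: "(LINT y:{..x}|leb01. G y) = 0" for x :: real
  proof -
    have "(LINT y:{..x}|leb01. G y) = (LINT y:{0..max 0 (min 1 x)}|leb01. G y)"
      unfolding set_lebesgue_integral_def
      by (intro Bochner_Integration.integral_cong) (auto simp: indicator_def space_restrict_space)
    then show ?thesis using zero by simp
  qed
  have u: "integral\<^sup>L leb01 G = 0"
  proof -
    have "integral\<^sup>L leb01 G = (LINT y:{..1}|leb01. G y)"
      unfolding set_lebesgue_integral_def
      by (intro Bochner_Integration.integral_cong) (auto simp: indicator_def space_restrict_space)
    then show ?thesis using z by simp
  qed
  have int: "set_integrable leb01 A G" if "A \<in> sets borel" for A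
    using that G by (rule set_integrable_leb01)
  have bor: "sigma_sets UNIV (range atMost) = sets (borel :: real measure)"
    by (simp add: borel_eq_atMost)
  have stable: "Int_stable (range (atMost :: real \<Rightarrow> real set))"
    by (auto simp: Int_stable_def)
  have sub: "range (atMost :: real \<Rightarrow> real set) \<subseteq> Pow UNIV" by simp
  have main: "(LINT y:A|leb01. G y) = 0" if "A \<in> sigma_sets UNIV (range (atMost :: real \<Rightarrow> real set))" for A
    using stable sub that
  proof (induction rule: sigma_sets_induct_disjoint)
    case (basic A)
    then show ?case using z by auto
  next
    case empty
    show ?case by (simp add: set_lebesgue_integral_def)
  next
    case (compl A)
    then have A: "A \<in> sets borel" by (simp add: bor)
    have "(LINT y:UNIV|leb01. G y) = (LINT y:A \<union> (UNIV - A)|leb01. G y)" by simp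
    also have "\<dots> = (LINT y:A|leb01. G y) + (LINT y:UNIV - A|leb01. G y)"
      by (intro set_integral_Un int) (use A in auto)
    finally show ?case using compl u by (simp add: set_lebesgue_integral_def)
  next
    case (union A)
    then have A: "A i \<in> sets borel" for i by (auto simp: bor)
    have cut: "(LINT y:B \<inter> {0<..<1}|leb01. G y) = (LINT y:B|leb01. G y)" for B :: "real set"
      unfolding set_lebesgue_integral_def
      by (intro Bochner_Integration.integral_cong) (auto simp: indicator_def space_restrict_space)
    have "(LINT y:(\<Union>i. A i \<inter> {0<..<1})|leb01. G y) = (\<Sum>i. LINT y:A i \<inter> {0<..<1}|leb01. G y)"
    proof (rule lebesgue_integral_countable_add)
      show "A i \<inter> {0<..<1} \<in> sets leb01" for i
        using A by (auto simp: sets_restrict_space)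
      show "A i \<inter> {0<..<1} \<inter> (A j \<inter> {0<..<1}) = {}" if "i \<noteq> j" for i j
        using union that by (auto simp: disjoint_family_on_def)
      show "set_integrable leb01 (\<Union>i. A i \<inter> {0<..<1}) G"
        using A by (intro int) auto
    qed
    then have "(LINT y:(\<Union>i. A i)|leb01. G y) = (\<Sum>i. LINT y:A i|leb01. G y)"
      using cut[of "\<Union>i. A i"] by (simp add: cut)
    then show ?case using union by simp
  qed
  fix B assume "B \<in> sets leb01"
  then have "B \<in> sets borel" by (auto simp: sets_restrict_space)
  then show "set_lebesgue_integral leb01 B G = 0"
    using main by (simp add: bor)
qed

lemma minus_scaleC: "- x = (-1) *\<^sub>C (x :: 'a::complex_inner)"
  using scaleR_scaleC[of "-1" x] by simp

lemma ac_rep_0: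
  assumes "ac_rep h 0 g"
  shows "g = 0" "\<forall>x\<in>{0..1}. h x = 0"
proof -
  define P where "P = (\<lambda>x. h 0 + (LINT y:{0..x}|leb01. rep_l2 g y))"
  have h: "h x = P x" if "x \<in> {0..1}" for x
    using assms that unfolding ac_rep_def P_def by blast
  have cont: "continuous_on UNIV P"
    unfolding P_def
    by (intro continuous_intros continuous_on_primitive sq_integrable01_integrable sq_rep_l2)
  have "AE x in leb01. rep_l2 0 x = h x"
    using assms by (simp add: ac_rep_def)
  then have "AE x in leb01. h x = 0"
    using rep_l2_zero by eventually_elim simp
  then have "AE x in lborel. x \<in> {0<..<1} \<longrightarrow> P x = 0"
    by (subst (asm) AE_restrict_space_iff) (auto simp: h)
  then have ae: "AE x in lebesgue. x \<in> {0<..<1} \<longrightarrow> x \<in> {x. P x = 0}"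
    by (auto intro: AE_completion)
  have cl: "closed {x. P x = 0}"
    using continuous_closed_preimage_constant[OF cont closed_UNIV] by simp
  have "{0<..<1} \<subseteq> {x. P x = 0}"
    using mem_closed_if_AE_lebesgue_open[OF open_greaterThanLessThan cl ae] by blast
  then have "closure {0<..<1} \<subseteq> {x. P x = 0}"
    by (rule closure_minimal[OF _ cl])
  then have P: "P x = 0" if "x \<in> {0..1}" for x
    using that by auto
  then show "\<forall>x\<in>{0..1}. h x = 0"
    by (simp add: h)
  have "h 0 = 0" using h[of 0] P[of 0] by simp
  then have "(LINT y:{0..x}|leb01. rep_l2 g y) = 0" if "x \<in> {0..1}" for x
    using P[OF that] by (simp add: P_def)
  then have "AE x in leb01. rep_l2 g x = 0"
    by (intro primitive_zero_imp_AE_zero sq_integrable01_integrable sq_rep_l2) auto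
  then have "AE x in leb01. rep_l2 g x = rep_l2 0 x"
    using rep_l2_zero by eventually_elim simp
  then show "g = 0" by (rule l2_eqI)
qed

lemma ac_rep_unique:
  assumes "ac_rep h \<phi> g" "ac_rep k \<phi> e"
  shows "g = e" "\<forall>x\<in>{0..1}. h x = k x"
proof -
  have "ac_rep (\<lambda>x. h x + (-1) * k x) (\<phi> + (-1) *\<^sub>C \<phi>) (g + (-1) *\<^sub>C e)"
    by (intro ac_rep_add ac_rep_scaleC assms)
  then have "ac_rep (\<lambda>x. h x + (-1) * k x) 0 (g - e)"
    by (simp flip: minus_scaleC)
  from ac_rep_0[OF this] show "g = e" "\<forall>x\<in>{0..1}. h x = k x"
    by auto
qed

lemma ac_rep_deriv: "ac_rep h \<phi> g \<Longrightarrow> h1_deriv \<phi> = g"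
  unfolding h1_deriv_def by (rule the_equality) (auto dest: ac_rep_unique(1))

lemma ac_rep_value: "ac_rep h \<phi> g \<Longrightarrow> x \<in> {0..1} \<Longrightarrow> h1_value \<phi> x = h x"
  unfolding h1_value_def by (rule the_equality) (auto dest: ac_rep_unique(2))

lemma ac_rep_H1: "ac_rep h \<phi> g \<Longrightarrow> \<phi> \<in> H1"
  by (auto simp: H1_def)

lemma H1_ac_rep:
  assumes "\<phi> \<in> H1" obtains h where "ac_rep h \<phi> (h1_deriv \<phi>)"
  using assms ac_rep_deriv unfolding H1_def by blast

lemma H1_add:
  assumes "\<phi> \<in> H1" "\<eta> \<in> H1"
  shows "\<phi> + \<eta> \<in> H1" "h1_deriv (\<phi> + \<eta>) = h1_deriv \<phi> + h1_deriv \<eta>"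
    "x \<in> {0..1} \<Longrightarrow> h1_value (\<phi> + \<eta>) x = h1_value \<phi> x + h1_value \<eta> x"
proof -
  obtain h k where hk: "ac_rep h \<phi> (h1_deriv \<phi>)" "ac_rep k \<eta> (h1_deriv \<eta>)"
    using assms by (metis H1_ac_rep)
  note sum = ac_rep_add[OF hk]
  show "\<phi> + \<eta> \<in> H1" "h1_deriv (\<phi> + \<eta>) = h1_deriv \<phi> + h1_deriv \<eta>"
    "x \<in> {0..1} \<Longrightarrow> h1_value (\<phi> + \<eta>) x = h1_value \<phi> x + h1_value \<eta> x"
    using ac_rep_H1[OF sum] ac_rep_deriv[OF sum] ac_rep_value[OF sum]
      ac_rep_value[OF hk(1)] ac_rep_value[OF hk(2)] by auto
qed

lemma H1_scaleC:
  assumes "\<phi> \<in> H1"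
  shows "c *\<^sub>C \<phi> \<in> H1" "h1_deriv (c *\<^sub>C \<phi>) = c *\<^sub>C h1_deriv \<phi>"
    "x \<in> {0..1} \<Longrightarrow> h1_value (c *\<^sub>C \<phi>) x = c * h1_value \<phi> x"
proof -
  obtain h where h: "ac_rep h \<phi> (h1_deriv \<phi>)"
    using assms by (metis H1_ac_rep)
  note mult = ac_rep_scaleC[OF h]
  show "c *\<^sub>C \<phi> \<in> H1" "h1_deriv (c *\<^sub>C \<phi>) = c *\<^sub>C h1_deriv \<phi>"
    "x \<in> {0..1} \<Longrightarrow> h1_value (c *\<^sub>C \<phi>) x = c * h1_value \<phi> x"
    using ac_rep_H1[OF mult] ac_rep_deriv[OF mult] ac_rep_value[OF mult] ac_rep_value[OF h]
    by auto
qed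

lemma primitive_zero: "(LINT y:{0..x}|leb01. rep_l2 0 y) = 0"
proof -
  have "(LINT y:{0..x}|leb01. rep_l2 0 y) = (LINT y:{0..x}|leb01. 0)" for x
    using rep_l2_zero set_integrable_rep_l2[of "{0..x}" 0]
    unfolding set_lebesgue_integral_def set_integrable_def
    by (intro integral_cong_AE) auto
  then show ?thesis by (simp add: set_lebesgue_integral_def)
qed

lemma H1_zero: "0 \<in> H1" "h1_deriv 0 = 0" "x \<in> {0..1} \<Longrightarrow> h1_value 0 x = 0"
proof -
  have "ac_rep (\<lambda>x. 0) 0 0"
    using rep_l2_zero by (simp add: ac_rep_def primitive_zero)
  from ac_rep_H1[OF this] ac_rep_deriv[OF this] ac_rep_value[OF this]
  show "0 \<in> H1" "h1_deriv 0 = 0" "x \<in> {0..1} \<Longrightarrow> h1_value 0 x = 0" by auto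
qed

lemma H1_eq_0:
  assumes "\<phi> \<in> H1" "h1_deriv \<phi> = 0" "h1_value \<phi> 0 = 0"
  shows "\<phi> = 0"
proof -
  obtain h where h: "ac_rep h \<phi> 0"
    using assms by (metis H1_ac_rep)
  have h0: "h 0 = 0"
    using ac_rep_value[OF h, of 0] assms(3) by simp
  have "h x = h 0 + (LINT y:{0..x}|leb01. rep_l2 0 y)" if "x \<in> {0..1}" for x
    using h that unfolding ac_rep_def by blast
  then have z: "h x = 0" if "x \<in> {0..1}" for x
    using that by (simp only: h0 primitive_zero add_0)
  have "AE x in leb01. rep_l2 \<phi> x = h x"
    using h by (simp add: ac_rep_def)
  moreover have "AE x in leb01. x \<in> {0<..<1}"
    by (rule AE_I2) (simp add: space_restrict_space)
  ultimately have "AE x in leb01. rep_l2 \<phi> x = rep_l2 0 x"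
    using rep_l2_zero by eventually_elim (simp add: z)
  then show ?thesis by (rule l2_eqI)
qed


section \<open>The state space \<open>H\<^sup>1(0,1) \<times> L\<^sup>2(0,1)\<close>\<close>

typedef wave_state = "{(\<phi>, \<psi>). \<phi> \<in> H1} :: (l2 \<times> l2) set"
  using H1_zero(1) by auto

setup_lifting type_definition_wave_state

definition mk_state :: "l2 \<Rightarrow> l2 \<Rightarrow> wave_state" where
  "mk_state \<phi> \<psi> = Abs_wave_state (\<phi>, \<psi>)"

definition pos :: "wave_state \<Rightarrow> l2" where "pos z = fst (Rep_wave_state z)"

definition vel :: "wave_state \<Rightarrow> l2" where "vel z = snd (Rep_wave_state z)"

lemma pos_mk_state: "\<phi> \<in> H1 \<Longrightarrow> pos (mk_state \<phi> \<psi>) = \<phi>"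
  by (simp add: pos_def mk_state_def Abs_wave_state_inverse)

lemma vel_mk_state: "\<phi> \<in> H1 \<Longrightarrow> vel (mk_state \<phi> \<psi>) = \<psi>"
  by (simp add: vel_def mk_state_def Abs_wave_state_inverse)

lemma pos_H1: "pos z \<in> H1"
  using Rep_wave_state[of z] by (auto simp: pos_def)

lemma wave_state_eqI: "pos z = pos y \<Longrightarrow> vel z = vel y \<Longrightarrow> z = y"
  unfolding pos_def vel_def by (metis Rep_wave_state_inject prod.expand)

instantiation wave_state :: complex_inner
begin

definition zero_wave_state :: wave_state where "zero_wave_state = mk_state 0 0"

definition plus_wave_state :: "wave_state \<Rightarrow> wave_state \<Rightarrow> wave_state" where
  "plus_wave_state z y = mk_state (pos z + pos y) (vel z + vel y)"

definition scaleC_wave_state :: "complex \<Rightarrow> wave_state \<Rightarrow> wave_state" where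
  "scaleC_wave_state c z = mk_state (c *\<^sub>C pos z) (c *\<^sub>C vel z)"

definition uminus_wave_state :: "wave_state \<Rightarrow> wave_state" where
  "uminus_wave_state z = (-1) *\<^sub>C z"

definition minus_wave_state :: "wave_state \<Rightarrow> wave_state \<Rightarrow> wave_state" where
  "minus_wave_state z y = z + (- y)"

definition scaleR_wave_state :: "real \<Rightarrow> wave_state \<Rightarrow> wave_state" where
  "scaleR_wave_state r z = complex_of_real r *\<^sub>C z"

definition cinner_wave_state :: "wave_state \<Rightarrow> wave_state \<Rightarrow> complex" where
  "cinner_wave_state z y = cinner (h1_deriv (pos z)) (h1_deriv (pos y)) + cinner (vel z) (vel y)
     + h1_value (pos z) 0 * cnj (h1_value (pos y) 0)"

definition inner_wave_state :: "wave_state \<Rightarrow> wave_state \<Rightarrow> real" where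
  "inner_wave_state z y = Re (cinner z y)"
definition norm_wave_state :: "wave_state \<Rightarrow> real" where "norm_wave_state z = sqrt (inner z z)"
definition dist_wave_state :: "wave_state \<Rightarrow> wave_state \<Rightarrow> real" where
  "dist_wave_state z y = norm (z - y)"
definition sgn_wave_state :: "wave_state \<Rightarrow> wave_state" where
  "sgn_wave_state z = inverse (norm z) *\<^sub>R z"
definition uniformity_wave_state :: "(wave_state \<times> wave_state) filter" where
  "uniformity_wave_state = (INF e\<in>{0<..}. principal {(x, y). dist x y < e})"
definition open_wave_state :: "wave_state set \<Rightarrow> bool" where
  "open_wave_state U \<longleftrightarrow> (\<forall>x\<in>U. eventually (\<lambda>(x', y). x' = x \<longrightarrow> y \<in> U) uniformity)"

instance
proof
  fix f g h :: wave_state and r s :: real and c d :: complex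
  have pv0: "pos 0 = 0" "vel 0 = 0"
    by (simp_all add: zero_wave_state_def pos_mk_state vel_mk_state H1_zero)
  have pvp: "pos (z + y) = pos z + pos y" "vel (z + y) = vel z + vel y" for z y :: wave_state
    by (simp_all add: plus_wave_state_def pos_mk_state vel_mk_state H1_add pos_H1)
  have pvs: "pos (a *\<^sub>C z) = a *\<^sub>C pos z" "vel (a *\<^sub>C z) = a *\<^sub>C vel z" for a and z :: wave_state
    by (simp_all add: scaleC_wave_state_def pos_mk_state vel_mk_state H1_scaleC pos_H1)
  note pv = pv0 pvp pvs
  show C1: "c *\<^sub>C (f + g) = c *\<^sub>C f + c *\<^sub>C g" for c :: complex and f g :: wave_state
    by (rule wave_state_eqI) (simp_all add: pv scaleC_add_right)
  show C2: "(c + d) *\<^sub>C f = c *\<^sub>C f + d *\<^sub>C f" for c d :: complex and f :: wave_state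
    by (rule wave_state_eqI) (simp_all add: pv scaleC_add_left)
  show C3: "c *\<^sub>C (d *\<^sub>C f) = (c * d) *\<^sub>C f" for c d :: complex and f :: wave_state
    by (rule wave_state_eqI) (simp_all add: pv scaleC_scaleC)
  show C4: "1 *\<^sub>C f = f" for f :: wave_state
    by (rule wave_state_eqI) (simp_all add: pv scaleC_one)
  show "r *\<^sub>R f = complex_of_real r *\<^sub>C f"
    by (rule scaleR_wave_state_def)
  show "f + g + h = f + (g + h)"
    by (rule wave_state_eqI) (simp_all add: pv)
  show "f + g = g + f"
    by (rule wave_state_eqI) (simp_all add: pv)
  show "0 + f = f"
    by (rule wave_state_eqI) (simp_all add: pv)
  show "- f + f = 0"
    by (rule wave_state_eqI) (simp_all add: uminus_wave_state_def pv flip: minus_scaleC)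
  show "f - g = f + - g"
    by (rule minus_wave_state_def)
  show "r *\<^sub>R (f + g) = r *\<^sub>R f + r *\<^sub>R g" "(r + s) *\<^sub>R f = r *\<^sub>R f + s *\<^sub>R f"
    "r *\<^sub>R s *\<^sub>R f = (r * s) *\<^sub>R f" "1 *\<^sub>R f = f"
    by (simp_all add: scaleR_wave_state_def C1 C2 C3 C4)
  show I1: "cinner f g = cnj (cinner g f)" for f g :: wave_state
    unfolding cinner_wave_state_def
    by (subst (1 2) cinner_commute) (simp add: mult.commute)
  show I2: "cinner (f + g) h = cinner f h + cinner g h" for f g h :: wave_state
    by (simp add: cinner_wave_state_def pv H1_add pos_H1 cinner_add_left algebra_simps)
  show I3: "cinner (c *\<^sub>C f) g = c * cinner f g" for c :: complex and f g :: wave_state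
    by (simp add: cinner_wave_state_def pv H1_scaleC pos_H1 cinner_scaleC_left algebra_simps)
  show "inner f g = Re (cinner f g)"
    by (rule inner_wave_state_def)
  show "inner f g = inner g f"
    unfolding inner_wave_state_def by (subst I1) simp
  show "inner (f + g) h = inner f h + inner g h"
    by (simp add: inner_wave_state_def I2)
  show "inner (r *\<^sub>R f) g = r * inner f g"
    by (simp add: inner_wave_state_def scaleR_wave_state_def I3)
  have eq: "Re (cinner f f) = (norm (h1_deriv (pos f)))\<^sup>2 + (norm (vel f))\<^sup>2
      + (cmod (h1_value (pos f) 0))\<^sup>2" for f :: wave_state
  proof -
    have "(norm x)\<^sup>2 = Re (cinner x x)" for x :: l2
      by (simp only: power2_norm_eq_inner inner_Re_cinner)
    moreover have "Re (a * cnj a) = (cmod a)\<^sup>2" for a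
      by (simp add: cmod_power2 flip: power2_eq_square)
    ultimately show ?thesis by (simp only: cinner_wave_state_def plus_complex.sel)
  qed
  show "0 \<le> inner f f"
    unfolding inner_wave_state_def eq by simp
  show "inner f f = 0 \<longleftrightarrow> f = 0"
  proof
    assume "inner f f = 0"
    then have "h1_deriv (pos f) = 0" "vel f = 0" "h1_value (pos f) 0 = 0"
      unfolding inner_wave_state_def eq
      by (simp_all add: add_nonneg_eq_0_iff)
    then show "f = 0"
      by (intro wave_state_eqI) (auto simp: pv intro: H1_eq_0 pos_H1)
  next
    assume "f = 0"
    then show "inner f f = 0"
      unfolding inner_wave_state_def eq by (simp add: pv H1_zero)
  qed
  show "norm f = sqrt (inner f f)" by (rule norm_wave_state_def)
  show "dist f g = norm (f - g)" by (rule dist_wave_state_def)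
  show "sgn f = inverse (norm f) *\<^sub>R f" by (rule sgn_wave_state_def)
  show "(uniformity :: (wave_state \<times> wave_state) filter) = (INF e\<in>{0<..}. principal {(x, y). dist x y < e})"
    by (rule uniformity_wave_state_def)
  show "open U \<longleftrightarrow> (\<forall>x\<in>U. eventually (\<lambda>(x', y). x' = x \<longrightarrow> y \<in> U) uniformity)"
    for U :: "wave_state set"
    by (rule open_wave_state_def)
qed

end


section \<open>Unitary groups and control operators\<close>

definition unitary_group :: "(real \<Rightarrow> 'a::complex_inner \<Rightarrow> 'a) \<Rightarrow> bool" where
  "unitary_group T \<longleftrightarrow> (\<forall>t. unitary (T t)) \<and> T 0 = id \<and> (\<forall>s t. T (s + t) = T s \<circ> T t) \<and>
     (\<forall>x. continuous_on UNIV (\<lambda>t. T t x))"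

text \<open>An unbounded operator is given by its domain \<open>D\<close> and a function \<open>A\<close> used only on \<open>D\<close>.\<close>

definition generates :: "'a::complex_inner set \<Rightarrow> ('a \<Rightarrow> 'a) \<Rightarrow> (real \<Rightarrow> 'a \<Rightarrow> 'a) \<Rightarrow> bool" where
  "generates D A T \<longleftrightarrow>
     D = {x. \<exists>y. ((\<lambda>h. (T h x - x) /\<^sub>R h) \<longlongrightarrow> y) (at 0)} \<and>
     (\<forall>x\<in>D. ((\<lambda>h. (T h x - x) /\<^sub>R h) \<longlongrightarrow> A x) (at 0))"

definition adj_dom :: "'a::complex_inner set \<Rightarrow> ('a \<Rightarrow> 'a) \<Rightarrow> 'a set" where
  "adj_dom D A = {y. \<exists>y'. \<forall>x\<in>D. cinner (A x) y = cinner x y'}"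

definition adj_op :: "'a::complex_inner set \<Rightarrow> ('a \<Rightarrow> 'a) \<Rightarrow> 'a \<Rightarrow> 'a" where
  "adj_op D A y = (THE y'. \<forall>x\<in>D. cinner (A x) y = cinner x y')"

text \<open>The pairing with \<open>\<D>(A\<^sup>*)\<close> is linear in the first and antilinear in the second argument, like
  the inner product: elements of \<open>\<D>(A\<^sup>*)'\<close> are antilinear functionals on \<open>\<D>(A\<^sup>*)\<close> bounded in the
  graph norm, represented as functions whose values outside \<open>\<D>(A\<^sup>*)\<close> are irrelevant, and \<open>x\<close> in the
  pivot space is identified with \<open>cinner x\<close>. The operator \<open>control_op b\<close> is the one with adjoint
  \<open>b = B\<^sup>* : \<D>(A\<^sup>*) \<rightarrow> \<complex>\<close>.\<close>

definition control_op :: "('a \<Rightarrow> complex) \<Rightarrow> complex \<Rightarrow> 'a \<Rightarrow> complex" where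
  "control_op b v z = v * cnj (b z)"

definition bounded_control :: "'a::complex_inner set \<Rightarrow> ('a \<Rightarrow> 'a) \<Rightarrow> (complex \<Rightarrow> 'a \<Rightarrow> complex) \<Rightarrow> bool"
  where
  "bounded_control D A B \<longleftrightarrow>
     (\<forall>v. \<forall>y\<in>adj_dom D A. \<forall>z\<in>adj_dom D A. B v (y + z) = B v y + B v z) \<and>
     (\<forall>c v. \<forall>z\<in>adj_dom D A. B v (c *\<^sub>C z) = cnj c * B v z) \<and>
     (\<forall>v w. \<forall>z\<in>adj_dom D A. B (v + w) z = B v z + B w z) \<and>
     (\<forall>c v. \<forall>z\<in>adj_dom D A. B (c * v) z = c * B v z) \<and>
     (\<exists>C. \<forall>v. \<forall>z\<in>adj_dom D A. cmod (B v z) \<le> C * cmod v * (norm z + norm (adj_op D A z)))"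

text \<open>The extension of a bounded operator \<open>S\<close> on the pivot space to \<open>\<D>(A\<^sup>*)'\<close>, by duality.\<close>

definition ext_op :: "('a::complex_inner \<Rightarrow> 'a) \<Rightarrow> ('a \<Rightarrow> complex) \<Rightarrow> 'a \<Rightarrow> complex" where
  "ext_op S F z = F (adj_op UNIV S z)"

text \<open>\<open>has_dual_integral D A I F G\<close>: \<open>\<integral>\<^sub>I F(s) ds = G\<close> in \<open>\<D>(A\<^sup>*)'\<close>.\<close>

definition has_dual_integral ::
  "'a::complex_inner set \<Rightarrow> ('a \<Rightarrow> 'a) \<Rightarrow> real set \<Rightarrow> (real \<Rightarrow> 'a \<Rightarrow> complex) \<Rightarrow> ('a \<Rightarrow> complex) \<Rightarrow> bool"
  where
  "has_dual_integral D A I F G \<longleftrightarrow>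
     (\<forall>z\<in>adj_dom D A. set_integrable lebesgue I (\<lambda>s. F s z) \<and> (LINT s:I|lebesgue. F s z) = G z)"

definition sq_integrable_on :: "real set \<Rightarrow> (real \<Rightarrow> complex) \<Rightarrow> bool" where
  "sq_integrable_on I u \<longleftrightarrow>
     set_borel_measurable lebesgue I u \<and> set_integrable lebesgue I (\<lambda>s. (cmod (u s))\<^sup>2)"

definition L2_loc :: "(real \<Rightarrow> complex) \<Rightarrow> bool" where
  "L2_loc u \<longleftrightarrow> (\<forall>\<tau>>0. sq_integrable_on {0..\<tau>} u)"

text \<open>Admissibility: for some \<open>\<tau> > 0\<close> the input map
  \<open>u \<mapsto> \<integral>\<^sub>0\<^sup>\<tau> e\<^bsup>A(\<tau>-s)\<^esup> B u(s) ds\<close> takes \<open>L\<^sup>2(0,\<tau>)\<close> into the pivot space.\<close>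

definition admissible ::
  "'a::complex_inner set \<Rightarrow> ('a \<Rightarrow> 'a) \<Rightarrow> (real \<Rightarrow> 'a \<Rightarrow> 'a) \<Rightarrow> (complex \<Rightarrow> 'a \<Rightarrow> complex) \<Rightarrow> bool" where
  "admissible D A T B \<longleftrightarrow> bounded_control D A B \<and>
     (\<exists>\<tau>>0. \<forall>u. sq_integrable_on {0..\<tau>} u \<longrightarrow>
        (\<exists>x. has_dual_integral D A {0..\<tau>} (\<lambda>s. ext_op (T (\<tau> - s)) (B (u s))) (cinner x)))"


section \<open>The wave system\<close>

definition wave_dom :: "wave_state set" where
  "wave_dom = {z. pos z \<in> H2 \<and> vel z \<in> H1 \<and>
     h1_value (h1_deriv (pos z)) 0 = h1_value (pos z) 0 \<and> h1_value (h1_deriv (pos z)) 1 = 0}"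

definition wave_op :: "wave_state \<Rightarrow> wave_state" where
  "wave_op z = mk_state (vel z) (h1_deriv (h1_deriv (pos z)))"

definition B1 :: "complex \<Rightarrow> wave_state \<Rightarrow> complex" where
  "B1 = control_op (\<lambda>z. - h1_value (vel z) 0)"

definition B2 :: "complex \<Rightarrow> wave_state \<Rightarrow> complex" where
  "B2 = control_op (\<lambda>z. h1_value (vel z) 1)"

text \<open>The state is \<open>X(t) = (w(\<cdot>,t), w\<^sub>t(\<cdot>,t))\<close>, and the identity
  \<open>X(t) - e\<^bsup>At\<^esup> X\<^sub>0 = \<integral>\<^sub>0\<^sup>t e\<^bsup>A(t-s)\<^esup> [- B\<^sub>1 ((q+1) w(0,s)) + B\<^sub>2 (f(X(s)) + u(s) + d(s))] ds\<close>
  holds in \<open>\<D>(A\<^sup>*)'\<close>.\<close>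

definition mild_solution ::
  "(real \<Rightarrow> wave_state \<Rightarrow> wave_state) \<Rightarrow> real \<Rightarrow> (wave_state \<Rightarrow> real) \<Rightarrow> (real \<Rightarrow> complex) \<Rightarrow>
    (real \<Rightarrow> complex) \<Rightarrow> wave_state \<Rightarrow> (real \<Rightarrow> wave_state) \<Rightarrow> bool" where
  "mild_solution T q f u d X0 X \<longleftrightarrow> continuous_on {0..} X \<and> X 0 = X0 \<and>
     (\<forall>t\<ge>0. has_dual_integral wave_dom wave_op {0..t}
        (\<lambda>s. ext_op (T (t - s))
           (\<lambda>z. - B1 (of_real (q + 1) * h1_value (pos (X s)) 0) z
                + B2 (of_real (f (X s)) + u s + d s) z))
        (cinner (X t - T t X0)))"

end

theory Submission
  imports Defs
begin

text \<open>The idea is to work with the bounded inverse \<open>K = A\<^sup>-\<^sup>1\<close> of the wave operator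
  \<open>A\<close>. Integration by parts shows that \<open>A\<close> is skew-symmetric, and solving \<open>\<phi>'' = g\<close>, \<open>\<phi>'(1) = 0\<close>, \<open>\<phi>(0) = \<phi>'(0)\<close> by two
  integrations shows that it is onto (\<open>wave_inv\<close>). Skew-symmetry and surjectivity together make \<open>A\<close> maximal,
  which gives \<open>A\<^sup>* = -A\<close> with equal domains.

  The group is obtained as for Stone's theorem: the bounded skew operators
  \<open>((K + \<epsilon>)\<^sup>-\<^sup>1 + (K - \<epsilon>)\<^sup>-\<^sup>1)/2\<close> tend to \<open>K\<^sup>-\<^sup>1\<close> on \<open>range K\<close> as \<open>\<epsilon> \<rightarrow> 0\<close>, and their exponentials,
  which are isometries, converge locally uniformly in time (\<open>skew_flow_exists\<close>). The limit commutes
  with \<open>K\<close>, and this identifies its generator as \<open>A\<close>.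

  Admissibility is a hidden regularity statement for the free system: multiplying the wave equation by
  \<open>x w\<^sub>x\<close> or \<open>(x - 1) w\<^sub>x\<close> gives \<open>\<integral>\<^sub>0\<^sup>\<tau> |w\<^sub>t(a,t)|\<^sup>2 dt \<le> (2 + \<tau>) ||(w,w\<^sub>t)||\<^sup>2\<close> at both ends \<open>a\<close>
  (\<open>trace_energy\<close>). By duality, that is by Riesz representation on the dense subspace \<open>D(A)\<close>, an input \<open>v\<close> in
  \<open>L\<^sup>2\<close> has a state \<open>J(t) = \<integral>\<^sub>0\<^sup>t e\<^bsup>-As\<^esup> B v(s) ds\<close> in the energy space, and
  \<open>||J(t) - J(s)||\<^sup>2 \<le> (2 + t - s) \<integral>\<^sub>s\<^sup>t |v|\<^sup>2\<close>. Hence \<open>J\<close> is continuous, and a mild solution is a continuous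
  fixed point of \<open>X(t) = e\<^bsup>At\<^esup> (X\<^sub>0 + J\<^sub>1(t) + J\<^sub>2(t))\<close>, where the inputs \<open>-(q + 1) w(0,\<cdot>)\<close> and \<open>f(X) + u + d\<close>
  depend on \<open>X\<close> in a Lipschitz way. The estimate makes this a Volterra equation, which has exactly one
  global solution (locale \<open>volterra\<close>).

  The remaining claim \<open>w' = w\<^sub>t\<close> concerns the \<open>L\<^sup>2\<close> norm only. Since \<open>w\<close> is the velocity component of \<open>K X\<close>,
  the free part of \<open>X\<close> is differentiable by \<open>d/dt e\<^bsup>At\<^esup> K z = e\<^bsup>At\<^esup> z\<close>; the contribution of the inputs on a
  time interval of length \<open>h\<close> is \<open>o(h)\<close> in this component, because states without displacement are not
  observed at the boundary after applying \<open>K\<close> (\<open>input_part_derivative\<close>).\<close>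

section \<open>Riesz representation on a subspace\<close>

text \<open>A minimiser of \<open>||z||\<^sup>2 - 2 g z\<close> over \<open>S\<close> represents \<open>g\<close>. The subspace need not be closed, so one statement
  serves three purposes: the representation of functionals known only on a dense subspace, orthogonal
  projection (with \<open>g = inner y\<close>), and hence the density criterion below.\<close>

lemma riesz_on_subspace:
  fixes g :: "'a::{real_inner,banach} \<Rightarrow> real"
  assumes S: "subspace S"
    and add: "\<And>x y. x \<in> S \<Longrightarrow> y \<in> S \<Longrightarrow> g (x + y) = g x + g y"
    and scale: "\<And>c x. x \<in> S \<Longrightarrow> g (c *\<^sub>R x) = c * g x"
    and bound: "\<And>x. x \<in> S \<Longrightarrow> \<bar>g x\<bar> \<le> C * norm x"
  obtains x where "x \<in> closure S" "\<And>z. z \<in> S \<Longrightarrow> inner x z = g z"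
proof -
  define E where "E z = (norm z)\<^sup>2 - 2 * g z" for z
  define m where "m = Inf (E ` S)"
  have low: "- C\<^sup>2 \<le> E z" if "z \<in> S" for z
  proof -
    have "0 \<le> (norm z - C)\<^sup>2" by simp
    then show ?thesis using bound[OF that]
      by (auto simp: E_def power2_eq_square algebra_simps abs_le_iff)
  qed
  have bdd: "bdd_below (E ` S)" using low by (rule bdd_belowI2)
  have m_le: "m \<le> E z" if "z \<in> S" for z
    unfolding m_def using that bdd by (auto intro: cInf_lower)
  have ne: "E ` S \<noteq> {}" using subspace_0[OF S] by auto
  have "\<exists>z\<in>S. E z < m + 1 / Suc n" for n
    using cInf_less_iff[OF ne bdd, of "m + 1 / Suc n"] by (auto simp: m_def)
  then obtain z where zS: "\<And>n. z n \<in> S" and zE: "\<And>n. E (z n) < m + 1 / Suc n" by metis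
  \<comment> \<open>The parallelogram law, applied at the midpoint, makes every minimising sequence Cauchy.\<close>
  have par: "(norm (a - b))\<^sup>2 \<le> 2 * (E a + E b - 2 * m)" if "a \<in> S" "b \<in> S" for a b
  proof -
    have w: "(1/2) *\<^sub>R (a + b) \<in> S" using S that by (intro subspace_scale subspace_add)
    have gw: "g ((1/2) *\<^sub>R (a + b)) = (g a + g b) / 2"
      using scale[of "a + b" "1/2"] add that subspace_add[OF S that] by simp
    have "E a + E b - 2 * E ((1/2) *\<^sub>R (a + b)) = (norm (a - b))\<^sup>2 / 2"
      unfolding E_def gw
      by (simp add: power2_norm_eq_inner inner_simps inner_commute[of b a] field_simps)
    then show ?thesis using m_le[OF w] by simp
  qed
  have "Cauchy z"
  proof (rule metric_CauchyI)
    fix e :: real assume e: "e > 0"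
    then obtain N where N: "1 / Suc N < e\<^sup>2 / 4"
      using nat_approx_posE[of "e\<^sup>2 / 4"] by (auto simp: inverse_eq_divide)
    have "dist (z i) (z j) < e" if "i \<ge> N" "j \<ge> N" for i j
    proof -
      have "E (z l) < m + e\<^sup>2 / 4" if "l \<ge> N" for l
      proof -
        have "1 / real (Suc l) \<le> 1 / real (Suc N)" using that by (simp add: frac_le)
        then show ?thesis using zE[of l] N by linarith
      qed
      from this[OF that(1)] this[OF that(2)] have "(norm (z i - z j))\<^sup>2 < e\<^sup>2"
        using par[OF zS zS, of i j] by argo
      then show ?thesis using e by (auto simp: dist_norm intro: power2_less_imp_less)
    qed
    then show "\<exists>M. \<forall>i\<ge>M. \<forall>j\<ge>M. dist (z i) (z j) < e" by blast
  qed
  then obtain x where x: "z \<longlonglongrightarrow> x" using Cauchy_convergent convergent_def by blast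
  have "x \<in> closure S" using x zS closure_sequential by blast
  moreover have "inner x v = g v" if v: "v \<in> S" for v
  proof (rule ccontr)
    define d where "d = inner x v - g v"
    define c where "c = (norm v)\<^sup>2"
    assume "inner x v \<noteq> g v"
    then have d: "d \<noteq> 0" by (simp add: d_def)
    have c: "c \<ge> 0" by (simp add: c_def)
    \<comment> \<open>The first variation in the direction \<open>v\<close> is nonnegative at the minimum.\<close>
    have var: "0 \<le> 2 * t * d + t\<^sup>2 * c" for t
    proof -
      have "m \<le> (m + 1 / Suc n) + 2 * t * (inner (z n) v - g v) + t\<^sup>2 * c" for n
      proof -
        have tv: "t *\<^sub>R v \<in> S" using S v by (rule subspace_scale)
        have "m \<le> E (z n + t *\<^sub>R v)" using S zS tv by (intro m_le subspace_add)
        also have "\<dots> = E (z n) + 2 * t * (inner (z n) v - g v) + t\<^sup>2 * c"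
        proof -
          have "(norm (z n + t *\<^sub>R v))\<^sup>2 = (norm (z n))\<^sup>2 + 2 * t * inner (z n) v + t\<^sup>2 * (norm v)\<^sup>2"
            using dot_norm[of "z n" "t *\<^sub>R v"] by (simp add: power_mult_distrib field_simps)
          then show ?thesis
            unfolding E_def c_def add[OF zS tv] scale[OF v] by (simp only: algebra_simps)
        qed
        finally show ?thesis using zE[of n] by linarith
      qed
      moreover have "(\<lambda>n. (m + 1 / Suc n) + 2 * t * (inner (z n) v - g v) + t\<^sup>2 * c)
          \<longlonglongrightarrow> (m + 0) + 2 * t * (inner x v - g v) + t\<^sup>2 * c"
        by (intro tendsto_intros x LIMSEQ_Suc[OF lim_1_over_n])
      ultimately have "m \<le> (m + 0) + 2 * t * (inner x v - g v) + t\<^sup>2 * c"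
        by (intro LIMSEQ_le_const) auto
      then show ?thesis by (simp add: d_def)
    qed
    \<comment> \<open>Close to the minimiser \<open>-d/c\<close>, but defined also for \<open>c = 0\<close>.\<close>
    define t where "t = - d / (c + 1)"
    have dt: "d = - (t * (c + 1))" and "t \<noteq> 0" using c d by (auto simp: t_def)
    have "2 * t * d + t\<^sup>2 * c = - (t\<^sup>2 * (c + 2))"
      unfolding dt by (simp add: power2_eq_square algebra_simps)
    moreover have "t\<^sup>2 * (c + 2) > 0" using \<open>t \<noteq> 0\<close> c by simp
    ultimately show False using var[of t] by simp
  qed
  ultimately show ?thesis using that by blast
qed

lemma norm_le_if_inner_bounded_on_dense:
  fixes x :: "'a::real_inner"
  assumes "x \<in> closure S" "\<And>z. z \<in> S \<Longrightarrow> inner x z \<le> C * norm z" "0 \<le> C"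
  shows "norm x \<le> C"
proof -
  have "closed {z. inner x z \<le> C * norm z}"
    by (intro closed_Collect_le continuous_intros)
  then have "closure S \<subseteq> {z. inner x z \<le> C * norm z}"
    using assms(2) by (intro closure_minimal) auto
  then have "inner x x \<le> C * norm x" using assms(1) by auto
  then have "norm x * norm x \<le> C * norm x" by (simp flip: power2_norm_eq_inner power2_eq_square)
  then show ?thesis using assms(3) by (cases "x = 0") auto
qed

lemma dense_if_orthogonal_trivial:
  fixes S :: "'a::{real_inner,banach} set"
  assumes S: "subspace S" and triv: "\<And>y. (\<And>z. z \<in> S \<Longrightarrow> inner y z = 0) \<Longrightarrow> y = 0"
  shows "closure S = UNIV"
proof -
  have "y \<in> closure S" for y
  proof -
    obtain x where x: "x \<in> closure S" "\<And>z. z \<in> S \<Longrightarrow> inner x z = inner y z"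
      using riesz_on_subspace[OF S, of "inner y" "norm y"]
      by (auto simp: inner_right_distrib Cauchy_Schwarz_ineq2)
    have "y - x = 0" using x(2) by (intro triv) (simp add: inner_diff_left)
    then show ?thesis using x(1) by simp
  qed
  then show ?thesis by blast
qed

section \<open>Fixed points of Volterra type\<close>

lemma continuous_on_atLeast_if_compact:
  fixes X :: "real \<Rightarrow> 'a::topological_space"
  assumes "\<And>\<tau>. continuous_on {0..\<tau>} X"
  shows "continuous_on {0..} X"
  unfolding continuous_on_eq_continuous_within
proof
  fix t :: real assume "t \<in> {0..}"
  then have "continuous (at t within {0..t+1}) X"
    using assms[of "t + 1"] by (simp add: continuous_on_eq_continuous_within)
  moreover have "at t within {0..t+1} = at t within {0..}"
    by (rule at_within_nhd[of _ "{..<t+1}"]) auto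
  ultimately show "continuous (at t within {0..}) X" by simp
qed

lemma tendsto_integral_if_uniform_limit:
  fixes f :: "nat \<Rightarrow> real \<Rightarrow> 'a::banach"
  assumes u: "uniform_limit {a..b} f g sequentially" and c: "\<And>n. continuous_on {a..b} (f n)"
  shows "(\<lambda>n. integral {a..b} (f n)) \<longlonglongrightarrow> integral {a..b} g"
proof -
  obtain I J where I: "\<And>n. (f n has_integral (I n :: 'a)) {a..b}" and J: "(g has_integral J) {a..b}" and lim: "I \<longlonglongrightarrow> J"
    by (rule uniform_limit_integral[OF u c]) auto
  have "integral {a..b} (f n) = I n" for n using I by (rule integral_unique)
  then show ?thesis using lim J by (simp add: integral_unique)
qed

lemma integral_exp_le:
  fixes l :: real
  assumes "l > 0" "0 \<le> t"
  shows "integral {0..t} (\<lambda>s. exp (l * s)) \<le> exp (l * t) / l"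
proof -
  have "((\<lambda>s. exp (l * s)) has_integral exp (l * t) / l - exp (l * 0) / l) {0..t}"
    using assms
    by (intro fundamental_theorem_of_calculus)
       (auto intro!: derivative_eq_intros simp: has_real_derivative_iff_has_vector_derivative[symmetric])
  then show ?thesis using assms by (simp add: integral_unique)
qed

text \<open>The squared form of the estimate is the one that \<open>L\<^sup>2\<close> bounds on inputs produce. Measured by
  \<open>sup e\<^bsup>-rs\<^esup> ||X(s) - Y(s)||\<^sup>2\<close> over \<open>s\<close> in \<open>[0,\<tau>]\<close>, with \<open>r\<close> at least \<open>4 k(\<tau>)\<close>, squared distances shrink
  by the factor \<open>1/4\<close> under \<open>P\<close>, however large \<open>\<tau>\<close> is; so solutions are global.\<close>

locale volterra =
  fixes P :: "(real \<Rightarrow> 'a::banach) \<Rightarrow> real \<Rightarrow> 'a" and k :: "real \<Rightarrow> real"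
  assumes cont: "\<And>X. continuous_on {0..} X \<Longrightarrow> continuous_on {0..} (P X)"
    and lip: "\<And>X Y t. continuous_on {0..} X \<Longrightarrow> continuous_on {0..} Y \<Longrightarrow> 0 \<le> t \<Longrightarrow>
      (norm (P X t - P Y t))\<^sup>2 \<le> k t * integral {0..t} (\<lambda>s. (norm (X s - Y s))\<^sup>2)"
    and k_mono: "\<And>s t. 0 \<le> s \<Longrightarrow> s \<le> t \<Longrightarrow> k s \<le> k t" 
begin

text \<open>The exponent of the weight. The maximum keeps it positive when the bound \<open>k\<close> is not.\<close>

definition rate :: "real \<Rightarrow> real" where "rate \<tau> = 4 * max 1 (k \<tau>)"

lemma weighted_contraction:
  assumes X: "continuous_on {0..} X" and Y: "continuous_on {0..} Y" and t: "0 \<le> t" "t \<le> \<tau>"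
    and N: "0 \<le> N" and bound: "\<And>s. 0 \<le> s \<Longrightarrow> s \<le> \<tau> \<Longrightarrow> (norm (X s - Y s))\<^sup>2 \<le> N * exp (rate \<tau> * s)"
  shows "(norm (P X t - P Y t))\<^sup>2 \<le> N / 4 * exp (rate \<tau> * t)"
proof -
  define l where "l = rate \<tau>"
  have l: "l > 0" "k t * 4 \<le> l" using k_mono[OF t] by (auto simp: l_def rate_def)
  have c: "continuous_on {0..t} X" "continuous_on {0..t} Y"
    using X Y by (auto intro: continuous_on_subset)
  have "integral {0..t} (\<lambda>s. (norm (X s - Y s))\<^sup>2) \<le> integral {0..t} (\<lambda>s. N * exp (l * s))"
    using t bound by (intro integral_le integrable_continuous_real continuous_intros c) (auto simp: l_def)
  also have "\<dots> \<le> N * (exp (l * t) / l)"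
    using mult_left_mono[OF integral_exp_le[OF l(1) t(1)] N] by simp
  finally have i: "integral {0..t} (\<lambda>s. (norm (X s - Y s))\<^sup>2) \<le> N * exp (l * t) / l" by simp
  have "(norm (P X t - P Y t))\<^sup>2 \<le> k t * integral {0..t} (\<lambda>s. (norm (X s - Y s))\<^sup>2)"
    by (rule lip[OF X Y t(1)])
  also have "\<dots> \<le> (l / 4) * integral {0..t} (\<lambda>s. (norm (X s - Y s))\<^sup>2)"
    using l by (intro mult_right_mono integral_nonneg integrable_continuous_real continuous_intros c) auto
  also have "\<dots> \<le> (l / 4) * (N * exp (l * t) / l)"
    using i l by (intro mult_left_mono) auto
  also have "\<dots> = N / 4 * exp (l * t)" using l by simp
  finally show ?thesis by (simp add: l_def)
qed

text \<open>Two sequences of iterates are compared, so that the lemma yields both the convergence of the Picard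
  iteration (compare the sequence with its shift) and uniqueness (compare two constant sequences).\<close>

lemma iterates_contract:
  assumes xc: "\<And>n. continuous_on {0..} (x n)" and yc: "\<And>n. continuous_on {0..} (y n)"
    and x_Suc: "\<And>n t. 0 \<le> t \<Longrightarrow> x (Suc n) t = P (x n) t"
    and y_Suc: "\<And>n t. 0 \<le> t \<Longrightarrow> y (Suc n) t = P (y n) t"
  obtains N where "\<And>n t. t \<in> {0..\<tau>} \<Longrightarrow> norm (x n t - y n t) \<le> N * (1/2) ^ n"
proof -
  have "continuous_on {0..\<tau>} (\<lambda>t. (norm (x 0 t - y 0 t))\<^sup>2)"
    by (intro continuous_intros continuous_on_subset[OF xc] continuous_on_subset[OF yc]) auto
  then have "bounded ((\<lambda>t. (norm (x 0 t - y 0 t))\<^sup>2) ` {0..\<tau>})"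
    by (intro compact_imp_bounded compact_continuous_image) auto
  then obtain N where N: "N > 0" "\<forall>z \<in> (\<lambda>t. (norm (x 0 t - y 0 t))\<^sup>2) ` {0..\<tau>}. norm z \<le> N"
    unfolding bounded_pos by blast
  have N0: "(norm (x 0 t - y 0 t))\<^sup>2 \<le> N" if "0 \<le> t" "t \<le> \<tau>" for t
    using N(2) that by auto
  have rate: "rate \<tau> \<ge> 0" by (auto simp: rate_def)
  have main: "\<forall>t. 0 \<le> t \<longrightarrow> t \<le> \<tau> \<longrightarrow>
      (norm (x n t - y n t))\<^sup>2 \<le> N * (1/4) ^ n * exp (rate \<tau> * t)" for n
  proof (induction n)
    case 0
    have "(norm (x 0 t - y 0 t))\<^sup>2 \<le> N * exp (rate \<tau> * t)" if "0 \<le> t" "t \<le> \<tau>" for t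
    proof -
      have "N * 1 \<le> N * exp (rate \<tau> * t)" using N rate that by (intro mult_left_mono) auto
      then show ?thesis using N0[OF that] by linarith
    qed
    then show ?case by simp
  next
    case (Suc n)
    show ?case
    proof (intro allI impI)
      fix t assume t: "0 \<le> t" "t \<le> \<tau>"
      have "(norm (P (x n) t - P (y n) t))\<^sup>2 \<le> N * (1/4) ^ n / 4 * exp (rate \<tau> * t)"
        using Suc.IH N t by (intro weighted_contraction xc yc) auto
      then show "(norm (x (Suc n) t - y (Suc n) t))\<^sup>2 \<le> N * (1/4) ^ Suc n * exp (rate \<tau> * t)"
        using x_Suc y_Suc t by simp
    qed
  qed
  define M where "M = sqrt (N * exp (rate \<tau> * \<tau>))"
  have "norm (x n t - y n t) \<le> M * (1/2) ^ n" if "t \<in> {0..\<tau>}" for n t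
  proof -
    have "(norm (x n t - y n t))\<^sup>2 \<le> N * (1/4) ^ n * exp (rate \<tau> * t)"
      using main that by auto
    also have "\<dots> \<le> N * (1/4) ^ n * exp (rate \<tau> * \<tau>)"
      using that N rate by (intro mult_left_mono) (auto intro: mult_left_mono)
    also have "\<dots> = (M * (1/2) ^ n)\<^sup>2"
    proof -
      have "((1/2::real) ^ n)\<^sup>2 = ((1/2)\<^sup>2) ^ n" by (simp only: power_mult[symmetric] mult.commute)
      then have "((1/2::real) ^ n)\<^sup>2 = (1/4) ^ n" by (simp add: power2_eq_square)
      then show ?thesis using N by (simp add: M_def power_mult_distrib)
    qed
    finally show ?thesis by (rule power2_le_imp_le) (use N in \<open>simp add: M_def\<close>)
  qed
  then show ?thesis using that by blast
qed

lemma fixed_point_unique: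
  assumes X: "continuous_on {0..} X" and Y: "continuous_on {0..} Y"
    and fX: "\<And>t. 0 \<le> t \<Longrightarrow> X t = P X t" and fY: "\<And>t. 0 \<le> t \<Longrightarrow> Y t = P Y t" and t: "0 \<le> t"
  shows "X t = Y t"
proof -
  obtain N where "\<And>n s. s \<in> {0..t} \<Longrightarrow> norm (X s - Y s) \<le> N * (1/2) ^ n"
    using iterates_contract[of "\<lambda>_. X" "\<lambda>_. Y" t] X Y fX fY by blast
  then have "norm (X t - Y t) \<le> N * (1/2) ^ n" for n using t by auto
  moreover have "(\<lambda>n. N * (1/2) ^ n) \<longlonglongrightarrow> N * 0"
    by (intro tendsto_intros LIMSEQ_power_zero) auto
  ultimately have "norm (X t - Y t) \<le> N * 0"
    by (intro LIMSEQ_le_const) auto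
  then show ?thesis by simp
qed

lemma fixed_point_exists: "\<exists>X. continuous_on {0..} X \<and> (\<forall>t\<ge>0. X t = P X t)"
proof -
  define x where "x n = (P ^^ n) (\<lambda>_. 0)" for n
  have c0: "continuous_on {0..} (\<lambda>_. 0 :: 'a)" by simp
  have xc: "continuous_on {0..} (x n)" for n
    unfolding x_def by (induction n) (use c0 cont in auto)
  define X where "X t = (\<Sum>n. x (Suc n) t - x n t)" for t
  have unif: "uniform_limit {0..\<tau>} x X sequentially" for \<tau>
  proof -
    obtain N where "\<And>n t. t \<in> {0..\<tau>} \<Longrightarrow> norm (x (Suc n) t - x n t) \<le> N * (1/2) ^ n"
      by (rule iterates_contract[of "\<lambda>n. x (Suc n)" x \<tau>]) (use xc[unfolded x_def] cont in \<open>auto simp: x_def\<close>)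
    then have "uniform_limit {0..\<tau>} (\<lambda>n t. \<Sum>i<n. x (Suc i) t - x i t) X sequentially"
      unfolding X_def by (rule Weierstrass_m_test) (auto intro: summable_mult summable_geometric)
    moreover have "(\<Sum>i<n. x (Suc i) t - x i t) = x n t" for n t
      by (subst sum_lessThan_telescope) (simp add: x_def)
    ultimately show ?thesis by simp
  qed
  have Xc: "continuous_on {0..} X"
  proof (rule continuous_on_atLeast_if_compact)
    show "continuous_on {0..\<tau>} X" for \<tau>
      by (rule uniform_limit_theorem[OF _ unif])
         (auto intro!: always_eventually continuous_on_subset[OF xc])
  qed
  have "X t = P X t" if t: "0 \<le> t" for t
  proof (rule LIMSEQ_unique)
    show "(\<lambda>n. x (Suc n) t) \<longlonglongrightarrow> X t"
      using tendsto_uniform_limitI[OF unif[of t]] t by (intro LIMSEQ_Suc) auto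
    have "(\<lambda>n. (norm (P (x n) t - P X t))\<^sup>2) \<longlonglongrightarrow> 0"
    proof (rule tendsto_sandwich[OF _ _ tendsto_const])
      show "\<forall>\<^sub>F n in sequentially. (norm (P (x n) t - P X t))\<^sup>2 \<le> k t * integral {0..t} (\<lambda>s. (norm (x n s - X s))\<^sup>2)"
        by (intro always_eventually allI lip xc Xc t)
      have xc': "continuous_on {0..t} (x n)" for n
        by (rule continuous_on_subset[OF xc]) auto
      have Xc': "continuous_on {0..t} X"
        by (rule continuous_on_subset[OF Xc]) auto
      have "uniform_limit {0..t} (\<lambda>n s. (norm (x n s - X s))\<^sup>2) (\<lambda>s. 0) sequentially"
      proof (rule uniform_limitI)
        fix e :: real assume "e > 0"
        then have "\<forall>\<^sub>F n in sequentially. \<forall>s\<in>{0..t}. dist (x n s) (X s) < sqrt e"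
          using uniform_limitD[OF unif] by simp
        then show "\<forall>\<^sub>F n in sequentially. \<forall>s\<in>{0..t}. dist ((norm (x n s - X s))\<^sup>2) 0 < e"
        proof eventually_elim
          case (elim n)
          show ?case
          proof
            fix s assume "s \<in> {0..t}"
            then have "norm (x n s - X s) < sqrt e" using elim by (simp add: dist_norm)
            then have "(norm (x n s - X s))\<^sup>2 < (sqrt e)\<^sup>2" by (intro power_strict_mono) auto
            then show "dist ((norm (x n s - X s))\<^sup>2) 0 < e" using \<open>e > 0\<close> by (simp add: dist_norm)
          qed
        qed
      qed
      then have "(\<lambda>n. integral {0..t} (\<lambda>s. (norm (x n s - X s))\<^sup>2)) \<longlonglongrightarrow> integral {0..t} (\<lambda>s. 0)"
        by (intro tendsto_integral_if_uniform_limit) (auto intro!: continuous_intros xc' Xc')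
      then show "(\<lambda>n. k t * integral {0..t} (\<lambda>s. (norm (x n s - X s))\<^sup>2)) \<longlonglongrightarrow> 0"
        by (auto intro: tendsto_eq_intros)
    qed simp
    then have "(\<lambda>n. P (x n) t - P X t) \<longlonglongrightarrow> 0"
      by (simp add: tendsto_norm_zero_iff)
    then show "(\<lambda>n. x (Suc n) t) \<longlonglongrightarrow> P X t"
      by (simp add: x_def LIM_zero_iff)
  qed
  then show ?thesis using Xc by blast
qed

end

section \<open>Exponentials of bounded skew operators\<close>

definition skew_op :: "('a::real_inner \<Rightarrow> 'a) \<Rightarrow> bool" where
  "skew_op B \<longleftrightarrow> bounded_linear B \<and> (\<forall>x. inner (B x) x = 0)"

lemma skew_op_linear: "skew_op B \<Longrightarrow> bounded_linear B"
  by (simp add: skew_op_def)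

lemma skew_op_inner: 
  assumes "skew_op B" shows "inner (B x) y = - inner x (B y)"
proof -
  interpret bounded_linear B using assms by (rule skew_op_linear)
  have "inner (B (x + y)) (x + y) = 0" "inner (B x) x = 0" "inner (B y) y = 0"
    using assms by (simp_all add: skew_op_def)
  then show ?thesis by (simp add: add inner_add_left inner_add_right inner_commute)
qed

text \<open>This is conservation of energy. It is the uniqueness argument for every evolution equation below,
  applied to the difference of two solutions.\<close>

lemma norm_const_if_orthogonal_derivative:
  fixes y :: "real \<Rightarrow> 'a::real_inner"
  assumes d: "\<And>t. (y has_vector_derivative y' t) (at t)" and o: "\<And>t. inner (y' t) (y t) = 0"
  shows "norm (y t) = norm (y s)"
proof -
  have "((\<lambda>t. inner (y t) (y t)) has_real_derivative 0) (at t)" for t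
    using bounded_bilinear.has_vector_derivative[OF bounded_bilinear_inner d[of t] d[of t]] o[of t]
    by (simp add: has_real_derivative_iff_has_vector_derivative inner_commute)
  then have "inner (y t) (y t) = inner (y s) (y s)" by (intro DERIV_isconst_all) auto
  then show ?thesis by (simp add: norm_eq_sqrt_inner)
qed

definition exp_op :: "('a::real_normed_vector \<Rightarrow> 'a) \<Rightarrow> real \<Rightarrow> 'a \<Rightarrow> 'a" where
  "exp_op B t x = (\<Sum>n. (t ^ n / fact n) *\<^sub>R (B ^^ n) x)"

lemma exp_op_0: "exp_op B 0 x = x"
proof -
  have "exp_op B 0 x = (\<Sum>n\<in>{0}. (0 ^ n / fact n) *\<^sub>R (B ^^ n) x)"
    unfolding exp_op_def by (rule suminf_finite) auto
  then show ?thesis by simp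
qed

lemma exp_op_derivative:
  fixes B :: "'a::banach \<Rightarrow> 'a"
  assumes "bounded_linear B"
  shows "((\<lambda>t. exp_op B t x) has_vector_derivative B (exp_op B t x)) (at t)"
proof -
  interpret B: bounded_linear B by fact
  obtain b where b: "b > 0" "\<And>x. norm (B x) \<le> norm x * b" using B.pos_bounded by blast
  define f where "f n t = (t ^ n / fact n) *\<^sub>R (B ^^ n) x" for n and t :: real
  define R where "R = \<bar>t\<bar> + 1"
  define S where "S = {-R..R}"
  have pow: "norm ((B ^^ n) x) \<le> b ^ n * norm x" for n
  proof (induction n)
    case (Suc n)
    have "norm ((B ^^ Suc n) x) \<le> norm ((B ^^ n) x) * b" using b(2) by simp
    also have "\<dots> \<le> b ^ n * norm x * b" using Suc b(1) by (intro mult_right_mono) auto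
    finally show ?case by (simp add: mult_ac)
  qed simp
  have unif: "uniform_limit S (\<lambda>n t. \<Sum>i<n. f i t) (\<lambda>t. exp_op B t x) sequentially"
    unfolding exp_op_def f_def
  proof (rule Weierstrass_m_test)
    fix n s assume "s \<in> S"
    then have "\<bar>s\<bar> \<le> R" by (auto simp: S_def R_def)
    then have "\<bar>s\<bar> ^ n / fact n * norm ((B ^^ n) x) \<le> R ^ n / fact n * (b ^ n * norm x)"
      using pow[of n] by (intro mult_mono divide_right_mono power_mono) (auto simp: R_def)
    then show "norm ((s ^ n / fact n) *\<^sub>R (B ^^ n) x) \<le> (inverse (fact n) * (R * b) ^ n) * norm x"
      by (simp add: power_abs power_mult_distrib field_simps)
  next
    show "summable (\<lambda>n. (inverse (fact n) * (R * b) ^ n) * norm x)"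
      by (intro summable_mult2 summable_exp)
  qed
  have "\<exists>g. \<forall>s\<in>S. (\<lambda>n. \<Sum>i<Suc n. f i s) \<longlonglongrightarrow> g s \<and>
      (g has_derivative (\<lambda>h. h *\<^sub>R B (exp_op B s x))) (at s within S)"
  proof (rule has_derivative_sequence[where f' = "\<lambda>n s h. h *\<^sub>R B (\<Sum>i<n. f i s)" and ?x0.0 = 0])
    show "convex S" "0 \<in> S" by (auto simp: S_def R_def)
    show "((\<lambda>s. \<Sum>i<Suc n. f i s) has_derivative (\<lambda>h. h *\<^sub>R B (\<Sum>i<n. f i s))) (at s within S)" for n s
    proof -
      have "(f (Suc i) has_vector_derivative B (f i s)) (at s within S)" for i
      proof -
        have "((\<lambda>s::real. s ^ Suc i / fact (Suc i)) has_real_derivative s ^ i / fact i) (at s within S)"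
          using DERIV_cdivide[OF DERIV_pow[of "Suc i" s S], of "fact (Suc i)"] by simp
        then have "((\<lambda>s. (s ^ Suc i / fact (Suc i)) *\<^sub>R (B ^^ Suc i) x) has_vector_derivative
            (s ^ i / fact i) *\<^sub>R (B ^^ Suc i) x) (at s within S)"
          using has_vector_derivative_scaleR[OF _ has_vector_derivative_const] by fastforce
        then show ?thesis by (simp add: f_def[abs_def] B.scale)
      qed
      then have "((\<lambda>s. f 0 s + (\<Sum>i<n. f (Suc i) s)) has_vector_derivative 0 + (\<Sum>i<n. B (f i s))) (at s within S)"
        by (intro has_vector_derivative_add has_vector_derivative_sum) (simp_all add: f_def[of 0])
      then show ?thesis
        by (simp add: has_vector_derivative_def sum.lessThan_Suc_shift B.sum del: sum.lessThan_Suc)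
    qed
    show "\<forall>\<^sub>F n in sequentially. \<forall>s\<in>S. \<forall>h. norm (h *\<^sub>R B (\<Sum>i<n. f i s) - h *\<^sub>R B (exp_op B s x)) \<le> e * norm h"
      if "e > 0" for e
    proof -
      have "\<forall>\<^sub>F n in sequentially. \<forall>s\<in>S. dist (\<Sum>i<n. f i s) (exp_op B s x) < e / b"
        using that b by (intro uniform_limitD[OF unif]) auto
      then show ?thesis
      proof eventually_elim
        case (elim n)
        show ?case
        proof (intro ballI allI)
          fix s h assume "s \<in> S"
          define d where "d = (\<Sum>i<n. f i s) - exp_op B s x"
          have "norm d \<le> e / b" using elim \<open>s \<in> S\<close> by (auto simp: dist_norm d_def)
          then have "norm (B d) \<le> e"
            using b(2)[of d] b(1) by (simp add: field_simps)
          then have "norm (h *\<^sub>R B d) \<le> e * norm h" 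
            using mult_left_mono[of "norm (B d)" e "\<bar>h\<bar>"] by (simp add: mult.commute)
          then show "norm (h *\<^sub>R B (\<Sum>i<n. f i s) - h *\<^sub>R B (exp_op B s x)) \<le> e * norm h"
            by (simp add: d_def B.diff scaleR_diff_right)
        qed
      qed
    qed
    show "(\<lambda>n. \<Sum>i<Suc n. f i 0) \<longlonglongrightarrow> exp_op B 0 x"
      using tendsto_uniform_limitI[OF unif, of 0] by (intro LIMSEQ_Suc) (auto simp: S_def R_def)
  qed
  then obtain g where g: "\<And>s. s \<in> S \<Longrightarrow> (\<lambda>n. \<Sum>i<Suc n. f i s) \<longlonglongrightarrow> g s"
    "\<And>s. s \<in> S \<Longrightarrow> (g has_derivative (\<lambda>h. h *\<^sub>R B (exp_op B s x))) (at s within S)" by blast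
  have eq: "g s = exp_op B s x" if "s \<in> S" for s
    using g(1)[OF that] tendsto_uniform_limitI[OF unif that, THEN LIMSEQ_Suc] by (rule LIMSEQ_unique)
  have t: "t \<in> S" "t \<in> interior S" by (auto simp: S_def R_def)
  have "((\<lambda>s. exp_op B s x) has_derivative (\<lambda>h. h *\<^sub>R B (exp_op B t x))) (at t within S)"
    using eq t by (intro has_derivative_transform[OF t(1) _ g(2)[OF t(1)]]) auto
  then show ?thesis
    using at_within_interior[OF t(2)] by (simp add: has_vector_derivative_def)
qed

lemma exp_op_unique:
  fixes B :: "'a::{real_inner,banach} \<Rightarrow> 'a"
  assumes B: "skew_op B" and d: "\<And>t. (y has_vector_derivative B (y t)) (at t)" and "y 0 = x"
  shows "y t = exp_op B t x"
proof -
  interpret B: bounded_linear B using B by (rule skew_op_linear)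
  have "norm (y t - exp_op B t x) = norm (y 0 - exp_op B 0 x)"
  proof (rule norm_const_if_orthogonal_derivative)
    show "((\<lambda>t. y t - exp_op B t x) has_vector_derivative B (y t - exp_op B t x)) (at t)" for t
      using has_vector_derivative_diff[OF d exp_op_derivative[OF B.bounded_linear_axioms]]
      by (simp add: B.diff)
  qed (use B in \<open>simp add: skew_op_def\<close>)
  then show ?thesis using assms by (simp add: exp_op_0)
qed

lemma norm_exp_op:
  fixes B :: "'a::{real_inner,banach} \<Rightarrow> 'a"
  assumes B: "skew_op B" shows "norm (exp_op B t x) = norm x"
proof -
  have "norm (exp_op B t x) = norm (exp_op B 0 x)"
    by (rule norm_const_if_orthogonal_derivative[OF exp_op_derivative])
       (use B in \<open>auto simp: skew_op_def\<close>)
  then show ?thesis by (simp add: exp_op_0)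
qed

lemma exp_op_commute:
  fixes B :: "'a::{real_inner,banach} \<Rightarrow> 'a"
  assumes B: "skew_op B" and L: "bounded_linear L" and c: "\<And>x. L (B x) = B (L x)"
  shows "L (exp_op B t x) = exp_op B t (L x)"
proof (rule exp_op_unique[OF B])
  show "((\<lambda>t. L (exp_op B t x)) has_vector_derivative B (L (exp_op B t x))) (at t)" for t
    using bounded_linear.has_vector_derivative[OF L exp_op_derivative[OF skew_op_linear[OF B]]]
    by (simp add: c)
qed (simp add: exp_op_0)

lemma exp_op_add:
  fixes B :: "'a::{real_inner,banach} \<Rightarrow> 'a"
  assumes B: "skew_op B"
  shows "exp_op B t (x + y) = exp_op B t x + exp_op B t y"
proof -
  interpret B: bounded_linear B using B by (rule skew_op_linear)
  have "exp_op B t x + exp_op B t y = exp_op B t (x + y)"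
    by (rule exp_op_unique[OF B, where y = "\<lambda>t. exp_op B t x + exp_op B t y"])
       (auto intro!: derivative_eq_intros exp_op_derivative B.bounded_linear_axioms simp: B.add exp_op_0)
  then show ?thesis by simp
qed

lemma exp_op_scaleR:
  fixes B :: "'a::{real_inner,banach} \<Rightarrow> 'a"
  assumes B: "skew_op B"
  shows "exp_op B t (c *\<^sub>R x) = c *\<^sub>R exp_op B t x"
  using exp_op_commute[OF B bounded_linear_scaleR_right[of c], of t x]
    linear_cmul[OF bounded_linear.linear[OF skew_op_linear[OF B]]] by simp

text \<open>Differentiating \<open>\<langle>e\<^bsup>sC\<^esup> x, e\<^bsup>(s-t)B\<^esup> v\<rangle>\<close> in \<open>s\<close> leaves \<open>\<langle>(C - B) e\<^bsup>sC\<^esup> x, e\<^bsup>(s-t)B\<^esup> v\<rangle>\<close>, whose size does not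
  depend on \<open>s\<close> because everything commutes and the exponentials are isometries. The bound involves only
  \<open>C x - B x\<close> and not the operator norms; this is what survives for unbounded limits.\<close>

lemma norm_exp_op_diff_le:
  fixes B C :: "'a::{real_inner,banach} \<Rightarrow> 'a"
  assumes B: "skew_op B" and C: "skew_op C" and c: "\<And>x. B (C x) = C (B x)"
  shows "norm (exp_op C t x - exp_op B t x) \<le> norm (C x - B x) * \<bar>t\<bar>"
proof -
  define F where "F D v s = inner (exp_op D s x) (exp_op B (s - t) v)" for D v s
  have dF: "(F D v has_real_derivative inner (D (exp_op D s x) - B (exp_op D s x)) (exp_op B (s - t) v)) (at s)"
    if D: "skew_op D" for D v s
  proof -
    have "((\<lambda>s. exp_op B (s - t) v) has_vector_derivative (1 - 0) *\<^sub>R B (exp_op B (s - t) v)) (at s)"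
    proof -
      have "((\<lambda>s. s - t) has_vector_derivative (1 - 0)) (at s)"
        by (intro has_vector_derivative_diff has_vector_derivative_id has_vector_derivative_const)
      from vector_diff_chain_at[OF this exp_op_derivative[OF skew_op_linear[OF B]], of v]
      show ?thesis by (simp add: o_def)
    qed
    from bounded_bilinear.has_vector_derivative[OF bounded_bilinear_inner
        exp_op_derivative[OF skew_op_linear[OF D], of x s] this]
    show ?thesis
      by (simp add: F_def[abs_def] has_real_derivative_iff_has_vector_derivative inner_diff_left
          skew_op_inner[OF B] add.commute)
  qed
  have ends: "F D v t = inner (exp_op D t x) v" "F D v 0 = inner x (exp_op B (-t) v)" for D v
    by (simp_all add: F_def exp_op_0)
  have "\<bar>F C v t - F C v 0\<bar> \<le> norm (C x - B x) * norm v * \<bar>t\<bar>" for v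
  proof -
    have "norm (F C v t - F C v 0) \<le> (norm (C x - B x) * norm v) * norm (t - 0)"
    proof (rule field_differentiable_bound[OF convex_UNIV dF[OF C]])
      fix s
      have "C (exp_op C s x) - B (exp_op C s x) = exp_op C s (C x) - exp_op C s (B x)"
        using exp_op_commute[OF C skew_op_linear[OF C]] exp_op_commute[OF C skew_op_linear[OF B]] c by simp
      also have "\<dots> = exp_op C s (C x - B x)"
        using exp_op_add[OF C, of s "C x" "(-1) *\<^sub>R B x"] exp_op_scaleR[OF C, of s "-1" "B x"] by simp
      finally have "norm (C (exp_op C s x) - B (exp_op C s x)) = norm (C x - B x)"
        by (simp add: norm_exp_op[OF C])
      then show "norm (inner (C (exp_op C s x) - B (exp_op C s x)) (exp_op B (s - t) v)) \<le> norm (C x - B x) * norm v"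
        using Cauchy_Schwarz_ineq2[of "C (exp_op C s x) - B (exp_op C s x)" "exp_op B (s - t) v"]
        by (simp add: norm_exp_op[OF B])
    qed auto
    then show ?thesis by simp
  qed
  moreover have "F B v t = F B v 0" for v
    using dF[OF B, of v] by (intro DERIV_isconst_all) simp
  ultimately have *: "\<bar>inner (exp_op C t x - exp_op B t x) v\<bar> \<le> norm (C x - B x) * norm v * \<bar>t\<bar>" for v
    by (simp add: ends inner_diff_left)
  define d where "d = exp_op C t x - exp_op B t x"
  have "norm d * norm d \<le> (norm (C x - B x) * \<bar>t\<bar>) * norm d"
    using *[of d] by (simp add: d_def[symmetric] power2_norm_eq_inner[symmetric] power2_eq_square mult_ac)
  then show ?thesis by (cases "d = 0") (auto simp: d_def)
qed

section \<open>The orthogonal group generated by the inverse of a skew operator\<close>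

lemma norm_skew_shift:
  assumes K: "skew_op K"
  shows "(norm (K x + e *\<^sub>R x))\<^sup>2 = (norm (K x))\<^sup>2 + e\<^sup>2 * (norm x)\<^sup>2"
  using K dot_norm[of "K x" "e *\<^sub>R x"] by (simp add: skew_op_def power_mult_distrib)

lemma norm_skew_shift_ge:
  assumes K: "skew_op K"
  shows "\<bar>e\<bar> * norm x \<le> norm (K x + e *\<^sub>R x)"
  by (rule power2_le_imp_le) (simp_all add: norm_skew_shift[OF K] power_mult_distrib)

lemma bounded_linear_shift:
  assumes K: "skew_op K"
  shows "bounded_linear (\<lambda>x. K x + e *\<^sub>R x)"
  by (intro bounded_linear_add skew_op_linear[OF K] bounded_linear_scaleR_right)

text \<open>The identity for the norm of \<open>(K + e) x\<close> bounds the shifted operator below, so it is injective with closed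
  range; a vector \<open>y\<close> orthogonal to the range satisfies \<open>e |y|\<^sup>2 = \<langle>y, (K + e) y\<rangle> = 0\<close>.\<close>

lemma bij_skew_shift:
  fixes K :: "'a::{real_inner,banach} \<Rightarrow> 'a"
  assumes K: "skew_op K" and e: "e \<noteq> 0"
  shows "bij (\<lambda>x. K x + e *\<^sub>R x)"
proof -
  define f where "f x = K x + e *\<^sub>R x" for x
  interpret f: bounded_linear f unfolding f_def by (rule bounded_linear_shift[OF K])
  have ge: "\<bar>e\<bar> * norm x \<le> norm (f x)" for x
    unfolding f_def by (rule norm_skew_shift_ge[OF K])
  have "inj f"
  proof (rule injI)
    fix x y assume "f x = f y"
    then have "f (x - y) = 0" by (simp add: f.diff)
    then have "norm (x - y) \<le> 0"
      using ge[of "x - y"] e by (simp add: mult_le_0_iff)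
    then show "x = y" by simp
  qed
  moreover have "range f = UNIV"
  proof -
    have sub: "subspace (range f)"
      using f.linear by (intro linear_subspace_image subspace_UNIV) auto
    have "complete (range f)"
      by (rule complete_isometric_image[of "\<bar>e\<bar>"])
         (use e ge in \<open>auto simp: f.bounded_linear_axioms complete_UNIV\<close>)
    then have "closure (range f) = range f" 
      by (intro closure_closed complete_imp_closed)
    moreover have "closure (range f) = UNIV"
    proof (rule dense_if_orthogonal_trivial[OF sub])
      fix y assume "\<And>z. z \<in> range f \<Longrightarrow> inner y z = 0"
      then have "inner y (f y) = 0" by blast
      then have "e * inner y y = 0" using K by (simp add: f_def skew_op_def inner_add_right inner_commute[of y "K y"])
      then show "y = 0" using e by simp
    qed
    ultimately show ?thesis by simp
  qed
  ultimately show ?thesis by (simp add: bij_def f_def[abs_def])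
qed

definition skew_resolvent :: "('a::real_vector \<Rightarrow> 'a) \<Rightarrow> real \<Rightarrow> 'a \<Rightarrow> 'a" where
  "skew_resolvent K e = inv (\<lambda>x. K x + e *\<^sub>R x)"

text \<open>The usual Yosida approximation \<open>(K + e)\<^sup>-\<^sup>1\<close> of \<open>K\<^sup>-\<^sup>1\<close> is dissipative for one sign of \<open>e\<close> and generates
  contractions in one time direction only. The mean of the approximations for \<open>e\<close> and \<open>-e\<close> is skew, and so it
  generates isometries for all times.\<close>

definition skew_yosida :: "('a::real_vector \<Rightarrow> 'a) \<Rightarrow> real \<Rightarrow> 'a \<Rightarrow> 'a" where
  "skew_yosida K e y = (1/2) *\<^sub>R (skew_resolvent K e y + skew_resolvent K (- e) y)"

locale skew =
  fixes K :: "'a::{real_inner,banach} \<Rightarrow> 'a"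
  assumes skew: "skew_op K"
begin

abbreviation "res \<equiv> skew_resolvent K"
abbreviation "yosida \<equiv> skew_yosida K"

sublocale K: bounded_linear K using skew by (rule skew_op_linear)

lemma resolvent_right: "e \<noteq> 0 \<Longrightarrow> K (res e y) + e *\<^sub>R res e y = y"
  unfolding skew_resolvent_def
  using bij_is_surj[OF bij_skew_shift[OF skew, of e]] by (rule surj_f_inv_f)

lemma resolvent_unique: "e \<noteq> 0 \<Longrightarrow> K x + e *\<^sub>R x = y \<Longrightarrow> res e y = x"
  using inv_f_f[OF bij_is_inj[OF bij_skew_shift[OF skew, of e]], of x]
  by (simp add: skew_resolvent_def)

lemma norm_resolvent: "e \<noteq> 0 \<Longrightarrow> \<bar>e\<bar> * norm (res e y) \<le> norm y"
  using norm_skew_shift_ge[OF skew, of e "res e y"] by (simp add: resolvent_right)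

lemma bounded_linear_resolvent:
  assumes e: "e \<noteq> 0" shows "bounded_linear (res e)"
proof (rule bounded_linear_intro)
  show "res e (x + y) = res e x + res e y" for x y
    using resolvent_right[OF e, of x] resolvent_right[OF e, of y]
    by (intro resolvent_unique e) (simp add: K.add scaleR_add_right algebra_simps)
  show "res e (c *\<^sub>R x) = c *\<^sub>R res e x" for c x
  proof (intro resolvent_unique e)
    have "c *\<^sub>R x = c *\<^sub>R (K (res e x) + e *\<^sub>R res e x)" by (simp only: resolvent_right[OF e])
    then show "K (c *\<^sub>R res e x) + e *\<^sub>R c *\<^sub>R res e x = c *\<^sub>R x"
      by (simp add: K.scale scaleR_add_right mult.commute)
  qed
  show "norm (res e x) \<le> norm x * (1 / \<bar>e\<bar>)" for x
    using norm_resolvent[OF e, of x] e by (simp add: field_simps)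
qed

lemma resolvent_commute:
  assumes "bounded_linear L" "\<And>x. L (K x) = K (L x)" and e: "e \<noteq> 0"
  shows "res e (L y) = L (res e y)"
proof (rule resolvent_unique[OF e])
  interpret L: bounded_linear L by fact
  show "K (L (res e y)) + e *\<^sub>R L (res e y) = L y"
    using arg_cong[OF resolvent_right[OF e, of y], of L] by (simp add: L.add L.scale assms(2))
qed

lemma bounded_linear_yosida: "e \<noteq> 0 \<Longrightarrow> bounded_linear (yosida e)"
  unfolding skew_yosida_def[abs_def]
  by (intro bounded_linear_compose[OF bounded_linear_scaleR_right] bounded_linear_add bounded_linear_resolvent) auto

lemma yosida_commute:
  assumes L: "bounded_linear L" "\<And>x. L (K x) = K (L x)" and e: "e \<noteq> 0"
  shows "yosida e (L y) = L (yosida e y)"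
proof -
  interpret L: bounded_linear L by fact
  show ?thesis
    using resolvent_commute[OF L e] resolvent_commute[OF L, of "- e"] e
    by (simp add: skew_yosida_def L.scale L.add)
qed

lemma yosida_K: "e \<noteq> 0 \<Longrightarrow> yosida e (K x) = K (yosida e x)"
  by (rule yosida_commute) (auto simp: K.bounded_linear_axioms)

text \<open>\<open>\<langle>(K + e)\<^sup>-\<^sup>1 y, y\<rangle> = e |(K + e)\<^sup>-\<^sup>1 y|\<^sup>2\<close>, and the norm is the same for \<open>-e\<close>: with
  \<open>u = (K + e)\<^sup>-\<^sup>1 (K - e)\<^sup>-\<^sup>1 y\<close> the two vectors are \<open>(K - e) u\<close> and \<open>(K + e) u\<close>.\<close>

lemma skew_op_yosida:
  assumes e: "e \<noteq> 0" shows "skew_op (yosida e)"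
proof -
  have "inner (yosida e y) y = 0" for y
  proof -
    define u where "u = res (- e) (res e y)"
    have e': "- e \<noteq> 0" using e by simp
    have c: "res (- e) (res e y) = res e (res (- e) y)"
    proof (rule resolvent_commute[OF _ _ e'])
      show "bounded_linear (res e)" by (rule bounded_linear_resolvent[OF e])
      show "res e (K x) = K (res e x)" for x
        by (rule resolvent_commute[OF _ _ e]) (auto simp: K.bounded_linear_axioms)
    qed
    have "res e y = K u + (- e) *\<^sub>R u" using resolvent_right[OF e', of "res e y"] by (simp add: u_def)
    moreover have "res (- e) y = K u + e *\<^sub>R u" using resolvent_right[OF e, of "res (- e) y"] by (simp add: u_def c)
    ultimately have "(norm (res e y))\<^sup>2 = (norm (res (- e) y))\<^sup>2"
      using norm_skew_shift[OF skew, of u e] norm_skew_shift[OF skew, of u "- e"] by simp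
    moreover have "inner (res d y) y = d * (norm (res d y))\<^sup>2" if "d \<noteq> 0" for d
    proof -
      have "inner (res d y) y = inner (res d y) (K (res d y) + d *\<^sub>R res d y)" by (simp only: resolvent_right[OF that])
      also have "\<dots> = d * (norm (res d y))\<^sup>2"
        using skew by (simp add: skew_op_def inner_add_right inner_commute[of _ "K _"] power2_norm_eq_inner)
      finally show ?thesis .
    qed
    ultimately show ?thesis using e e' by (simp add: skew_yosida_def inner_add_left)
  qed
  then show ?thesis using bounded_linear_yosida[OF e] by (simp add: skew_op_def)
qed

end

locale injective_skew = skew K for K :: "'a::{real_inner,banach} \<Rightarrow> 'a" +
  assumes K_eq_0: "K x = 0 \<Longrightarrow> x = 0"
begin

lemma dense_range: "closure (range K) = UNIV"
proof (rule dense_if_orthogonal_trivial)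
  show "subspace (range K)" using K.linear by (intro linear_subspace_image subspace_UNIV) auto
  fix y assume "\<And>z. z \<in> range K \<Longrightarrow> inner y z = 0"
  then have "inner y (K (K y)) = 0" by blast
  then have "inner (K y) (K y) = 0" by (simp add: skew_op_inner[OF skew])
  then show "y = 0" using K_eq_0 by simp
qed

lemma approx_by_range: 
  assumes "d > 0" obtains w where "norm (z - K w) < d"
proof -
  have "z \<in> closure (range K)" by (simp add: dense_range)
  then obtain y where "y \<in> range K" "dist y z < d" using assms closure_approachable by blast
  then show ?thesis using that by (auto simp: dist_norm norm_minus_commute)
qed

text \<open>On \<open>range K\<close> this follows from \<open>(K + e)\<^sup>-\<^sup>1 K w = w - e (K + e)\<^sup>-\<^sup>1 w\<close>; the operators \<open>e (K + e)\<^sup>-\<^sup>1\<close> are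
  contractions and \<open>range K\<close> is dense.\<close>

lemma resolvent_tendsto_0:
  assumes e0: "\<And>n. e n \<noteq> 0" and e: "e \<longlonglongrightarrow> 0"
  shows "(\<lambda>n. e n *\<^sub>R res (e n) z) \<longlonglongrightarrow> 0"
proof (rule tendstoI)
  fix d :: real assume d: "d > 0"
  obtain w where w: "norm (z - K w) < d / 2" using approx_by_range[of "d/2" z] d by auto
  have "(\<lambda>n. 2 * \<bar>e n\<bar> * norm w) \<longlonglongrightarrow> 2 * \<bar>0\<bar> * norm w" by (intro tendsto_intros e)
  then have "\<forall>\<^sub>F n in sequentially. 2 * \<bar>e n\<bar> * norm w < d / 2" using d by (intro order_tendstoD) auto
  then show "\<forall>\<^sub>F n in sequentially. dist (e n *\<^sub>R res (e n) z) 0 < d"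
  proof eventually_elim
    case (elim n)
    interpret R: bounded_linear "res (e n)" by (rule bounded_linear_resolvent[OF e0])
    have "res (e n) (K w) = K (res (e n) w)"
      by (rule resolvent_commute[OF K.bounded_linear_axioms _ e0]) simp
    also have "\<dots> = w - e n *\<^sub>R res (e n) w" using resolvent_right[OF e0, of n w] by (simp add: algebra_simps)
    finally have "norm (res (e n) (K w)) \<le> norm w + norm (e n *\<^sub>R res (e n) w)"
      using norm_triangle_ineq4 by metis
    then have "norm (res (e n) (K w)) \<le> 2 * norm w" using norm_resolvent[OF e0, of n w] by simp
    then have "norm (e n *\<^sub>R res (e n) (K w)) \<le> 2 * \<bar>e n\<bar> * norm w"
      using mult_left_mono[of _ _ "\<bar>e n\<bar>"] by (fastforce simp: mult_ac)
    moreover have "norm (e n *\<^sub>R res (e n) (z - K w)) < d / 2"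
      using norm_resolvent[OF e0, of n "z - K w"] w by simp
    moreover have "e n *\<^sub>R res (e n) z = e n *\<^sub>R res (e n) (K w) + e n *\<^sub>R res (e n) (z - K w)"
      by (simp add: R.diff scaleR_diff_right)
    ultimately show ?case using elim norm_triangle_ineq[of "e n *\<^sub>R res (e n) (K w)" "e n *\<^sub>R res (e n) (z - K w)"]
      by (simp add: dist_norm)
  qed
qed

lemma yosida_tendsto:
  assumes e0: "\<And>n. e n \<noteq> 0" and e: "e \<longlonglongrightarrow> 0"
  shows "(\<lambda>n. yosida (e n) (K z)) \<longlonglongrightarrow> z"
proof -
  have RK: "res d (K z) = z - d *\<^sub>R res d z" if "d \<noteq> 0" for d
  proof -
    have "res d (K z) = K (res d z)" by (rule resolvent_commute[OF K.bounded_linear_axioms _ that]) simp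
    then show ?thesis using resolvent_right[OF that, of z] by (simp add: algebra_simps)
  qed
  have "(\<lambda>n. (1/2) *\<^sub>R ((z - e n *\<^sub>R res (e n) z) + (z - (- e n) *\<^sub>R res (- e n) z))) \<longlonglongrightarrow> (1/2) *\<^sub>R ((z - 0) + (z - 0))"
    using e0 e by (intro tendsto_intros resolvent_tendsto_0 tendsto_minus_cancel_left[THEN iffD1]) (auto intro: tendsto_eq_intros)
  moreover have "yosida (e n) (K z) = (1/2) *\<^sub>R ((z - e n *\<^sub>R res (e n) z) + (z - (- e n) *\<^sub>R res (- e n) z))" for n
    using RK[OF e0[of n]] RK[of "- e n"] e0[of n] by (simp add: skew_yosida_def)
  ultimately show ?thesis by (simp flip: scaleR_2)
qed

end

text \<open>\<open>T t\<close> is the group \<open>e\<^bsup>tA\<^esup>\<close> generated by \<open>A = K\<^sup>-\<^sup>1\<close>. Differentiability is stated along \<open>K z\<close>, the general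
  element of the domain, so that \<open>A\<close> itself never has to be mentioned.\<close>

locale skew_flow = injective_skew K for K :: "'a::{real_inner,banach} \<Rightarrow> 'a" +
  fixes T :: "real \<Rightarrow> 'a \<Rightarrow> 'a"
  assumes flow_add: "T t (x + y) = T t x + T t y"
    and flow_scaleR: "T t (c *\<^sub>R x) = c *\<^sub>R T t x"
    and norm_flow: "norm (T t x) = norm x"
    and flow_0: "T 0 x = x"
    and flow_flow: "T s (T t x) = T (s + t) x"
    and flow_K: "T t (K x) = K (T t x)"
    and flow_continuous: "continuous_on UNIV (\<lambda>t. T t x)"
    and flow_derivative: "((\<lambda>t. T t (K z)) has_vector_derivative T t z) (at t)"

context injective_skew
begin

definition approx :: "nat \<Rightarrow> 'a \<Rightarrow> 'a" where
  "approx n = yosida (1 / Suc n)"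

definition approx_flow :: "nat \<Rightarrow> real \<Rightarrow> 'a \<Rightarrow> 'a" where
  "approx_flow n = exp_op (approx n)"

definition flow :: "real \<Rightarrow> 'a \<Rightarrow> 'a" where
  "flow t x = lim (\<lambda>n. approx_flow n t x)"

lemma skew_op_approx: "skew_op (approx n)"
  unfolding approx_def by (rule skew_op_yosida) simp

lemma approx_K: "approx n (K x) = K (approx n x)"
  unfolding approx_def by (rule yosida_K) simp

lemma approx_commute: "approx n (approx m x) = approx m (approx n x)"
  unfolding approx_def[of n]
  by (rule yosida_commute[where L = "approx m", OF skew_op_linear[OF skew_op_approx] approx_K]) simp

lemma approx_tendsto: "(\<lambda>n. approx n (K z)) \<longlonglongrightarrow> z"
  unfolding approx_def by (rule yosida_tendsto[where e = "\<lambda>n. 1 / real (Suc n)", OF _ LIMSEQ_Suc[OF lim_1_over_n]]) simp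

lemma approx_flow_diff_le:
  "norm (approx_flow m t (K z) - approx_flow n t (K z)) \<le> norm (approx m (K z) - approx n (K z)) * \<bar>t\<bar>"
  unfolding approx_flow_def
  by (rule norm_exp_op_diff_le[where B = "approx n" and C = "approx m", OF skew_op_approx skew_op_approx])
     (rule approx_commute)

lemma norm_approx_flow: "norm (approx_flow n t x) = norm x"
  by (simp add: approx_flow_def norm_exp_op skew_op_approx)

lemma approx_flow_add: "approx_flow n t (x + y) = approx_flow n t x + approx_flow n t y"
  by (simp add: approx_flow_def exp_op_add skew_op_approx)

lemma approx_flow_scaleR: "approx_flow n t (c *\<^sub>R x) = c *\<^sub>R approx_flow n t x"
  by (simp add: approx_flow_def exp_op_scaleR skew_op_approx)

lemma approx_flow_diff: "approx_flow n t (x - y) = approx_flow n t x - approx_flow n t y"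
  using approx_flow_add[of n t "x - y" y] by simp

lemma approx_flow_uniform_limit:
  "uniform_limit {-r..r} (\<lambda>n t. approx_flow n t z) (\<lambda>t. flow t z) sequentially"
proof -
  have "uniformly_Cauchy_on {-r..r} (\<lambda>n t. approx_flow n t z)"
  proof (rule uniformly_Cauchy_onI)
    fix e :: real assume e: "e > 0"
    obtain w where w: "norm (z - K w) < e / 3" using approx_by_range[of "e / 3" z] e by auto
    have "Cauchy (\<lambda>n. approx n (K w))" using approx_tendsto[of w] by (rule LIMSEQ_imp_Cauchy)
    moreover have "e / (3 * (\<bar>r\<bar> + 1)) > 0" using e by simp
    ultimately obtain N where
      N: "\<And>m n. m \<ge> N \<Longrightarrow> n \<ge> N \<Longrightarrow> dist (approx m (K w)) (approx n (K w)) < e / (3 * (\<bar>r\<bar> + 1))"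
      unfolding Cauchy_def by blast
    have "dist (approx_flow m t z) (approx_flow n t z) < e" if t: "t \<in> {-r..r}" and mn: "m \<ge> N" "n \<ge> N" for t m n
    proof -
      let ?E = approx_flow
      have "norm (?E m t (K w) - ?E n t (K w)) \<le> e / (3 * (\<bar>r\<bar> + 1)) * \<bar>t\<bar>"
        using mult_right_mono[OF less_imp_le[OF N[OF mn]], of "\<bar>t\<bar>"] approx_flow_diff_le[of m t w n]
        by (simp add: dist_norm)
      also have "\<dots> \<le> e / (3 * (\<bar>r\<bar> + 1)) * (\<bar>r\<bar> + 1)" using t e by (intro mult_left_mono) auto
      also have "\<dots> = e / 3" by (simp add: field_simps)
      finally have 1: "norm (?E m t (K w) - ?E n t (K w)) \<le> e / 3" .
      have 2: "norm (?E k t (z - K w)) < e / 3" for k using w by (simp add: norm_approx_flow)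
      have "?E m t z - ?E n t z = (?E m t (K w) - ?E n t (K w)) + (?E m t (z - K w) - ?E n t (z - K w))"
        by (simp add: approx_flow_diff)
      then have "norm (?E m t z - ?E n t z) \<le> norm (?E m t (K w) - ?E n t (K w)) + (norm (?E m t (z - K w)) + norm (?E n t (z - K w)))"
        using norm_triangle_ineq[of "?E m t (K w) - ?E n t (K w)" "?E m t (z - K w) - ?E n t (z - K w)"]
          norm_triangle_ineq4[of "?E m t (z - K w)" "?E n t (z - K w)"] by simp
      then show ?thesis using 1 2[of m] 2[of n] by (simp add: dist_norm)
    qed
    then show "\<exists>M. \<forall>t\<in>{-r..r}. \<forall>m\<ge>M. \<forall>n\<ge>M. dist (approx_flow m t z) (approx_flow n t z) < e" by blast
  qed
  then have "uniformly_convergent_on {-r..r} (\<lambda>n t. approx_flow n t z)"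
    by (rule Cauchy_uniformly_convergent)
  then show ?thesis by (simp add: uniformly_convergent_uniform_limit_iff flow_def)
qed

lemma approx_flow_tendsto: "(\<lambda>n. approx_flow n t z) \<longlonglongrightarrow> flow t z"
  by (rule tendsto_uniform_limitI[OF approx_flow_uniform_limit[where r = "\<bar>t\<bar>"]]) auto

text \<open>The derivatives \<open>e\<^bsup>sA\<^sub>n\<^esup> A\<^sub>n K z\<close> converge locally uniformly to \<open>flow s z\<close> since \<open>A\<^sub>n K z \<rightarrow> z\<close>.\<close>

lemma lim_flow_derivative: "((\<lambda>t. flow t (K z)) has_vector_derivative flow t z) (at t)"
proof -
  define S where "S = {-(\<bar>t\<bar> + 1)..\<bar>t\<bar> + 1}"
  have S: "t \<in> S" "t \<in> interior S" "convex S" by (auto simp: S_def)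
  have "\<exists>g. \<forall>s\<in>S. (\<lambda>n. approx_flow n s (K z)) \<longlonglongrightarrow> g s \<and> (g has_derivative (\<lambda>h. h *\<^sub>R flow s z)) (at s within S)"
  proof (rule has_derivative_sequence[where f' = "\<lambda>n s h. h *\<^sub>R approx_flow n s (approx n (K z))" and ?x0.0 = t,
        OF S(3) _ _ S(1) approx_flow_tendsto])
    show "((\<lambda>s. approx_flow n s (K z)) has_derivative (\<lambda>h. h *\<^sub>R approx_flow n s (approx n (K z)))) (at s within S)" for n s
    proof -
      have "approx_flow n s (approx n (K z)) = approx n (approx_flow n s (K z))"
        unfolding approx_flow_def
        by (rule exp_op_commute[symmetric]) (simp_all add: skew_op_approx skew_op_linear)
      moreover have "((\<lambda>s. approx_flow n s (K z)) has_vector_derivative approx n (approx_flow n s (K z))) (at s within S)"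
        unfolding approx_flow_def
        by (rule has_vector_derivative_at_within[OF exp_op_derivative[OF skew_op_linear[OF skew_op_approx]]])
      ultimately show ?thesis by (simp add: has_vector_derivative_def)
    qed
    show "\<forall>\<^sub>F n in sequentially. \<forall>s\<in>S. \<forall>h.
        norm (h *\<^sub>R approx_flow n s (approx n (K z)) - h *\<^sub>R flow s z) \<le> e * norm h" if e: "e > 0" for e
    proof -
      have "\<forall>\<^sub>F n in sequentially. dist (approx n (K z)) z < e / 2"
        by (rule tendstoD[OF approx_tendsto]) (use e in simp)
      moreover have "\<forall>\<^sub>F n in sequentially. \<forall>s\<in>S. dist (approx_flow n s z) (flow s z) < e / 2"
        unfolding S_def by (rule uniform_limitD[OF approx_flow_uniform_limit]) (use e in simp)
      ultimately show ?thesis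
      proof eventually_elim
        case (elim n)
        show ?case
        proof (intro ballI allI)
          fix s and h :: real assume s: "s \<in> S"
          let ?a = "approx n (K z)"
          have "approx_flow n s ?a - flow s z = approx_flow n s (?a - z) + (approx_flow n s z - flow s z)"
            unfolding approx_flow_diff by simp
          then have "norm (approx_flow n s ?a - flow s z) \<le> norm (?a - z) + norm (approx_flow n s z - flow s z)"
            using norm_triangle_ineq[of "approx_flow n s (?a - z)" "approx_flow n s z - flow s z"]
            by (simp only: norm_approx_flow)
          also have "\<dots> \<le> e / 2 + e / 2" using elim(1) bspec[OF elim(2) s] unfolding dist_norm by linarith
          finally have "norm (approx_flow n s ?a - flow s z) \<le> e" by simp
          then have "\<bar>h\<bar> * norm (approx_flow n s ?a - flow s z) \<le> \<bar>h\<bar> * e" by (rule mult_left_mono) simp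
          then show "norm (h *\<^sub>R approx_flow n s ?a - h *\<^sub>R flow s z) \<le> e * norm h"
            unfolding scaleR_diff_right[symmetric] by (simp add: mult.commute)
        qed
      qed
    qed
  qed
  then obtain g where g: "\<forall>s\<in>S. (\<lambda>n. approx_flow n s (K z)) \<longlonglongrightarrow> g s \<and>
      (g has_derivative (\<lambda>h. h *\<^sub>R flow s z)) (at s within S)" by (rule exE)
  have "flow s (K z) = g s" if "s \<in> S" for s
    using approx_flow_tendsto bspec[OF g that, THEN conjunct1] by (rule LIMSEQ_unique)
  then have "((\<lambda>s. flow s (K z)) has_derivative (\<lambda>h. h *\<^sub>R flow t z)) (at t within S)"
    by (rule has_derivative_transform[OF S(1) _ bspec[OF g S(1), THEN conjunct2]])
  then show ?thesis
    using at_within_interior[OF S(2)] by (simp add: has_vector_derivative_def)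
qed

lemma lim_flow_add: "flow t (x + y) = flow t x + flow t y"
  using tendsto_add[OF approx_flow_tendsto approx_flow_tendsto, of t x t y] approx_flow_tendsto[of t "x + y"]
  by (intro LIMSEQ_unique) (auto simp: approx_flow_add)

lemma lim_flow_scaleR: "flow t (c *\<^sub>R x) = c *\<^sub>R flow t x"
  using tendsto_scaleR[OF tendsto_const approx_flow_tendsto, of c t x] approx_flow_tendsto[of t "c *\<^sub>R x"]
  by (intro LIMSEQ_unique) (auto simp: approx_flow_scaleR)

lemma norm_lim_flow: "norm (flow t x) = norm x"
  using tendsto_norm[OF approx_flow_tendsto, of t x] by (simp add: norm_approx_flow LIMSEQ_const_iff)

lemma bounded_linear_lim_flow: "bounded_linear (flow t)"
  by (rule bounded_linear_intro[where K = 1]) (simp_all add: lim_flow_add lim_flow_scaleR norm_lim_flow)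

lemma lim_flow_0: "flow 0 x = x"
  using approx_flow_tendsto[of 0 x] by (simp add: approx_flow_def exp_op_0 LIMSEQ_const_iff)

lemma lim_flow_K: "flow t (K x) = K (flow t x)"
proof (rule LIMSEQ_unique[OF approx_flow_tendsto])
  have "approx_flow n t (K x) = K (approx_flow n t x)" for n
    unfolding approx_flow_def
    by (rule exp_op_commute[symmetric]) (auto simp: skew_op_approx K.bounded_linear_axioms approx_K)
  then show "(\<lambda>n. approx_flow n t (K x)) \<longlonglongrightarrow> K (flow t x)"
    using K.tendsto[OF approx_flow_tendsto] by simp
qed

text \<open>For \<open>x = K z\<close> both sides solve the same equation in \<open>s\<close>, their difference \<open>D\<close> satisfies \<open>D = K D'\<close>, and
  energy conservation applies; density does the rest.\<close>

lemma lim_flow_flow: "flow s (flow t x) = flow (s + t) x"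
proof -
  have range: "flow s (flow t x) = flow (s + t) x" if r: "x \<in> range K" for x
  proof -
    obtain z where x: "x = K z" using r by (rule rangeE)
    have "norm (flow s (flow t x) - flow (s + t) x) = norm (flow 0 (flow t x) - flow (0 + t) x)"
    proof (rule norm_const_if_orthogonal_derivative[where y' = "\<lambda>s. flow s (flow t z) - flow (s + t) z"])
      fix s
      have "((\<lambda>s. s + t) has_vector_derivative (1 + 0)) (at s)"
        by (intro has_vector_derivative_add has_vector_derivative_id has_vector_derivative_const)
      from vector_diff_chain_at[OF this lim_flow_derivative, of z]
      have "((\<lambda>s. flow (s + t) x) has_vector_derivative flow (s + t) z) (at s)" by (simp add: o_def x)
      moreover have "((\<lambda>s. flow s (flow t x)) has_vector_derivative flow s (flow t z)) (at s)"
        unfolding x lim_flow_K[of t] by (rule lim_flow_derivative)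
      ultimately show "((\<lambda>s. flow s (flow t x) - flow (s + t) x) has_vector_derivative flow s (flow t z) - flow (s + t) z) (at s)"
        by (intro has_vector_derivative_diff)
      show "inner (flow s (flow t z) - flow (s + t) z) (flow s (flow t x) - flow (s + t) x) = 0"
      proof -
        have "flow s (flow t x) - flow (s + t) x = K (flow s (flow t z) - flow (s + t) z)"
          by (simp add: x lim_flow_K K.diff)
        then show ?thesis using skew by (simp add: skew_op_def inner_commute)
      qed
    qed
    then show ?thesis by (simp add: lim_flow_0)
  qed
  interpret s: bounded_linear "flow s" by (rule bounded_linear_lim_flow)
  interpret t: bounded_linear "flow t" by (rule bounded_linear_lim_flow)
  interpret st: bounded_linear "flow (s + t)" by (rule bounded_linear_lim_flow)
  have "closed {x. flow s (flow t x) = flow (s + t) x}"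
    by (intro closed_Collect_eq s.continuous_on t.continuous_on st.continuous_on continuous_on_id)
  then have "closure (range K) \<subseteq> {x. flow s (flow t x) = flow (s + t) x}"
    using range by (intro closure_minimal) auto
  then show ?thesis by (auto simp: dense_range)
qed

lemma continuous_lim_flow: "continuous_on UNIV (\<lambda>t. flow t x)"
  unfolding continuous_on_eq_continuous_at[OF open_UNIV]
proof
  fix t :: real
  define S where "S = {-(\<bar>t\<bar> + 1)..\<bar>t\<bar> + 1}"
  have S: "t \<in> interior S" by (auto simp: S_def)
  have "continuous_on S (\<lambda>t. approx_flow n t x)" for n
    unfolding approx_flow_def
    by (intro continuous_at_imp_continuous_on ballI
        has_vector_derivative_continuous[OF exp_op_derivative[OF skew_op_linear[OF skew_op_approx]]])
  then have "continuous_on S (\<lambda>t. flow t x)"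
    by (intro uniform_limit_theorem[OF _ approx_flow_uniform_limit[where r = "\<bar>t\<bar> + 1", folded S_def]] always_eventually allI) simp_all
  then show "isCont (\<lambda>t. flow t x) t" using S by (rule continuous_on_interior)
qed

theorem skew_flow_exists: "skew_flow K flow"
  by unfold_locales
     (rule lim_flow_add lim_flow_scaleR norm_lim_flow lim_flow_0 lim_flow_flow lim_flow_K
        continuous_lim_flow lim_flow_derivative)+

end

section \<open>Complex structure\<close>

lemma cinner_add_right: "cinner x (y + z) = cinner x y + cinner x (z::'a::complex_inner)"
  by (subst (1 2 3) cinner_commute) (simp add: cinner_add_left)

lemma cinner_scaleC_right: "cinner x (c *\<^sub>C y) = cnj c * cinner x (y::'a::complex_inner)"
  by (subst (1 2) cinner_commute) (simp add: cinner_scaleC_left)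

lemma cinner_eq_inner: "cinner x y = Complex (inner x y) (inner x (\<i> *\<^sub>C y))"
  by (simp add: inner_Re_cinner cinner_scaleC_right complex_eq_iff)

lemma scaleC_scaleR: "c *\<^sub>C (r *\<^sub>R x) = r *\<^sub>R (c *\<^sub>C (x::'a::complex_inner))"
  by (simp add: scaleR_scaleC scaleC_scaleC mult.commute)

lemma norm_scaleC: "norm (c *\<^sub>C x) = cmod c * norm (x::'a::complex_inner)"
proof -
  have "cinner (c *\<^sub>C x) (c *\<^sub>C x) = complex_of_real ((cmod c)\<^sup>2) * cinner x x"
    by (simp add: cinner_scaleC_left cinner_scaleC_right complex_norm_square mult_ac del: of_real_power)
  then have "(norm (c *\<^sub>C x))\<^sup>2 = (cmod c * norm x)\<^sup>2"
    by (simp add: power2_norm_eq_inner inner_Re_cinner power_mult_distrib del: of_real_power)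
  then show ?thesis by (simp add: power2_eq_iff_nonneg)
qed

lemma bounded_linear_scaleC: "bounded_linear (\<lambda>x::'a::complex_inner. c *\<^sub>C x)"
  by (rule bounded_linear_intro[where K = "cmod c"])
     (simp_all add: scaleC_add_right scaleC_scaleR norm_scaleC mult.commute)

lemma eq_if_cinner_eq_on_dense:
  fixes x y :: "'a::complex_inner"
  assumes "closure D = UNIV" "\<And>z. z \<in> D \<Longrightarrow> cinner x z = cinner y z"
  shows "x = y"
proof -
  have "norm (x - y) \<le> 0"
  proof (rule norm_le_if_inner_bounded_on_dense)
    show "x - y \<in> closure D" using assms(1) by simp
    show "inner (x - y) z \<le> 0 * norm z" if "z \<in> D" for z
    proof -
      have "inner x z = inner y z" using assms(2)[OF that] by (simp add: inner_Re_cinner)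
      then show ?thesis by (simp add: inner_diff_left)
    qed
  qed simp
  then show ?thesis by simp
qed

section \<open>Unitary groups and their generators\<close>

locale complex_skew_flow = skew_flow K T for K :: "'a::{complex_inner,banach} \<Rightarrow> 'a" and T +
  assumes K_scaleC: "K (c *\<^sub>C x) = c *\<^sub>C K x"
begin

lemma bounded_linear_flow: "bounded_linear (T t)"
  by (rule bounded_linear_intro[where K = 1]) (simp_all add: flow_add flow_scaleR norm_flow)

lemma flow_diff: "T t (x - y) = T t x - T t y"
  using linear_diff[OF bounded_linear.linear[OF bounded_linear_flow]] .

lemma flow_inverse [simp]: "T t (T (- t) x) = x" "T (- t) (T t x) = x"
  by (simp_all add: flow_flow flow_0)

lemma cinner_K: "cinner (K x) y = - cinner x (K y)"
  unfolding cinner_eq_inner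
  by (simp add: skew_op_inner[OF skew] complex_eq_iff K_scaleC[symmetric])

text \<open>Complex linearity is another instance of uniqueness: \<open>T t (c x)\<close> and \<open>c T t x\<close> solve the same equation.\<close>

lemma flow_scaleC: "T t (c *\<^sub>C x) = c *\<^sub>C T t x"
proof -
  have on_range: "T t (c *\<^sub>C K z) = c *\<^sub>C T t (K z)" for z
  proof -
    define d where "d z t = T t (c *\<^sub>C z) - c *\<^sub>C T t z" for z t
    have dK: "d (K z) t = K (d z t)" for t
      by (simp add: d_def K.diff K_scaleC flow_K flip: K_scaleC)
    have "norm (d (K z) t) = norm (d (K z) 0)"
    proof (rule norm_const_if_orthogonal_derivative)
      show "(d (K z) has_vector_derivative d z t) (at t)" for t
        unfolding d_def K_scaleC[symmetric]
        by (intro has_vector_derivative_diff flow_derivative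
            bounded_linear.has_vector_derivative[OF bounded_linear_scaleC])
      show "inner (d z t) (d (K z) t) = 0" for t
        using skew by (simp add: dK skew_op_def inner_commute)
    qed
    then show ?thesis by (simp add: d_def flow_0)
  qed
  interpret bounded_linear "T t" by (rule bounded_linear_flow)
  interpret c: bounded_linear "\<lambda>x::'a. c *\<^sub>C x" by (rule bounded_linear_scaleC)
  have "closed {x. T t (c *\<^sub>C x) = c *\<^sub>C T t x}"
    by (intro closed_Collect_eq continuous_on c.continuous_on continuous_on_id)
  then have "closure (range K) \<subseteq> {x. T t (c *\<^sub>C x) = c *\<^sub>C T t x}"
    using on_range by (intro closure_minimal) auto
  then show ?thesis by (auto simp: dense_range)
qed

lemma inner_flow: "inner (T t x) (T t y) = inner x y"
  using dot_norm[of x y] dot_norm[of "T t x" "T t y"] by (simp add: norm_flow flip: flow_add)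

lemma cinner_flow: "cinner (T t x) (T t y) = cinner x y"
  by (simp add: cinner_eq_inner inner_flow flip: flow_scaleC)

lemma cinner_flow_left: "cinner (T t x) y = cinner x (T (- t) y)"
  using cinner_flow[of "- t" "T t x" y] by simp

lemma unitary_flow: "unitary (T t)"
  unfolding unitary_def clinear_def
  by (auto simp: flow_add flow_scaleC cinner_flow intro!: surjI[of "T t" "T (- t)"])

lemma unitary_group_flow: "unitary_group T"
  unfolding unitary_group_def
  by (auto simp: unitary_flow flow_0 flow_flow flow_continuous fun_eq_iff)

lemma adj_op_flow: "adj_op UNIV (T t) = T (- t)"
proof
  fix y
  show "adj_op UNIV (T t) y = T (- t) y"
    unfolding adj_op_def
  proof (rule the_equality)
    fix y' assume "\<forall>x\<in>UNIV. cinner (T t x) y = cinner x y'"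
    then have "cinner x y' = cinner x (T (- t) y)" for x by (metis UNIV_I cinner_flow_left)
    then have "cinner y' x = cinner (T (- t) y) x" for x by (metis cinner_commute)
    then show "y' = T (- t) y" by (intro eq_if_cinner_eq_on_dense[OF closure_UNIV]) 
  qed (simp add: cinner_flow_left)
qed

text \<open>The domain is not larger than \<open>range K\<close>: if the difference quotients at \<open>x\<close> converge to \<open>y\<close>, then applying
  \<open>K\<close> to them shows that \<open>K y\<close> is the derivative of \<open>T h (K x)\<close> at \<open>0\<close>, which is \<open>x\<close>.\<close>

lemma generates_flow:
  assumes D: "D = range K" and A: "\<And>x. A (K x) = x"
  shows "generates D A T"
proof -
  have diff_quot: "((\<lambda>h. (T h (K z) - K z) /\<^sub>R h) \<longlongrightarrow> z) (at 0)" for z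
  proof -
    have "((\<lambda>t. T t (K z)) has_vector_derivative z) (at 0)"
      using flow_derivative[of z 0] by (simp add: flow_0)
    then have lim: "((\<lambda>h. norm (T h (K z) - K z - h *\<^sub>R z) / \<bar>h\<bar>) \<longlongrightarrow> 0) (at 0)"
      by (simp add: has_vector_derivative_def has_derivative_at flow_0)
    have eq: "norm (T h (K z) - K z - h *\<^sub>R z) / \<bar>h\<bar> = norm ((T h (K z) - K z) /\<^sub>R h - z)"
      if "h \<noteq> 0" for h
    proof -
      have "(T h (K z) - K z) /\<^sub>R h - z = (T h (K z) - K z - h *\<^sub>R z) /\<^sub>R h"
        using that by (simp add: scaleR_diff_right)
      then show ?thesis by (simp add: divide_inverse mult.commute)
    qed
    have "\<forall>\<^sub>F h in at 0. norm (T h (K z) - K z - h *\<^sub>R z) / \<bar>h\<bar> = norm ((T h (K z) - K z) /\<^sub>R h - z)"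
      using eq by (auto simp: eventually_at_filter)
    with lim have "((\<lambda>h. norm ((T h (K z) - K z) /\<^sub>R h - z)) \<longlongrightarrow> 0) (at 0)"
      by (rule Lim_transform_eventually)
    then show ?thesis by (simp add: LIM_zero_iff tendsto_norm_zero_iff)
  qed
  have "x \<in> range K" if y: "((\<lambda>h. (T h x - x) /\<^sub>R h) \<longlongrightarrow> y) (at 0)" for x y
  proof -
    have "((\<lambda>h. K ((T h x - x) /\<^sub>R h)) \<longlongrightarrow> K y) (at 0)" by (rule K.tendsto[OF y])
    moreover have "K ((T h x - x) /\<^sub>R h) = (T h (K x) - K x) /\<^sub>R h" for h
      by (simp add: K.scaleR K.diff flow_K)
    ultimately have "K y = x" using diff_quot[of x] tendsto_unique[OF _ _ diff_quot[of x]] by simp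
    then show ?thesis by blast
  qed
  then show ?thesis
    unfolding generates_def D using diff_quot A by auto
qed

text \<open>If \<open>\<langle>A x, y\<rangle> = \<langle>x, y'\<rangle>\<close> on the domain, then \<open>\<langle>x, y\<rangle> = \<langle>K x, y'\<rangle> = -\<langle>x, K y'\<rangle>\<close> for all \<open>x\<close>, because \<open>A\<close> is
  onto; hence \<open>y = -K y'\<close> lies in the domain.\<close>

lemma adj_dom_generator:
  assumes D: "D = range K" and A: "\<And>x. A (K x) = x"
  shows "adj_dom D A = D"
proof
  show "adj_dom D A \<subseteq> D"
  proof
    fix y assume "y \<in> adj_dom D A"
    then obtain y' where y': "\<And>x. cinner x y = cinner (K x) y'" by (auto simp: adj_dom_def D A)
    have "cinner y x = cinner (- K y') x" for x
    proof -
      have "cinner x y = - cinner x (K y')" by (simp add: y' cinner_K)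
      then have "cinner y x = - cinner (K y') x" by (metis cinner_commute complex_cnj_minus)
      then show ?thesis by (simp add: minus_scaleC[of "K y'"] cinner_scaleC_left)
    qed
    then have "y = - K y'" by (intro eq_if_cinner_eq_on_dense[OF closure_UNIV])
    also have "\<dots> = K (- y')" by (simp add: K.neg)
    finally show "y \<in> D" by (simp add: D)
  qed
  show "D \<subseteq> adj_dom D A"
  proof
    fix y assume "y \<in> D"
    then obtain x where x: "y = K x" by (auto simp: D)
    have "cinner z (K x) = cinner (K z) (- x)" for z
      by (simp add: cinner_K minus_scaleC[of x] K_scaleC cinner_scaleC_right)
    then show "y \<in> adj_dom D A" unfolding adj_dom_def D by (auto simp: A x)
  qed
qed

lemma adj_op_generator:
  assumes D: "D = range K" and A: "\<And>x. A (K x) = x"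
  shows "adj_op D A (K x) = - x"
  unfolding adj_op_def
proof (rule the_equality)
  have sym: "cinner z (K x) = cinner (K z) (- x)" for z
    by (simp add: cinner_K minus_scaleC[of x] K_scaleC cinner_scaleC_right)
  then show "\<forall>z\<in>D. cinner (A z) (K x) = cinner z (- x)" by (auto simp: D A)
  fix y' assume "\<forall>z\<in>D. cinner (A z) (K x) = cinner z y'"
  then have "cinner (K z) y' = cinner (K z) (- x)" for z by (auto simp: D A sym)
  then have "cinner y' z = cinner (- x) z" if "z \<in> range K" for z
    using that by (metis cinner_commute rangeE)
  then show "y' = - x" by (rule eq_if_cinner_eq_on_dense[OF dense_range])
qed

lemma continuous_on_flow_apply:
  assumes Z: "continuous_on S Z"
  shows "continuous_on S (\<lambda>t. T t (Z t))"
  unfolding continuous_on_def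
proof
  fix t assume t: "t \<in> S"
  have "((\<lambda>s. T s (Z s - Z t)) \<longlongrightarrow> 0) (at t within S)"
  proof (rule tendsto_norm_zero_cancel)
    have "(Z \<longlongrightarrow> Z t) (at t within S)" using Z t by (simp add: continuous_on_def)
    then show "((\<lambda>s. norm (T s (Z s - Z t))) \<longlongrightarrow> 0) (at t within S)"
      by (simp add: norm_flow tendsto_norm_zero_iff LIM_zero)
  qed
  moreover have "((\<lambda>s. T s (Z t)) \<longlongrightarrow> T t (Z t)) (at t within S)"
    using continuous_on_subset[OF flow_continuous subset_UNIV, of S] t by (simp add: continuous_on_def)
  ultimately have "((\<lambda>s. T s (Z s - Z t) + T s (Z t)) \<longlongrightarrow> 0 + T t (Z t)) (at t within S)"
    by (rule tendsto_add)
  then show "((\<lambda>s. T s (Z s)) \<longlongrightarrow> T t (Z t)) (at t within S)" by (simp flip: flow_add)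
qed

end

section \<open>Square integrable inputs\<close>

lemma Cauchy_Schwarz_integral:
  fixes f g :: "'a \<Rightarrow> real"
  assumes f: "integrable M (\<lambda>x. (f x)\<^sup>2)" and g: "integrable M (\<lambda>x. (g x)\<^sup>2)"
    and fg: "integrable M (\<lambda>x. f x * g x)"
  shows "(\<integral>x. f x * g x \<partial>M)\<^sup>2 \<le> (\<integral>x. (f x)\<^sup>2 \<partial>M) * (\<integral>x. (g x)\<^sup>2 \<partial>M)"
proof -
  define F G P where "F = (\<integral>x. (f x)\<^sup>2 \<partial>M)" and "G = (\<integral>x. (g x)\<^sup>2 \<partial>M)" and "P = (\<integral>x. f x * g x \<partial>M)"
  have quad: "0 \<le> F - 2 * l * P + l\<^sup>2 * G" for l
  proof -
    have "0 \<le> (\<integral>x. (f x - l * g x)\<^sup>2 \<partial>M)" by simp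
    also have "(\<lambda>x. (f x - l * g x)\<^sup>2) = (\<lambda>x. (f x)\<^sup>2 - 2 * l * (f x * g x) + l\<^sup>2 * (g x)\<^sup>2)"
      by (simp add: fun_eq_iff power2_eq_square algebra_simps)
    also have "(\<integral>x. (f x)\<^sup>2 - 2 * l * (f x * g x) + l\<^sup>2 * (g x)\<^sup>2 \<partial>M) = F - 2 * l * P + l\<^sup>2 * G"
      using f g fg by (simp add: F_def G_def P_def)
    finally show ?thesis .
  qed
  have "G \<ge> 0" by (simp add: G_def)
  have "P\<^sup>2 \<le> F * G"
  proof (cases "G = 0")
    case True
    have "P = 0"
    proof (rule ccontr)
      assume "P \<noteq> 0"
      then show False using quad[of "(F + 1) / (2 * P)"] True by simp
    qed
    then show ?thesis using True by simp
  next
    case False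
    then have "G > 0" using \<open>G \<ge> 0\<close> by simp
    then have "F - 2 * (P / G) * P + (P / G)\<^sup>2 * G = (F * G - P\<^sup>2) / G"
      by (simp add: field_simps power2_eq_square)
    then show ?thesis using quad[of "P / G"] \<open>G > 0\<close> by (simp add: zero_le_divide_iff)
  qed
  then show ?thesis by (simp add: F_def G_def P_def)
qed

lemma sq_integrable_on_measurable:
  "sq_integrable_on I u \<Longrightarrow> (\<lambda>s. indicator I s *\<^sub>R u s) \<in> borel_measurable lebesgue"
  by (simp add: sq_integrable_on_def set_borel_measurable_def)

lemma sq_integrable_on_prod:
  assumes u: "sq_integrable_on I u" and v: "sq_integrable_on I v"
  shows "set_integrable lebesgue I (\<lambda>s. u s * cnj (v s))"
  unfolding set_integrable_def
proof (rule Bochner_Integration.integrable_bound)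
  have [measurable]: "(\<lambda>s. indicat_real I s *\<^sub>R u s) \<in> borel_measurable lebesgue"
    "(\<lambda>s. indicat_real I s *\<^sub>R v s) \<in> borel_measurable lebesgue"
    using assms by (auto intro: sq_integrable_on_measurable)
  show "integrable lebesgue (\<lambda>s. indicat_real I s *\<^sub>R (cmod (u s))\<^sup>2 + indicat_real I s *\<^sub>R (cmod (v s))\<^sup>2)"
    using assms by (intro Bochner_Integration.integrable_add) (auto simp: sq_integrable_on_def set_integrable_def)
  have "(\<lambda>s. indicat_real I s *\<^sub>R (u s * cnj (v s))) = (\<lambda>s. (indicat_real I s *\<^sub>R u s) * cnj (indicat_real I s *\<^sub>R v s))"
    by (auto simp: fun_eq_iff indicator_def)
  moreover have "(\<lambda>s. cnj (indicat_real I s *\<^sub>R v s)) \<in> borel_measurable lebesgue"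
    by (rule borel_measurable_continuous_on[of cnj]) (auto intro: continuous_intros)
  then have "(\<lambda>s. (indicat_real I s *\<^sub>R u s) * cnj (indicat_real I s *\<^sub>R v s)) \<in> borel_measurable lebesgue"
    by measurable
  ultimately show "(\<lambda>s. indicat_real I s *\<^sub>R (u s * cnj (v s))) \<in> borel_measurable lebesgue"
    by (simp only:)
  have "cmod (u s) * cmod (v s) \<le> (cmod (u s))\<^sup>2 + (cmod (v s))\<^sup>2" for s
  proof -
    have "2 * (cmod (u s) * cmod (v s)) \<le> (cmod (u s))\<^sup>2 + (cmod (v s))\<^sup>2" "0 \<le> cmod (u s) * cmod (v s)"
      using sum_squares_bound[of "cmod (u s)" "cmod (v s)"] by (simp_all add: mult.assoc)
    then show ?thesis by linarith
  qed
  then show "AE s in lebesgue. norm (indicat_real I s *\<^sub>R (u s * cnj (v s)))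
      \<le> norm (indicat_real I s *\<^sub>R (cmod (u s))\<^sup>2 + indicat_real I s *\<^sub>R (cmod (v s))\<^sup>2)"
    by (auto simp: indicator_def norm_mult)
qed

lemma sq_integrable_on_Cauchy_Schwarz:
  assumes u: "sq_integrable_on I u" and v: "sq_integrable_on I v"
  shows "(cmod (LINT s:I|lebesgue. u s * cnj (v s)))\<^sup>2 \<le>
    (LINT s:I|lebesgue. (cmod (u s))\<^sup>2) * (LINT s:I|lebesgue. (cmod (v s))\<^sup>2)"
proof -
  let ?f = "\<lambda>s. indicat_real I s * cmod (u s)" and ?g = "\<lambda>s. indicat_real I s * cmod (v s)"
  have sq: "(indicat_real I s * cmod x)\<^sup>2 = indicat_real I s *\<^sub>R (cmod x)\<^sup>2" for s and x
    by (simp add: indicator_def)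
  have prod: "norm (indicat_real I s *\<^sub>R (u s * cnj (v s))) = ?f s * ?g s" for s
    by (simp add: indicator_def norm_mult)
  have int: "integrable lebesgue (\<lambda>s. indicat_real I s *\<^sub>R (u s * cnj (v s)))"
    using sq_integrable_on_prod[OF assms] by (simp add: set_integrable_def)
  have "cmod (LINT s:I|lebesgue. u s * cnj (v s)) \<le> (\<integral>s. ?f s * ?g s \<partial>lebesgue)"
    unfolding set_lebesgue_integral_def prod[symmetric] by (rule integral_norm_bound)
  then have "(cmod (LINT s:I|lebesgue. u s * cnj (v s)))\<^sup>2 \<le> (\<integral>s. ?f s * ?g s \<partial>lebesgue)\<^sup>2"
    by (rule power_mono) simp
  also have "\<dots> \<le> (\<integral>s. (?f s)\<^sup>2 \<partial>lebesgue) * (\<integral>s. (?g s)\<^sup>2 \<partial>lebesgue)"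
    using u v integrable_norm[OF int] unfolding prod
    by (intro Cauchy_Schwarz_integral) (simp_all add: sq sq_integrable_on_def set_integrable_def)
  finally show ?thesis unfolding sq set_lebesgue_integral_def .
qed

lemma sq_integrable_on_add:
  assumes u: "sq_integrable_on I u" and v: "sq_integrable_on I v"
  shows "sq_integrable_on I (\<lambda>s. u s + v s)"
proof -
  have m: "(\<lambda>s. indicat_real I s *\<^sub>R (u s + v s)) \<in> borel_measurable lebesgue"
    unfolding scaleR_add_right
    by (intro borel_measurable_add sq_integrable_on_measurable assms)
  have "integrable lebesgue (\<lambda>s. indicat_real I s *\<^sub>R (cmod (u s + v s))\<^sup>2)"
  proof (rule Bochner_Integration.integrable_bound)
    show "integrable lebesgue (\<lambda>s. 2 * (indicat_real I s *\<^sub>R (cmod (u s))\<^sup>2) + 2 * (indicat_real I s *\<^sub>R (cmod (v s))\<^sup>2))"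
      using assms by (intro Bochner_Integration.integrable_add integrable_mult_right) (auto simp: sq_integrable_on_def set_integrable_def)
    have "(\<lambda>s. indicat_real I s *\<^sub>R (cmod (u s + v s))\<^sup>2) = (\<lambda>s. (cmod (indicat_real I s *\<^sub>R (u s + v s)))\<^sup>2)"
      by (auto simp: fun_eq_iff indicator_def)
    moreover have "(\<lambda>s. (cmod (indicat_real I s *\<^sub>R (u s + v s)))\<^sup>2) \<in> borel_measurable lebesgue"
      by (rule borel_measurable_continuous_on[OF _ m]) (intro continuous_intros)
    ultimately show "(\<lambda>s. indicat_real I s *\<^sub>R (cmod (u s + v s))\<^sup>2) \<in> borel_measurable lebesgue" by (simp only:)
    have "(cmod (u s + v s))\<^sup>2 \<le> 2 * (cmod (u s))\<^sup>2 + 2 * (cmod (v s))\<^sup>2" for s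
    proof -
      have "(cmod (u s + v s))\<^sup>2 \<le> (cmod (u s) + cmod (v s))\<^sup>2" by (intro power_mono norm_triangle_ineq) simp
      moreover have "0 \<le> (cmod (u s) - cmod (v s))\<^sup>2" by simp
      ultimately show ?thesis by (simp add: power2_diff power2_sum)
    qed
    then show "AE s in lebesgue. norm (indicat_real I s *\<^sub>R (cmod (u s + v s))\<^sup>2)
      \<le> norm (2 * (indicat_real I s *\<^sub>R (cmod (u s))\<^sup>2) + 2 * (indicat_real I s *\<^sub>R (cmod (v s))\<^sup>2))"
      by (auto simp: indicator_def)
  qed
  then show ?thesis using m by (simp add: sq_integrable_on_def set_integrable_def set_borel_measurable_def)
qed

lemma sq_integrable_on_continuous:
  assumes "continuous_on {a..b} u" shows "sq_integrable_on {a..b} u"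
proof -
  have "set_integrable lebesgue {a..b} (\<lambda>s. (cmod (u s))\<^sup>2)"
    using assms by (intro absolutely_integrable_continuous_real continuous_intros)
  moreover have "set_integrable lebesgue {a..b} u"
    using assms by (rule absolutely_integrable_continuous_real)
  ultimately show ?thesis
    by (auto simp: sq_integrable_on_def set_borel_measurable_def set_integrable_def)
qed

lemma sq_integrable_on_subset:
  assumes "sq_integrable_on I u" "J \<subseteq> I" "J \<in> sets lebesgue"
  shows "sq_integrable_on J u"
proof -
  have "(\<lambda>s. indicat_real J s *\<^sub>R indicat_real I s *\<^sub>R u s) \<in> borel_measurable lebesgue"
    by (rule borel_measurable_scaleR[OF borel_measurable_indicator[OF assms(3)] sq_integrable_on_measurable[OF assms(1)]])
  moreover have "(\<lambda>s. indicat_real J s *\<^sub>R indicat_real I s *\<^sub>R u s) = (\<lambda>s. indicat_real J s *\<^sub>R u s)"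
    using assms(2) by (auto simp: fun_eq_iff indicator_def)
  moreover have "set_integrable lebesgue J (\<lambda>s. (cmod (u s))\<^sup>2)"
    using assms by (auto simp: sq_integrable_on_def intro: set_integrable_subset)
  ultimately show ?thesis by (simp add: sq_integrable_on_def set_borel_measurable_def)
qed

lemma L2_loc_sq_integrable: "L2_loc u \<Longrightarrow> 0 \<le> a \<Longrightarrow> sq_integrable_on {a..b} u"
  unfolding L2_loc_def
  by (rule sq_integrable_on_subset[of "{0..max 1 b}"]) auto

lemma L2_loc_add: "L2_loc u \<Longrightarrow> L2_loc v \<Longrightarrow> L2_loc (\<lambda>s. u s + v s)"
  unfolding L2_loc_def by (simp add: sq_integrable_on_add)

lemma L2_loc_continuous: "continuous_on {0..} u \<Longrightarrow> L2_loc u"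
  unfolding L2_loc_def by (auto intro!: sq_integrable_on_continuous intro: continuous_on_subset)

lemma L2_loc_diff: 
  assumes "L2_loc u" "L2_loc v" shows "L2_loc (\<lambda>s. u s - v s)"
proof -
  have "L2_loc (\<lambda>s. - v s)"
    using assms(2) by (auto simp: L2_loc_def sq_integrable_on_def set_borel_measurable_def)
  from L2_loc_add[OF assms(1) this] show ?thesis by simp
qed

section \<open>Admissible observations and input maps\<close>

lemma set_integral_split:
  fixes f :: "real \<Rightarrow> 'b::euclidean_space"
  assumes f: "set_integrable lebesgue {a..c} f" and m: "a \<le> m" "m \<le> c"
  shows "(LINT s:{a..c}|lebesgue. f s) = (LINT s:{a..m}|lebesgue. f s) + (LINT s:{m..c}|lebesgue. f s)"
proof -
  have "set_integrable lebesgue {a..m} f" "set_integrable lebesgue {m..c} f"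
    using m by (auto intro: set_integrable_subset[OF f])
  then show ?thesis
    using f m Henstock_Kurzweil_Integration.integral_combine[OF m set_lebesgue_integral_eq_integral(1)[OF f]] by (simp add: set_lebesgue_integral_eq_integral)
qed

lemma set_integral_point: "(LINT s:{a..a::real}|lebesgue. (f s :: 'b::{banach, second_countable_topology})) = 0"
  unfolding set_lebesgue_integral_def
proof (rule integral_eq_zero_AE)
  have "AE s in lebesgue. s \<noteq> a" by (rule AE_completion[OF AE_lborel_singleton])
  then show "AE s in lebesgue. indicat_real {a..a} s *\<^sub>R f s = 0"
    by eventually_elim (auto simp: indicator_def)
qed

text \<open>\<open>b\<close> is the adjoint of a control operator. It is used on \<open>range K\<close> only, where it is bounded in the graph
  norm. The energy estimate is the dual form of admissibility, with the constant \<open>2 + \<tau>\<close> that the multiplier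
  method yields.\<close>

locale observed_flow = complex_skew_flow K T for K :: "'a::{complex_inner,banach} \<Rightarrow> 'a" and T +
  fixes b :: "'a \<Rightarrow> complex"
  assumes bounded_obs: "bounded_linear (\<lambda>x. b (K x))"
    and obs_scaleC: "b (K (c *\<^sub>C x)) = c * b (K x)"
    and obs_energy: "0 \<le> \<tau> \<Longrightarrow> integral {0..\<tau>} (\<lambda>s. (cmod (b (T s (K x))))\<^sup>2) \<le> (2 + \<tau>) * (norm (K x))\<^sup>2"
begin

sublocale obs: bounded_linear "\<lambda>x. b (K x)" by (rule bounded_obs)

lemma continuous_obs: "continuous_on S (\<lambda>s. b (T s (K x)))"
  unfolding flow_K
  by (intro obs.continuous_on continuous_on_subset[OF flow_continuous]) auto

lemma sq_integrable_obs: "sq_integrable_on {a..c} (\<lambda>s. b (T s (K x)))"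
  by (intro sq_integrable_on_continuous continuous_obs)

lemma obs_energy_window:
  assumes ac: "a \<le> c"
  shows "(LINT s:{a..c}|lebesgue. (cmod (b (T s (K x))))\<^sup>2) \<le> (2 + (c - a)) * (norm (K x))\<^sup>2"
proof -
  let ?k = "\<lambda>s. (cmod (b (T s (K x))))\<^sup>2"
  have "(LINT s:{a..c}|lebesgue. ?k s) = integral {a..c} ?k"
    by (intro set_lebesgue_integral_eq_integral absolutely_integrable_continuous_real continuous_intros continuous_obs)
  also have "\<dots> = integral {0 + a..(c - a) + a} ?k" by simp
  also have "\<dots> = integral {0..c - a} (?k \<circ> (\<lambda>s. s + a))"
    by (intro integral_shift[symmetric] continuous_intros continuous_obs)
  also have "\<dots> = integral {0..c - a} (\<lambda>s. (cmod (b (T s (K (T a x)))))\<^sup>2)"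
    by (simp add: o_def flow_flow flip: flow_K)
  also have "\<dots> \<le> (2 + (c - a)) * (norm (K (T a x)))\<^sup>2" using ac by (intro obs_energy) simp
  also have "norm (K (T a x)) = norm (K x)" by (simp add: norm_flow flip: flow_K)
  finally show ?thesis .
qed

text \<open>\<open>J = \<integral>\<^sub>a\<^sup>c T(-s) B v(s) ds\<close>, tested against the domain. Pulling the integrand back to time \<open>0\<close> removes the
  dependence on the final time from it, so increments of the input map are integrals of the same kind.\<close>

definition represents :: "'a \<Rightarrow> (real \<Rightarrow> complex) \<Rightarrow> real \<Rightarrow> real \<Rightarrow> bool" where
  "represents J v a c \<longleftrightarrow> (\<forall>x. cinner J (K x) = (LINT s:{a..c}|lebesgue. v s * cnj (b (T s (K x)))))"

lemma represents_unique: "represents J v a c \<Longrightarrow> represents J' v a c \<Longrightarrow> J = J'"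
  by (rule eq_if_cinner_eq_on_dense[OF dense_range]) (auto simp: represents_def)

lemma input_functional_bound:
  assumes v: "sq_integrable_on {a..c} v" and ac: "a \<le> c"
  shows "cmod (LINT s:{a..c}|lebesgue. v s * cnj (b (T s (K x))))
    \<le> sqrt ((2 + (c - a)) * (LINT s:{a..c}|lebesgue. (cmod (v s))\<^sup>2)) * norm (K x)"
proof (rule power2_le_imp_le)
  let ?V = "LINT s:{a..c}|lebesgue. (cmod (v s))\<^sup>2"
  have V: "0 \<le> ?V" by (simp add: set_lebesgue_integral_def)
  have "(cmod (LINT s:{a..c}|lebesgue. v s * cnj (b (T s (K x)))))\<^sup>2 \<le>
      ?V * (LINT s:{a..c}|lebesgue. (cmod (b (T s (K x))))\<^sup>2)"
    by (rule sq_integrable_on_Cauchy_Schwarz[OF v sq_integrable_obs])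
  also have "\<dots> \<le> ?V * ((2 + (c - a)) * (norm (K x))\<^sup>2)"
    using obs_energy_window[OF ac] V by (rule mult_left_mono)
  also have "\<dots> = (sqrt ((2 + (c - a)) * ?V) * norm (K x))\<^sup>2"
    using V ac by (simp add: power_mult_distrib)
  finally show "(cmod (LINT s:{a..c}|lebesgue. v s * cnj (b (T s (K x)))))\<^sup>2 \<le> (sqrt ((2 + (c - a)) * ?V) * norm (K x))\<^sup>2" .
  show "0 \<le> sqrt ((2 + (c - a)) * ?V) * norm (K x)" using V ac by simp
qed

lemma norm_represents:
  assumes v: "sq_integrable_on {a..c} v" and ac: "a \<le> c" and J: "represents J v a c"
  shows "(norm J)\<^sup>2 \<le> (2 + (c - a)) * (LINT s:{a..c}|lebesgue. (cmod (v s))\<^sup>2)"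
proof -
  let ?V = "LINT s:{a..c}|lebesgue. (cmod (v s))\<^sup>2"
  have V: "0 \<le> ?V" by (simp add: set_lebesgue_integral_def)
  have "norm J \<le> sqrt ((2 + (c - a)) * ?V)"
  proof (rule norm_le_if_inner_bounded_on_dense)
    show "J \<in> closure (range K)" by (simp add: dense_range)
    show "inner J z \<le> sqrt ((2 + (c - a)) * ?V) * norm z" if z: "z \<in> range K" for z
    proof -
      obtain x where x: "z = K x" using z by (rule rangeE)
      have "inner J z \<le> cmod (cinner J z)" unfolding inner_Re_cinner by (rule complex_Re_le_cmod)
      also have "\<dots> \<le> sqrt ((2 + (c - a)) * ?V) * norm z"
        using J input_functional_bound[OF v ac, of x] by (simp add: represents_def x)
      finally show ?thesis .
    qed
  qed (use V ac in simp)
  then have "(norm J)\<^sup>2 \<le> (sqrt ((2 + (c - a)) * ?V))\<^sup>2" by (rule power_mono) simp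
  then show ?thesis using V ac by simp
qed

text \<open>The bound on the functional permits Riesz representation of its real part; multiplication of the argument
  by \<open>\<i>\<close> recovers the imaginary part.\<close>

lemma represents_exists:
  assumes v: "sq_integrable_on {a..c} v" and ac: "a \<le> c"
  shows "\<exists>J. represents J v a c"
proof -
  define G where "G z = (LINT s:{a..c}|lebesgue. v s * cnj (b (T s z)))" for z
  have int: "set_integrable lebesgue {a..c} (\<lambda>s. v s * cnj (b (T s (K x))))" for x
    by (rule sq_integrable_on_prod[OF v sq_integrable_obs])
  have G_add: "G (K x + K y) = G (K x) + G (K y)" for x y
  proof -
    have "G (K x + K y) = (LINT s:{a..c}|lebesgue. v s * cnj (b (T s (K x))) + v s * cnj (b (T s (K y))))"
      unfolding G_def by (simp add: flow_K obs.add flow_add algebra_simps flip: K.add)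
    then show ?thesis unfolding G_def using set_integral_add(2)[OF int int] by simp
  qed
  have G_scale: "G (d *\<^sub>C K x) = cnj d * G (K x)" for d x
  proof -
    have "G (d *\<^sub>C K x) = (LINT s:{a..c}|lebesgue. cnj d * (v s * cnj (b (T s (K x)))))"
      unfolding G_def by (simp add: flow_K flow_scaleC obs_scaleC mult_ac flip: K_scaleC)
    then show ?thesis by (simp add: G_def)
  qed
  obtain J where J: "\<And>z. z \<in> range K \<Longrightarrow> inner J z = Re (G z)"
  proof (rule riesz_on_subspace[of "range K" "\<lambda>z. Re (G z)"
        "sqrt ((2 + (c - a)) * (LINT s:{a..c}|lebesgue. (cmod (v s))\<^sup>2))"])
    show "subspace (range K)" using K.linear by (intro linear_subspace_image subspace_UNIV) auto
    show "Re (G (x + y)) = Re (G x) + Re (G y)" if "x \<in> range K" "y \<in> range K" for x y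
      using that by (auto simp: G_add)
    show "Re (G (d *\<^sub>R x)) = d * Re (G x)" if "x \<in> range K" for d x
      using that by (auto simp: scaleR_scaleC G_scale)
    show "\<bar>Re (G z)\<bar> \<le> sqrt ((2 + (c - a)) * (LINT s:{a..c}|lebesgue. (cmod (v s))\<^sup>2)) * norm z"
      if z: "z \<in> range K" for z
    proof -
      obtain x where "z = K x" using z by (rule rangeE)
      then show ?thesis
        using input_functional_bound[OF v ac, of x] abs_Re_le_cmod[of "G z"] by (simp add: G_def)
    qed
  qed (use that in blast)
  have "cinner J (K x) = G (K x)" for x
  proof (rule complex_eqI)
    show "Re (cinner J (K x)) = Re (G (K x))" using J[of "K x"] by (simp add: inner_Re_cinner)
    have "inner J (K (\<i> *\<^sub>C x)) = Re (G (K (\<i> *\<^sub>C x)))" by (rule J) simp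
    then show "Im (cinner J (K x)) = Im (G (K x))"
      by (simp add: K_scaleC inner_Re_cinner cinner_scaleC_right G_scale)
  qed
  then show ?thesis by (auto simp: represents_def G_def)
qed

definition input :: "(real \<Rightarrow> complex) \<Rightarrow> real \<Rightarrow> 'a" where
  "input v t = (SOME J. represents J v 0 t)"

definition energy :: "(real \<Rightarrow> complex) \<Rightarrow> real \<Rightarrow> real" where
  "energy v t = (LINT s:{0..t}|lebesgue. (cmod (v s))\<^sup>2)"

lemma represents_input:
  assumes "L2_loc v" "0 \<le> t" shows "represents (input v t) v 0 t"
  unfolding input_def
  by (rule someI_ex[OF represents_exists]) (use assms in \<open>simp_all add: L2_loc_sq_integrable\<close>)

lemma energy_split:
  assumes v: "L2_loc v" and ac: "0 \<le> a" "a \<le> c"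
  shows "(LINT s:{a..c}|lebesgue. (cmod (v s))\<^sup>2) = energy v c - energy v a"
  using set_integral_split[of 0 c "\<lambda>s. (cmod (v s))\<^sup>2" a] L2_loc_sq_integrable[OF v, of 0 c] ac
  by (simp add: energy_def sq_integrable_on_def)

lemma continuous_energy:
  assumes v: "L2_loc v" shows "continuous_on {0..} (energy v)"
proof (rule continuous_on_atLeast_if_compact)
  fix \<tau> :: real
  have int: "set_integrable lebesgue {0..\<tau>} (\<lambda>s. (cmod (v s))\<^sup>2)"
    using L2_loc_sq_integrable[OF v, of 0 \<tau>] by (simp add: sq_integrable_on_def)
  then have "(\<lambda>s. (cmod (v s))\<^sup>2) integrable_on {0..\<tau>}" by (rule set_lebesgue_integral_eq_integral)
  then have "continuous_on {0..\<tau>} (\<lambda>t. integral {0..t} (\<lambda>s. (cmod (v s))\<^sup>2))"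
    by (rule indefinite_integral_continuous_1)
  moreover have "energy v t = integral {0..t} (\<lambda>s. (cmod (v s))\<^sup>2)" if "t \<in> {0..\<tau>}" for t
    unfolding energy_def
    by (rule set_lebesgue_integral_eq_integral(2)[OF set_integrable_subset[OF int]]) (use that in auto)
  ultimately show "continuous_on {0..\<tau>} (energy v)" by (simp cong: continuous_on_cong_simp)
qed

lemma represents_increment:
  assumes v: "L2_loc v" and ac: "0 \<le> a" "a \<le> c"
  shows "represents (input v c - input v a) v a c"
  unfolding represents_def
proof
  fix x
  have "set_integrable lebesgue {0..c} (\<lambda>s. v s * cnj (b (T s (K x))))"
    by (rule sq_integrable_on_prod[OF L2_loc_sq_integrable[OF v] sq_integrable_obs]) simp
  from set_integral_split[OF this ac]
  have "cinner (input v c) (K x) = cinner (input v a) (K x) + (LINT s:{a..c}|lebesgue. v s * cnj (b (T s (K x))))"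
    using represents_input[OF v, of c] represents_input[OF v, of a] ac by (simp add: represents_def)
  moreover have "cinner (input v c) (K x) = cinner (input v c - input v a) (K x) + cinner (input v a) (K x)"
    by (simp flip: cinner_add_left)
  ultimately show "cinner (input v c - input v a) (K x) = (LINT s:{a..c}|lebesgue. v s * cnj (b (T s (K x))))"
    by simp
qed

lemma norm_input_increment:
  assumes v: "L2_loc v" and ac: "0 \<le> a" "a \<le> c"
  shows "(norm (input v c - input v a))\<^sup>2 \<le> (2 + (c - a)) * (energy v c - energy v a)"
  using norm_represents[OF L2_loc_sq_integrable[OF v ac(1)] ac(2) represents_increment[OF assms]]
  by (simp add: energy_split[OF assms])

lemma input_0: assumes "L2_loc v" shows "input v 0 = 0"
proof (rule represents_unique[OF represents_input[OF assms order_refl]])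
  show "represents 0 v 0 0"
    unfolding represents_def set_integral_point using cinner_add_left[of "0::'a" 0] by simp
qed

lemma input_diff:
  assumes v: "L2_loc v" and w: "L2_loc w" and t: "0 \<le> t"
  shows "input v t - input w t = input (\<lambda>s. v s - w s) t"
proof (rule represents_unique[OF _ represents_input[OF L2_loc_diff[OF v w] t]])
  have int: "set_integrable lebesgue {0..t} (\<lambda>s. v s * cnj (b (T s (K x))))" if "L2_loc v" for v x
    by (rule sq_integrable_on_prod[OF L2_loc_sq_integrable[OF that] sq_integrable_obs]) simp
  have "cinner (input v t - input w t) (K x) = cinner (input v t) (K x) - cinner (input w t) (K x)" for x
    using cinner_add_left[of "input v t - input w t" "input w t" "K x"] by simp
  then show "represents (input v t - input w t) (\<lambda>s. v s - w s) 0 t"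
    using represents_input[OF v t] represents_input[OF w t]
    by (simp add: represents_def left_diff_distrib set_integral_diff(2)[OF int[OF v] int[OF w]])
qed

lemma norm_input_diff:
  assumes v: "L2_loc v" and w: "L2_loc w" and t: "0 \<le> t"
  shows "(norm (input v t - input w t))\<^sup>2 \<le> (2 + t) * energy (\<lambda>s. v s - w s) t"
  using norm_input_increment[OF L2_loc_diff[OF v w] order_refl t]
  unfolding energy_def set_integral_point
  by (simp add: input_diff[OF assms] input_0 L2_loc_diff[OF v w])

lemma continuous_input:
  assumes v: "L2_loc v" shows "continuous_on {0..} (input v)"
  unfolding continuous_on_def
proof
  fix t :: real assume t: "t \<in> {0..}"
  let ?F = "at t within {0..}"
  have E: "(energy v \<longlongrightarrow> energy v t) ?F"
    using continuous_energy[OF v] t by (simp add: continuous_on_def)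
  have "((\<lambda>s. sqrt ((2 + \<bar>s - t\<bar>) * \<bar>energy v s - energy v t\<bar>)) \<longlongrightarrow> sqrt ((2 + \<bar>t - t\<bar>) * \<bar>energy v t - energy v t\<bar>)) ?F"
    by (intro tendsto_intros E)
  then have lim: "((\<lambda>s. sqrt ((2 + \<bar>s - t\<bar>) * \<bar>energy v s - energy v t\<bar>)) \<longlongrightarrow> 0) ?F" by simp
  have "norm (input v s - input v t) \<le> sqrt ((2 + \<bar>s - t\<bar>) * \<bar>energy v s - energy v t\<bar>)" if s: "0 \<le> s" for s
  proof (rule real_le_rsqrt)
    show "(norm (input v s - input v t))\<^sup>2 \<le> (2 + \<bar>s - t\<bar>) * \<bar>energy v s - energy v t\<bar>"
    proof (cases "s \<le> t")
      case True
      have "(norm (input v s - input v t))\<^sup>2 \<le> (2 + (t - s)) * (energy v t - energy v s)"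
        using norm_input_increment[OF v s True] by (simp add: norm_minus_commute)
      also have "\<dots> \<le> (2 + (t - s)) * \<bar>energy v s - energy v t\<bar>" using True by (intro mult_left_mono) auto
      finally show ?thesis using True by simp
    next
      case False
      then have "(norm (input v s - input v t))\<^sup>2 \<le> (2 + (s - t)) * (energy v s - energy v t)"
        using norm_input_increment[OF v, of t s] t by simp
      also have "\<dots> \<le> (2 + (s - t)) * \<bar>energy v s - energy v t\<bar>" using False by (intro mult_left_mono) auto
      finally show ?thesis using False by simp
    qed
  qed
  then have "\<forall>\<^sub>F s in ?F. norm (input v s - input v t) \<le> sqrt ((2 + \<bar>s - t\<bar>) * \<bar>energy v s - energy v t\<bar>)"
    by (auto simp: eventually_at_filter)
  from Lim_null_comparison[OF this lim] show "(input v \<longlongrightarrow> input v t) ?F"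
    by (rule LIM_zero_cancel)
qed

text \<open>The mild solution formula pairs with \<open>T(s - t) z\<close>, which is \<open>T s\<close> applied to the element \<open>T(-t) z\<close> of the
  domain; so \<open>T t J\<close> is the integral required there.\<close>

lemma has_dual_integral_represents:
  assumes D: "D = range K" and A: "\<And>x. A (K x) = x"
    and v: "sq_integrable_on {0..t} v" and J: "represents J v 0 t"
  shows "has_dual_integral D A {0..t} (\<lambda>s. ext_op (T (t - s)) (control_op b (v s))) (cinner (T t J))"
  unfolding has_dual_integral_def adj_dom_generator[OF D A] ext_op_def adj_op_flow control_op_def
proof
  fix z assume "z \<in> D"
  then obtain x where x: "z = K x" unfolding D by (rule rangeE)
  have eq: "T (- (t - s)) z = T s (K (T (- t) x))" for s
    by (simp add: x flow_K[symmetric] flow_flow)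
  have "cinner (T t J) z = cinner J (K (T (- t) x))"
    by (simp add: cinner_flow_left x flow_K)
  then show "set_integrable lebesgue {0..t} (\<lambda>s. v s * cnj (b (T (- (t - s)) z))) \<and>
      (LINT s:{0..t}|lebesgue. v s * cnj (b (T (- (t - s)) z))) = cinner (T t J) z"
    using J unfolding eq represents_def
    by (simp add: sq_integrable_on_prod[OF v sq_integrable_obs])
qed

lemma bounded_control_obs:
  assumes D: "D = range K" and A: "\<And>x. A (K x) = x"
  shows "bounded_control D A (control_op b)"
proof -
  obtain C where C: "\<And>x. cmod (b (K x)) \<le> norm x * C" "C > 0" using obs.pos_bounded by blast
  have "cmod (control_op b v (K x)) \<le> C * cmod v * (norm (K x) + norm (adj_op D A (K x)))" for v x
  proof -
    have "cmod v * cmod (b (K x)) \<le> cmod v * (norm x * C)" using C by (intro mult_left_mono) auto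
    also have "\<dots> \<le> C * cmod v * (norm (K x) + norm x)"
      using C(2) by (simp add: algebra_simps)
    finally show ?thesis
      unfolding adj_op_generator[OF D A] by (simp add: control_op_def norm_mult)
  qed
  then have "\<forall>v. \<forall>z\<in>D. cmod (control_op b v z) \<le> C * cmod v * (norm z + norm (adj_op D A z))"
    by (auto simp: D)
  moreover have "b (K x + K y) = b (K x) + b (K y)" "b (c *\<^sub>C K x) = c * b (K x)" for x y c
    by (simp_all flip: K.add K_scaleC add: obs.add obs_scaleC)
  ultimately show ?thesis
    unfolding bounded_control_def adj_dom_generator[OF D A]
    by (auto simp: control_op_def D algebra_simps)
qed

lemma admissible_obs:
  assumes D: "D = range K" and A: "\<And>x. A (K x) = x"
  shows "admissible D A T (control_op b)"
  unfolding admissible_def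
proof (intro conjI exI[of _ "1::real"] allI impI)
  show "bounded_control D A (control_op b)" by (rule bounded_control_obs[OF D A])
  fix u assume u: "sq_integrable_on {0..1} u"
  obtain J where "represents J u 0 1" using represents_exists[OF u] by auto
  from has_dual_integral_represents[OF D A u this]
  show "\<exists>x. has_dual_integral D A {0..1} (\<lambda>s. ext_op (T (1 - s)) (control_op b (u s))) (cinner x)" by blast
qed simp

end

section \<open>Components that the inputs do not excite at first order\<close>

context observed_flow
begin

text \<open>Along the flow, the time derivative of \<open>b (K (T s e))\<close> is the observation \<open>b (T s e)\<close>, whose \<open>L\<^sup>2\<close> norm is
  controlled by \<open>e\<close>. The estimate itself contains only bounded quantities and extends to all \<open>e\<close>.\<close>

lemma obs_drift_nonneg:
  assumes r: "0 \<le> r"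
  shows "(cmod (b (K (T r e)) - b (K e)))\<^sup>2 \<le> r * (2 + r) * (norm e)\<^sup>2"
proof -
  have on_range: "(cmod (b (K (T r e)) - b (K e)))\<^sup>2 \<le> r * (2 + r) * (norm e)\<^sup>2" if e: "e \<in> range K" for e
  proof -
    obtain x where x: "e = K x" using e by (rule rangeE)
    let ?k = "\<lambda>s. b (T s (K x))"
    have d: "((\<lambda>s. b (K (T s e))) has_vector_derivative ?k s) (at s within {0..r})" for s
      unfolding x flow_K[of s x]
      by (rule has_vector_derivative_at_within[OF obs.has_vector_derivative[OF flow_derivative]])
    have "(?k has_integral b (K (T r e)) - b (K (T 0 e))) {0..r}"
      by (rule fundamental_theorem_of_calculus[OF r d])
    then have "b (K (T r e)) - b (K e) = integral {0..r} ?k" by (simp add: flow_0 integral_unique)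
    also have "\<dots> = (LINT s:{0..r}|lebesgue. ?k s * cnj 1)"
      by (simp add: set_lebesgue_integral_eq_integral absolutely_integrable_continuous_real continuous_obs)
    finally have "(cmod (b (K (T r e)) - b (K e)))\<^sup>2 \<le>
        (LINT s:{0..r}|lebesgue. (cmod (?k s))\<^sup>2) * (LINT s:{0..r}|lebesgue. (cmod 1)\<^sup>2)"
      using sq_integrable_on_Cauchy_Schwarz[OF sq_integrable_obs[of 0 r x], of "\<lambda>_. 1"]
      by (simp add: sq_integrable_on_continuous)
    also have "(LINT s:{0..r}|lebesgue. (cmod 1)\<^sup>2) = r"
      using r by (simp add: set_lebesgue_integral_eq_integral absolutely_integrable_continuous_real)
    also have "(LINT s:{0..r}|lebesgue. (cmod (?k s))\<^sup>2) * r \<le> ((2 + (r - 0)) * (norm (K x))\<^sup>2) * r"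
      using r by (intro mult_right_mono obs_energy_window) auto
    finally show ?thesis by (simp add: x mult_ac)
  qed
  have "closed {e. (cmod (b (K (T r e)) - b (K e)))\<^sup>2 \<le> r * (2 + r) * (norm e)\<^sup>2}"
    by (intro closed_Collect_le continuous_intros obs.continuous_on
        bounded_linear.continuous_on[OF bounded_linear_flow])
  then have "closure (range K) \<subseteq> {e. (cmod (b (K (T r e)) - b (K e)))\<^sup>2 \<le> r * (2 + r) * (norm e)\<^sup>2}"
    using on_range by (intro closure_minimal) auto
  then show ?thesis by (auto simp: dense_range)
qed

lemma obs_drift: "(cmod (b (K (T r e)) - b (K e)))\<^sup>2 \<le> \<bar>r\<bar> * (2 + \<bar>r\<bar>) * (norm e)\<^sup>2"
proof (cases "0 \<le> r")
  case True
  then show ?thesis using obs_drift_nonneg[of r e] by simp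
next
  case False
  then show ?thesis
    using obs_drift_nonneg[of "- r" "T r e"] by (simp add: norm_flow norm_minus_commute)
qed

text \<open>If \<open>K e\<close> is not observed, then \<open>T s (K e)\<close> has an observation of order \<open>s\<^sup>1\<^sup>/\<^sup>2\<close> by the preceding lemma. Its
  \<open>L\<^sup>2\<close> norm over a window of length \<open>h = c - a\<close> is then of order \<open>h\<close>, and the Cauchy-Schwarz inequality adds
  the factor \<open>(\<integral>\<^sub>a\<^sup>c |v|\<^sup>2)\<^sup>1\<^sup>/\<^sup>2\<close>, which tends to \<open>0\<close> with \<open>h\<close>.\<close>

lemma cinner_K_input_increment:
  assumes v: "L2_loc v" and ac: "0 \<le> a" "a \<le> c" and r: "a \<le> r" "r \<le> c" and e: "b (K e) = 0"
  shows "cmod (cinner (K (T r (input v c - input v a))) e) \<le>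
    (c - a) * sqrt ((2 + (c - a)) * (energy v c - energy v a)) * norm e"
proof (rule power2_le_imp_le)
  let ?h = "c - a" and ?J = "input v c - input v a"
  let ?k = "\<lambda>s. b (T s (K (T (- r) e)))"
  have E: "0 \<le> energy v c - energy v a"
    using energy_split[OF v ac] by (simp add: set_lebesgue_integral_def flip: energy_split[OF v ac])
  have "cinner (K (T r ?J)) e = - cinner ?J (K (T (- r) e))"
    by (simp add: cinner_K cinner_flow_left flow_K)
  also have "cinner ?J (K (T (- r) e)) = (LINT s:{a..c}|lebesgue. v s * cnj (?k s))"
    using represents_increment[OF v ac] by (simp add: represents_def)
  finally have "(cmod (cinner (K (T r ?J)) e))\<^sup>2 \<le>
      (LINT s:{a..c}|lebesgue. (cmod (v s))\<^sup>2) * (LINT s:{a..c}|lebesgue. (cmod (?k s))\<^sup>2)"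
    using sq_integrable_on_Cauchy_Schwarz[OF L2_loc_sq_integrable[OF v ac(1)] sq_integrable_obs] by simp
  also have "\<dots> = (energy v c - energy v a) * (LINT s:{a..c}|lebesgue. (cmod (?k s))\<^sup>2)"
    by (simp only: energy_split[OF v ac])
  also have "\<dots> \<le> (energy v c - energy v a) * (?h * (?h * (2 + ?h) * (norm e)\<^sup>2))"
  proof (rule mult_left_mono[OF _ E])
    have bound: "(cmod (?k s))\<^sup>2 \<le> ?h * (2 + ?h) * (norm e)\<^sup>2" if s: "s \<in> {a..c}" for s
    proof -
      have "?k s = b (K (T (s - r) e)) - b (K e)" by (simp add: flow_K flow_flow e)
      then have "(cmod (?k s))\<^sup>2 \<le> \<bar>s - r\<bar> * (2 + \<bar>s - r\<bar>) * (norm e)\<^sup>2" using obs_drift by simp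
      also have "\<dots> \<le> ?h * (2 + ?h) * (norm e)\<^sup>2"
        using s r by (intro mult_right_mono mult_mono) auto
      finally show ?thesis .
    qed
    have "(LINT s:{a..c}|lebesgue. (cmod (?k s))\<^sup>2) = integral {a..c} (\<lambda>s. (cmod (?k s))\<^sup>2)"
      by (intro set_lebesgue_integral_eq_integral absolutely_integrable_continuous_real continuous_intros continuous_obs)
    also have "\<dots> \<le> integral {a..c} (\<lambda>s. ?h * (2 + ?h) * (norm e)\<^sup>2)"
      using bound by (intro integral_le integrable_continuous_real continuous_intros continuous_obs) auto
    also have "\<dots> = ?h * (?h * (2 + ?h) * (norm e)\<^sup>2)" using ac by simp
    finally show "(LINT s:{a..c}|lebesgue. (cmod (?k s))\<^sup>2) \<le> ?h * (?h * (2 + ?h) * (norm e)\<^sup>2)" .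
  qed
  also have "\<dots> = (?h * sqrt ((2 + ?h) * (energy v c - energy v a)) * norm e)\<^sup>2"
    using E ac by (simp add: power_mult_distrib) (simp add: power2_eq_square)
  finally show "(cmod (cinner (K (T r ?J)) e))\<^sup>2 \<le> (?h * sqrt ((2 + ?h) * (energy v c - energy v a)) * norm e)\<^sup>2" .
  show "0 \<le> ?h * sqrt ((2 + ?h) * (energy v c - energy v a)) * norm e" using E ac by simp
qed

text \<open>Testing the preceding bound with \<open>R (p y)\<close>, where \<open>y\<close> is the vector estimated there and \<open>R\<close> the adjoint of
  \<open>p\<close>, turns it into a bound for the norm of \<open>p y\<close>. It is \<open>|s - t|\<close> times a function that tends to \<open>0\<close>.\<close>

lemma input_part_derivative:
  fixes p :: "'a \<Rightarrow> 'b::complex_inner" and R :: "'b \<Rightarrow> 'a"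
  assumes v: "L2_loc v" and t: "0 \<le> t"
    and adj: "\<And>x \<eta>. cinner (p x) \<eta> = cinner x (R \<eta>)" and norm_R: "\<And>\<eta>. norm (R \<eta>) \<le> norm \<eta>"
    and unobs: "\<And>\<eta>. b (K (R \<eta>)) = 0"
    and p0: "p 0 = 0"
  shows "((\<lambda>s. p (K (T s (input v s - input v t)))) has_vector_derivative 0) (at t within {0..})"
proof -
  define H where "H s = sqrt ((2 + \<bar>s - t\<bar>) * \<bar>energy v s - energy v t\<bar>)" for s
  let ?q = "\<lambda>s. p (K (T s (input v s - input v t)))"
  have bound: "norm (?q s) \<le> \<bar>s - t\<bar> * H s" if s: "0 \<le> s" for s
  proof -
    have "cmod (cinner (K (T s (input v s - input v t))) (R \<eta>)) \<le> \<bar>s - t\<bar> * H s * norm (R \<eta>)" for \<eta>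
    proof (cases "s \<le> t")
      case True
      have E: "0 \<le> energy v t - energy v s"
        unfolding energy_split[OF v s True, symmetric] by (simp add: set_lebesgue_integral_def)
      have "K (T s (input v s - input v t)) = (-1) *\<^sub>C K (T s (input v t - input v s))"
        unfolding minus_scaleC[symmetric] by (simp add: flow_diff K.diff)
      then have "cinner (K (T s (input v s - input v t))) (R \<eta>) = - cinner (K (T s (input v t - input v s))) (R \<eta>)"
        by (simp only: cinner_scaleC_left) simp
      then show ?thesis
        using cinner_K_input_increment[OF v s True order_refl True unobs, of \<eta>] True E by (simp add: H_def)
    next
      case False
      then have ts: "t \<le> s" by simp
      have E: "0 \<le> energy v s - energy v t"
        unfolding energy_split[OF v t ts, symmetric] by (simp add: set_lebesgue_integral_def)
      show ?thesis
        using cinner_K_input_increment[OF v t ts ts order_refl unobs, of \<eta>] ts E by (simp add: H_def)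
    qed
    from this[of "?q s"] have "cmod (cinner (?q s) (?q s)) \<le> \<bar>s - t\<bar> * H s * norm (R (?q s))"
      by (simp add: adj)
    also have "\<dots> \<le> \<bar>s - t\<bar> * H s * norm (?q s)"
      using norm_R by (intro mult_left_mono) (auto simp: H_def)
    finally have "cmod (cinner (?q s) (?q s)) \<le> \<bar>s - t\<bar> * H s * norm (?q s)" .
    moreover have "norm (?q s) * norm (?q s) \<le> cmod (cinner (?q s) (?q s))"
      using complex_Re_le_cmod[of "cinner (?q s) (?q s)"]
      by (simp add: power2_norm_eq_inner inner_Re_cinner flip: power2_eq_square)
    ultimately have "norm (?q s) * norm (?q s) \<le> \<bar>s - t\<bar> * H s * norm (?q s)" by linarith
    then show ?thesis by (cases "?q s = 0") (auto simp: H_def)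
  qed
  have "((\<lambda>s. sqrt ((2 + \<bar>s - t\<bar>) * \<bar>energy v s - energy v t\<bar>)) \<longlongrightarrow> sqrt ((2 + \<bar>t - t\<bar>) * \<bar>energy v t - energy v t\<bar>)) (at t within {0..})"
    using continuous_energy[OF v] t by (intro tendsto_intros) (simp add: continuous_on_def)
  then have lim: "(H \<longlongrightarrow> 0) (at t within {0..})" by (simp add: H_def[abs_def])
  have "(?q has_derivative (\<lambda>h. h *\<^sub>R 0)) (at t within {0..})"
  proof (rule has_derivativeI_sandwich[OF zero_less_one _ _ lim])
    fix s assume "s \<in> {0..}" "s \<noteq> t"
    then show "norm (?q s - ?q t - (s - t) *\<^sub>R 0) / norm (s - t) \<le> H s"
      using bound[of s] linear_0[OF bounded_linear.linear[OF bounded_linear_flow]]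
      by (simp add: K.zero p0 field_simps)
  qed simp
  then show ?thesis by (simp add: has_vector_derivative_def)
qed

end

section \<open>The closed loop\<close>

locale closed_loop = o1: observed_flow K T b1 + o2: observed_flow K T b2
  for K :: "'a::{complex_inner,banach} \<Rightarrow> 'a" and T and b1 b2 :: "'a \<Rightarrow> complex" +
  fixes F1 F2 :: "'a \<Rightarrow> complex" and L :: real and g1 g2 :: "real \<Rightarrow> complex" and X0 :: 'a
  assumes F1: "cmod (F1 x - F1 y) \<le> L * norm (x - y)" and F2: "cmod (F2 x - F2 y) \<le> L * norm (x - y)"
    and g1: "L2_loc g1" and g2: "L2_loc g2"
begin

definition in1 :: "(real \<Rightarrow> 'a) \<Rightarrow> real \<Rightarrow> complex" where "in1 X s = F1 (X s) + g1 s"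
definition in2 :: "(real \<Rightarrow> 'a) \<Rightarrow> real \<Rightarrow> complex" where "in2 X s = F2 (X s) + g2 s"

definition P :: "(real \<Rightarrow> 'a) \<Rightarrow> real \<Rightarrow> 'a" where
  "P X t = T t (X0 + o1.input (in1 X) t + o2.input (in2 X) t)"

lemma continuous_feedback:
  assumes F: "\<And>x y. cmod (F x - F y) \<le> L * norm (x - y :: 'a)" and X: "continuous_on {0..} X"
  shows "continuous_on {0..} (\<lambda>s. F (X s) :: complex)"
proof -
  have "continuous_on UNIV F"
  proof (rule lipschitz_on_continuous_on)
    show "\<bar>L\<bar>-lipschitz_on UNIV F"
      by (rule lipschitz_onI)
        (auto simp: dist_norm intro: order_trans[OF F mult_right_mono[OF abs_ge_self norm_ge_zero]])
  qed
  then show ?thesis using X by (rule continuous_on_compose2) auto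
qed

lemma L2_loc_in1: "continuous_on {0..} X \<Longrightarrow> L2_loc (in1 X)"
  unfolding in1_def[abs_def] by (intro L2_loc_add L2_loc_continuous continuous_feedback F1 g1)

lemma L2_loc_in2: "continuous_on {0..} X \<Longrightarrow> L2_loc (in2 X)"
  unfolding in2_def[abs_def] by (intro L2_loc_add L2_loc_continuous continuous_feedback F2 g2)

lemma feedback_energy:
  fixes X Y :: "real \<Rightarrow> 'a"
  assumes F: "\<And>x y. cmod (F x - F y) \<le> L * norm (x - y :: 'a)"
    and X: "continuous_on {0..} X" and Y: "continuous_on {0..} Y" 
  shows "(LINT s:{0..t}|lebesgue. (cmod (F (X s) - F (Y s) :: complex))\<^sup>2) \<le> L\<^sup>2 * integral {0..t} (\<lambda>s. (norm (X s - Y s))\<^sup>2)"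
proof -
  have c: "continuous_on {0..t} Z" if "continuous_on {0..} Z" for Z :: "real \<Rightarrow> 'b::topological_space"
    by (rule continuous_on_subset[OF that]) auto
  note c = c[OF X] c[OF Y] c[OF continuous_feedback[OF F X]] c[OF continuous_feedback[OF F Y]]
  have FF: "continuous_on {0..t} (\<lambda>s. F (X s))" "continuous_on {0..t} (\<lambda>s. F (Y s))"
    by (rule c)+
  have "(LINT s:{0..t}|lebesgue. (cmod (F (X s) - F (Y s)))\<^sup>2) = integral {0..t} (\<lambda>s. (cmod (F (X s) - F (Y s)))\<^sup>2)"
    by (intro set_lebesgue_integral_eq_integral absolutely_integrable_continuous_real continuous_intros FF)
  also have "\<dots> \<le> integral {0..t} (\<lambda>s. L\<^sup>2 * (norm (X s - Y s))\<^sup>2)"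
  proof (intro integral_le integrable_continuous_real continuous_intros c)
    show "(cmod (F (X s) - F (Y s)))\<^sup>2 \<le> L\<^sup>2 * (norm (X s - Y s))\<^sup>2" for s
      using power_mono[OF F[of "X s" "Y s"] norm_ge_zero, of 2] by (simp add: power_mult_distrib)
  qed
  finally show ?thesis by simp
qed

text \<open>Two inputs and \<open>(x + y)\<^sup>2 \<le> 2 x\<^sup>2 + 2 y\<^sup>2\<close> together give the factor \<open>4\<close>.\<close>

sublocale volterra P "\<lambda>t. 4 * (2 + t) * L\<^sup>2"
proof
  show "continuous_on {0..} (P X)" if X: "continuous_on {0..} X" for X
    unfolding P_def
    by (intro o1.continuous_on_flow_apply continuous_intros o1.continuous_input o2.continuous_input
        L2_loc_in1 L2_loc_in2 X)
  show "4 * (2 + s) * L\<^sup>2 \<le> 4 * (2 + t) * L\<^sup>2" if "0 \<le> s" "s \<le> t" for s t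
    using that by (intro mult_right_mono) auto
  fix X Y :: "real \<Rightarrow> 'a" and t assume X: "continuous_on {0..} X" and Y: "continuous_on {0..} Y" and t: "(0::real) \<le> t"
  let ?I = "integral {0..t} (\<lambda>s. (norm (X s - Y s))\<^sup>2)"
  let ?d1 = "o1.input (in1 X) t - o1.input (in1 Y) t" and ?d2 = "o2.input (in2 X) t - o2.input (in2 Y) t"
  have "(norm ?d1)\<^sup>2 \<le> (2 + t) * (L\<^sup>2 * ?I)"
  proof (rule order_trans[OF o1.norm_input_diff[OF L2_loc_in1[OF X] L2_loc_in1[OF Y] t] mult_left_mono])
    show "o1.energy (\<lambda>s. in1 X s - in1 Y s) t \<le> L\<^sup>2 * ?I"
      using feedback_energy[OF F1 X Y, of t] by (simp add: o1.energy_def in1_def)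
  qed (use t in simp)
  moreover have "(norm ?d2)\<^sup>2 \<le> (2 + t) * (L\<^sup>2 * ?I)"
  proof (rule order_trans[OF o2.norm_input_diff[OF L2_loc_in2[OF X] L2_loc_in2[OF Y] t] mult_left_mono])
    show "o2.energy (\<lambda>s. in2 X s - in2 Y s) t \<le> L\<^sup>2 * ?I"
      using feedback_energy[OF F2 X Y, of t] by (simp add: o2.energy_def in2_def)
  qed (use t in simp)
  moreover have "P X t - P Y t = T t (?d1 + ?d2)"
    unfolding P_def o1.flow_diff[symmetric] by (simp add: algebra_simps)
  then have "(norm (P X t - P Y t))\<^sup>2 \<le> (norm ?d1 + norm ?d2)\<^sup>2"
    by (simp only: o1.norm_flow) (intro power_mono norm_triangle_ineq norm_ge_zero)
  moreover have "(norm ?d1 + norm ?d2)\<^sup>2 \<le> 2 * (norm ?d1)\<^sup>2 + 2 * (norm ?d2)\<^sup>2"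
    using zero_le_power2[of "norm ?d1 - norm ?d2"] by (simp add: power2_sum power2_diff)
  ultimately have "(norm (P X t - P Y t))\<^sup>2 \<le> 4 * ((2 + t) * (L\<^sup>2 * ?I))" by linarith
  then show "(norm (P X t - P Y t))\<^sup>2 \<le> 4 * (2 + t) * L\<^sup>2 * ?I"
    by (simp only: mult.assoc)
qed

lemma has_dual_integral_closed_loop:
  assumes D: "D = range K" and A: "\<And>x. A (K x) = x" and X: "continuous_on {0..} X" and t: "0 \<le> t"
  shows "has_dual_integral D A {0..t}
    (\<lambda>s. ext_op (T (t - s)) (\<lambda>z. control_op b1 (in1 X s) z + control_op b2 (in2 X s) z)) (cinner (P X t - T t X0))"
proof -
  have 1: "has_dual_integral D A {0..t} (\<lambda>s. ext_op (T (t - s)) (control_op b1 (in1 X s))) (cinner (T t (o1.input (in1 X) t)))"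
    by (intro o1.has_dual_integral_represents[OF D A] o1.represents_input L2_loc_in1[OF X] L2_loc_sq_integrable order_refl t)
  have 2: "has_dual_integral D A {0..t} (\<lambda>s. ext_op (T (t - s)) (control_op b2 (in2 X s))) (cinner (T t (o2.input (in2 X) t)))"
    by (intro o2.has_dual_integral_represents[OF D A] o2.represents_input L2_loc_in2[OF X] L2_loc_sq_integrable order_refl t)
  have "P X t - T t X0 = T t (o1.input (in1 X) t) + T t (o2.input (in2 X) t)"
    by (simp add: P_def o1.flow_add)
  with 1 2 show ?thesis
    unfolding has_dual_integral_def ext_op_def by (simp add: cinner_add_left)
qed

lemma mild_iff_fixed_point:
  assumes D: "D = range K" and A: "\<And>x. A (K x) = x" and X: "continuous_on {0..} X" and t: "0 \<le> t"
  shows "has_dual_integral D A {0..t}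
    (\<lambda>s. ext_op (T (t - s)) (\<lambda>z. control_op b1 (in1 X s) z + control_op b2 (in2 X s) z)) (cinner (X t - T t X0))
    \<longleftrightarrow> X t = P X t"
proof
  assume mild: "has_dual_integral D A {0..t}
    (\<lambda>s. ext_op (T (t - s)) (\<lambda>z. control_op b1 (in1 X s) z + control_op b2 (in2 X s) z)) (cinner (X t - T t X0))"
  have "cinner (X t - T t X0) z = cinner (P X t - T t X0) z" if "z \<in> range K" for z
  proof -
    have "z \<in> adj_dom D A" using that by (simp only: o1.adj_dom_generator[OF D A]) (simp only: D)
    note 1 = bspec[OF mild[unfolded has_dual_integral_def] this, THEN conjunct2]
      and 2 = bspec[OF has_dual_integral_closed_loop[OF D A X t, unfolded has_dual_integral_def] this, THEN conjunct2]
    show ?thesis by (rule trans[OF 1[symmetric] 2])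
  qed
  from eq_if_cinner_eq_on_dense[OF o1.dense_range this] show "X t = P X t" by simp
next
  assume eq: "X t = P X t"
  show "has_dual_integral D A {0..t}
    (\<lambda>s. ext_op (T (t - s)) (\<lambda>z. control_op b1 (in1 X s) z + control_op b2 (in2 X s) z)) (cinner (X t - T t X0))"
    unfolding eq by (rule has_dual_integral_closed_loop[OF D A X t])
qed

lemma P_0: "continuous_on {0..} X \<Longrightarrow> P X 0 = X0"
  by (simp add: P_def o1.input_0 o2.input_0 L2_loc_in1 L2_loc_in2 o1.flow_0)

text \<open>\<open>X(s) = T s (Z s)\<close> with \<open>Z\<close> the sum of the initial state and the input maps. Freezing \<open>Z\<close> at time \<open>t\<close> leaves a
  differentiable function, and the two correction terms have derivative \<open>0\<close>.\<close>

lemma position_derivative: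
  fixes p :: "'a \<Rightarrow> 'b::complex_inner" and R :: "'b \<Rightarrow> 'a"
  assumes p: "bounded_linear p"
    and adj: "\<And>x \<eta>. cinner (p x) \<eta> = cinner x (R \<eta>)" and norm_R: "\<And>\<eta>. norm (R \<eta>) \<le> norm \<eta>"
    and unobs: "\<And>\<eta>. b1 (K (R \<eta>)) = 0" "\<And>\<eta>. b2 (K (R \<eta>)) = 0"
    and X: "continuous_on {0..} X" and fp: "\<And>s. 0 \<le> s \<Longrightarrow> X s = P X s" and t: "0 \<le> t"
  shows "((\<lambda>s. p (K (X s))) has_vector_derivative p (X t)) (at t within {0..})"
proof -
  interpret p: bounded_linear p by (rule p)
  define Z where "Z s = X0 + o1.input (in1 X) s + o2.input (in2 X) s" for s
  let ?q1 = "\<lambda>s. p (K (T s (o1.input (in1 X) s - o1.input (in1 X) t)))"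
  let ?q2 = "\<lambda>s. p (K (T s (o2.input (in2 X) s - o2.input (in2 X) t)))"
  have "((\<lambda>s. p (T s (K (Z t)))) has_vector_derivative p (T t (Z t))) (at t within {0..})"
    by (rule has_vector_derivative_at_within[OF p.has_vector_derivative[OF o1.flow_derivative]])
  moreover have "(?q1 has_vector_derivative 0) (at t within {0..})"
    by (rule o1.input_part_derivative[OF L2_loc_in1[OF X] t adj norm_R unobs(1) p.zero])
  moreover have "(?q2 has_vector_derivative 0) (at t within {0..})"
    by (rule o2.input_part_derivative[OF L2_loc_in2[OF X] t adj norm_R unobs(2) p.zero])
  ultimately have "((\<lambda>s. p (T s (K (Z t))) + ?q1 s + ?q2 s) has_vector_derivative p (T t (Z t)) + 0 + 0) (at t within {0..})"
    by (intro has_vector_derivative_add)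
  then have deriv: "((\<lambda>s. p (T s (K (Z t))) + ?q1 s + ?q2 s) has_vector_derivative p (X t)) (at t within {0..})"
    using fp[OF t] by (simp add: P_def Z_def)
  have "p (K (X s)) = p (T s (K (Z t))) + ?q1 s + ?q2 s" if "s \<in> {0..}" for s
  proof -
    have "T s (Z t) + T s (o1.input (in1 X) s - o1.input (in1 X) t) + T s (o2.input (in2 X) s - o2.input (in2 X) t) = X s"
      using fp[of s] that by (simp add: P_def Z_def flip: o1.flow_add)
    then have "K (X s) = K (T s (Z t)) + K (T s (o1.input (in1 X) s - o1.input (in1 X) t)) + K (T s (o2.input (in2 X) s - o2.input (in2 X) t))"
      by (simp flip: o1.K.add)
    then show ?thesis by (simp only: p.add o1.flow_K)
  qed
  from has_vector_derivative_transform[OF _ this deriv] show ?thesis using t by simp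
qed

end

section \<open>Completeness of \<open>L\<^sup>2(0,1)\<close>\<close>

lemma leb01_space: "space leb01 = {0<..<1}" by (simp add: space_restrict_space)

lemma AE_leb01_I: "(\<And>x. 0 < x \<Longrightarrow> x < 1 \<Longrightarrow> Q x) \<Longrightarrow> AE x in leb01. Q x"
  by (rule AE_I2) (simp add: leb01_space)

lemma integral_leb01_cong:
  "(\<And>x. 0 < x \<Longrightarrow> x < 1 \<Longrightarrow> f x = g x) \<Longrightarrow> (LINT x|leb01. f x) = (LINT x|leb01. (g x :: 'b::{banach,second_countable_topology}))"
  by (rule Bochner_Integration.integral_cong) (auto simp: leb01_space)

lemma measure_leb01: "measure leb01 {0<..<1} = 1"
  by (simp add: measure_restrict_space)

lemma integral_leb01_const: "(LINT x|leb01. c) = (c :: 'b::{banach,second_countable_topology})"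
  by (simp add: leb01_space measure_leb01)

lemma rep_measurable [measurable]: "rep_l2 f \<in> borel_measurable leb01"
  using sq_rep_l2[of f] by (simp add: sq_integrable01_def)

lemma rep_sq_integrable: "integrable leb01 (\<lambda>x. (cmod (rep_l2 f x))\<^sup>2)"
  using sq_rep_l2[of f] by (simp add: sq_integrable01_def)

lemma norm_l2_sq: "(norm f)\<^sup>2 = (LINT x|leb01. (cmod (rep_l2 f x))\<^sup>2)"
proof -
  have "cinner f f = (LINT x|leb01. complex_of_real ((cmod (rep_l2 f x))\<^sup>2))"
    unfolding cinner_l2.rep_eq by (simp add: complex_norm_square del: of_real_power)
  then show ?thesis by (simp add: power2_norm_eq_inner inner_Re_cinner del: of_real_power)
qed

lemma rep_l2_diff: "AE x in leb01. rep_l2 (f - g) x = rep_l2 f x - rep_l2 g x"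
  using rep_l2_add[of f "(-1) *\<^sub>C g"] rep_l2_scaleC[of "-1" g]
  by eventually_elim (simp flip: minus_scaleC)

lemma norm_l2_diff_sq: "(norm (f - g))\<^sup>2 = (LINT x|leb01. (cmod (rep_l2 f x - rep_l2 g x))\<^sup>2)"
  unfolding norm_l2_sq using rep_l2_diff[of f g] by (intro integral_cong_AE) auto

lemma integrable_diff_sq: "integrable leb01 (\<lambda>x. (cmod (rep_l2 f x - rep_l2 g x))\<^sup>2)"
proof -
  have "sq_integrable01 (\<lambda>x. rep_l2 f x + (-1) * rep_l2 g x)"
    by (intro sq_integrable01_add sq_integrable01_scale sq_rep_l2)
  then show ?thesis by (simp add: sq_integrable01_def)
qed

lemma integral_cmod_le:
  assumes "sq_integrable01 F"
  shows "(LINT x|leb01. cmod (F x))\<^sup>2 \<le> (LINT x|leb01. (cmod (F x))\<^sup>2)"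
  using Cauchy_Schwarz_integral[of leb01 "\<lambda>x. cmod (F x)" "\<lambda>x. 1"] assms sq_integrable01_integrable[OF assms]
  by (simp add: sq_integrable01_def integral_leb01_const finite_measure.integrable_const[OF finite_leb01] del: integral_const lebesgue_integral_const)

lemma Cauchy_fast_subsequence:
  fixes X :: "nat \<Rightarrow> 'a::metric_space"
  assumes "Cauchy X"
  obtains r where "strict_mono r" "\<And>k i j. i \<ge> r k \<Longrightarrow> j \<ge> r k \<Longrightarrow> dist (X i) (X j) < (1/2) ^ k"
proof -
  have ex: "\<exists>N. \<forall>i\<ge>N. \<forall>j\<ge>N. dist (X i) (X j) < (1/2) ^ k" for k :: nat
    by (rule metric_CauchyD[OF assms]) simp
  have "\<exists>r. \<forall>k. (\<forall>i\<ge>r k. \<forall>j\<ge>r k. dist (X i) (X j) < (1/2) ^ k) \<and> r k < r (Suc k)"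
  proof (rule dependent_nat_choice)
    fix m k
    obtain N where N: "\<forall>i\<ge>N. \<forall>j\<ge>N. dist (X i) (X j) < (1/2) ^ Suc k" using ex by blast
    show "\<exists>y. (\<forall>i\<ge>y. \<forall>j\<ge>y. dist (X i) (X j) < (1/2) ^ Suc k) \<and> m < y"
      by (rule exI[of _ "max N (Suc m)"]) (use N in auto)
  qed (use ex in blast)
  then show ?thesis using that by (auto simp: strict_mono_Suc_iff)
qed

text \<open>The Riesz-Fischer argument: along a fast subsequence the increments are summable in \<open>L\<^sup>1\<close>, hence the
  representatives converge almost everywhere, and Fatou's lemma bounds the distance to the limit.\<close>

lemma l2_complete:
  fixes X :: "nat \<Rightarrow> l2"
  assumes X: "Cauchy X" shows "convergent X"
proof -
  obtain r where r: "strict_mono r" "\<And>k i j. i \<ge> r k \<Longrightarrow> j \<ge> r k \<Longrightarrow> dist (X i) (X j) < (1/2) ^ k"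
    using Cauchy_fast_subsequence[OF X] by blast
  define F where "F k = rep_l2 (X (r k))" for k
  have F[measurable]: "F k \<in> borel_measurable leb01" for k by (simp add: F_def)
  have FF: "(LINT x|leb01. (cmod (F j x - F k x))\<^sup>2) \<le> ((1/2) ^ k)\<^sup>2" if "k \<le> j" for j k
  proof -
    have "r k \<le> r j" using r(1) that by (simp add: strict_mono_less_eq)
    then have "norm (X (r j) - X (r k)) \<le> (1/2) ^ k" using r(2)[of k "r j" "r k"] by (simp add: dist_norm)
    then show ?thesis unfolding F_def norm_l2_diff_sq[symmetric] by (rule power_mono) simp
  qed
  have intF: "integrable leb01 (\<lambda>x. (cmod (F j x - F k x))\<^sup>2)" for j k
    unfolding F_def by (rule integrable_diff_sq)
  have sqF: "sq_integrable01 (\<lambda>x. F j x - F k x)" for j k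
    using intF by (simp add: sq_integrable01_def)
  have L1: "(LINT x|leb01. cmod (F (Suc k) x - F k x)) \<le> (1/2) ^ k" for k
  proof (rule power2_le_imp_le)
    show "(LINT x|leb01. cmod (F (Suc k) x - F k x))\<^sup>2 \<le> ((1/2) ^ k)\<^sup>2"
      using integral_cmod_le[OF sqF] FF[of k "Suc k"] by (rule order_trans) simp
  qed simp
  have ae: "AE x in leb01. summable (\<lambda>k. cmod (F (Suc k) x - F k x))"
  proof -
    have "(\<integral>\<^sup>+ x. (\<Sum>k. ennreal (cmod (F (Suc k) x - F k x))) \<partial>leb01)
        = (\<Sum>k. \<integral>\<^sup>+ x. ennreal (cmod (F (Suc k) x - F k x)) \<partial>leb01)"
      by (rule nn_integral_suminf) measurable
    also have "\<dots> = (\<Sum>k. ennreal (LINT x|leb01. cmod (F (Suc k) x - F k x)))"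
      using sq_integrable01_integrable[OF sqF]
      by (intro suminf_cong nn_integral_eq_integral) auto
    also have "\<dots> \<le> (\<Sum>k. ennreal ((1/2) ^ k))"
      using L1 by (intro suminf_le ennreal_leI summableI)
    also have "\<dots> = ennreal (\<Sum>k. (1/2) ^ k)"
      by (rule suminf_ennreal2) (auto intro: summable_geometric)
    also have "\<dots> < \<infinity>" by simp
    finally have "(\<integral>\<^sup>+ x. (\<Sum>k. ennreal (cmod (F (Suc k) x - F k x))) \<partial>leb01) \<noteq> \<infinity>" by simp
    then have "AE x in leb01. (\<Sum>k. ennreal (cmod (F (Suc k) x - F k x))) \<noteq> \<infinity>"
      by (intro nn_integral_PInf_AE) auto
    then show ?thesis
      by eventually_elim (auto intro: summable_suminf_not_top)
  qed
  define G where "G x = lim (\<lambda>k. F k x)" for x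
  have G[measurable]: "G \<in> borel_measurable leb01"
    unfolding G_def by (rule borel_measurable_lim_metric) (rule F)
  have lim: "AE x in leb01. (\<lambda>k. F k x) \<longlonglongrightarrow> G x"
    using ae
  proof eventually_elim
    case (elim x)
    then have "summable (\<lambda>k. F (Suc k) x - F k x)" by (rule summable_norm_cancel)
    then have "convergent (\<lambda>n. (\<Sum>k<n. F (Suc k) x - F k x) + F 0 x)"
      by (intro convergent_add convergent_const) (simp add: summable_iff_convergent)
    then have "convergent (\<lambda>n. F n x)" by (simp add: sum_lessThan_telescope[of "\<lambda>k. F k x"])
    then show ?case unfolding G_def by (simp add: convergent_LIMSEQ_iff)
  qed
  have fatou: "(\<integral>\<^sup>+ x. ennreal ((cmod (G x - F k x))\<^sup>2) \<partial>leb01) \<le> ennreal (((1/2) ^ k)\<^sup>2)" for k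
  proof -
    have "AE x in leb01. ennreal ((cmod (G x - F k x))\<^sup>2) = liminf (\<lambda>j. ennreal ((cmod (F j x - F k x))\<^sup>2))"
      using lim
    proof eventually_elim
      case (elim x)
      then have "(\<lambda>j. ennreal ((cmod (F j x - F k x))\<^sup>2)) \<longlonglongrightarrow> ennreal ((cmod (G x - F k x))\<^sup>2)"
        by (intro tendsto_intros)
      then show ?case using lim_imp_Liminf[OF sequentially_bot] by metis
    qed
    then have "(\<integral>\<^sup>+ x. ennreal ((cmod (G x - F k x))\<^sup>2) \<partial>leb01)
        = (\<integral>\<^sup>+ x. liminf (\<lambda>j. ennreal ((cmod (F j x - F k x))\<^sup>2)) \<partial>leb01)"
      by (rule nn_integral_cong_AE)
    also have "\<dots> \<le> liminf (\<lambda>j. \<integral>\<^sup>+ x. ennreal ((cmod (F j x - F k x))\<^sup>2) \<partial>leb01)"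
      by (rule nn_integral_liminf) measurable
    also have "\<dots> \<le> limsup (\<lambda>j. \<integral>\<^sup>+ x. ennreal ((cmod (F j x - F k x))\<^sup>2) \<partial>leb01)"
      by (rule Liminf_le_Limsup) simp
    also have "\<dots> \<le> ennreal (((1/2) ^ k)\<^sup>2)"
    proof (rule Limsup_bounded)
      show "\<forall>\<^sub>F j in sequentially. (\<integral>\<^sup>+ x. ennreal ((cmod (F j x - F k x))\<^sup>2) \<partial>leb01) \<le> ennreal (((1/2) ^ k)\<^sup>2)"
        using eventually_ge_at_top[of k]
      proof eventually_elim
        case (elim j)
        have "(\<integral>\<^sup>+ x. ennreal ((cmod (F j x - F k x))\<^sup>2) \<partial>leb01) = ennreal (LINT x|leb01. (cmod (F j x - F k x))\<^sup>2)"
          by (rule nn_integral_eq_integral[OF intF]) simp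
        also have "\<dots> \<le> ennreal (((1/2) ^ k)\<^sup>2)" using FF[OF elim] by (rule ennreal_leI)
        finally show ?case .
      qed
    qed
    finally show ?thesis .
  qed
  have intG: "integrable leb01 (\<lambda>x. (cmod (G x - F k x))\<^sup>2)" for k
  proof (rule integrableI_bounded)
    show "(\<integral>\<^sup>+ x. ennreal (norm ((cmod (G x - F k x))\<^sup>2)) \<partial>leb01) < \<infinity>"
      using le_less_trans[OF fatou[of k]] by simp
  qed measurable
  have "sq_integrable01 (\<lambda>x. (G x - F 0 x) + F 0 x)"
  proof (rule sq_integrable01_add)
    show "sq_integrable01 (\<lambda>x. G x - F 0 x)" using intG[of 0] by (simp add: sq_integrable01_def)
    show "sq_integrable01 (F 0)" by (simp add: F_def sq_rep_l2)
  qed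
  then have sqG: "sq_integrable01 G" by simp
  have bound: "norm (abs_l2 G - X (r k)) \<le> (1/2) ^ k" for k
  proof (rule power2_le_imp_le)
    have "(norm (abs_l2 G - X (r k)))\<^sup>2 = (LINT x|leb01. (cmod (G x - F k x))\<^sup>2)"
      unfolding norm_l2_diff_sq F_def using rep_abs_l2[OF sqG]
      by (intro integral_cong_AE) (auto simp: F_def)
    moreover have "ennreal (LINT x|leb01. (cmod (G x - F k x))\<^sup>2) \<le> ennreal (((1/2) ^ k)\<^sup>2)"
      using fatou[of k] nn_integral_eq_integral[OF intG] by simp
    ultimately show "(norm (abs_l2 G - X (r k)))\<^sup>2 \<le> ((1/2) ^ k)\<^sup>2" by (simp add: ennreal_le_iff)
  qed simp
  have "(X \<circ> r) \<longlonglongrightarrow> abs_l2 G"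
  proof (rule LIM_zero_cancel, rule Lim_null_comparison)
    show "\<forall>\<^sub>F k in sequentially. norm ((X \<circ> r) k - abs_l2 G) \<le> (1/2) ^ k"
      using bound by (simp add: norm_minus_commute)
    show "(\<lambda>k. (1/2::real) ^ k) \<longlonglongrightarrow> 0" by (rule LIMSEQ_power_zero) simp
  qed
  then have "X \<longlonglongrightarrow> abs_l2 G" using Cauchy_converges_subseq[OF X r(1)] by (simp add: o_def)
  then show ?thesis by (auto simp: convergent_def)
qed

instance l2 :: banach
  by standard (rule l2_complete)

section \<open>Calculus in \<open>H\<^sup>1(0,1)\<close>\<close>

definition primitive :: "(real \<Rightarrow> complex) \<Rightarrow> real \<Rightarrow> complex" where
  "primitive G x = (LINT y:{0..x}|leb01. G y)"

lemma continuous_primitive: "integrable leb01 G \<Longrightarrow> continuous_on UNIV (primitive G)"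
  unfolding primitive_def[abs_def] by (rule continuous_on_primitive)

lemma primitive_measurable: "integrable leb01 G \<Longrightarrow> primitive G \<in> borel_measurable leb01"
  by (intro measurable_restrict_space1) (simp add: borel_measurable_continuous_onI continuous_primitive)

lemma integrable_rep: "integrable leb01 (rep_l2 g)"
  by (intro sq_integrable01_integrable sq_rep_l2)

lemma primitive_0: "primitive G 0 = 0"
  unfolding primitive_def set_lebesgue_integral_def
  using integral_leb01_cong[of "\<lambda>y. indicat_real {0..0} y *\<^sub>R G y" "\<lambda>_. 0"] by simp

lemma primitive_1: "primitive G 1 = (LINT y|leb01. G y)"
  unfolding primitive_def set_lebesgue_integral_def by (rule integral_leb01_cong) simp

lemma cmod_primitive_le:
  assumes G: "integrable leb01 G" shows "cmod (primitive G x) \<le> (LINT y|leb01. cmod (G y))"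
proof -
  have "cmod (primitive G x) \<le> (LINT y|leb01. cmod (indicat_real {0..x} y *\<^sub>R G y))"
    unfolding primitive_def set_lebesgue_integral_def by (rule integral_norm_bound)
  also have "\<dots> \<le> (LINT y|leb01. cmod (G y))"
  proof (rule integral_mono[OF integrable_norm integrable_norm[OF G]])
    show "integrable leb01 (\<lambda>y. indicat_real {0..x} y *\<^sub>R G y)"
      using set_integrable_leb01[OF _ G, of "{0..x}"] by (simp add: set_integrable_def)
  qed (simp add: indicator_def)
  finally show ?thesis .
qed

lemma cmod_primitive_rep_le: "cmod (primitive (rep_l2 g) x) \<le> norm g"
proof -
  have "(LINT y|leb01. cmod (rep_l2 g y))\<^sup>2 \<le> (norm g)\<^sup>2"
    unfolding norm_l2_sq by (rule integral_cmod_le[OF sq_rep_l2])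
  then have "(LINT y|leb01. cmod (rep_l2 g y)) \<le> norm g" by (rule power2_le_imp_le) simp
  then show ?thesis using cmod_primitive_le[OF integrable_rep] order_trans by blast
qed

lemma sq_integrable01_bounded:
  assumes "F \<in> borel_measurable leb01" "\<And>x. cmod (F x) \<le> B"
  shows "sq_integrable01 F"
proof -
  have "integrable leb01 (\<lambda>x. (cmod (F x))\<^sup>2)"
  proof (rule finite_measure.integrable_const_bound[OF finite_leb01])
    show "AE x in leb01. norm ((cmod (F x))\<^sup>2) \<le> B\<^sup>2"
      using assms(2) by (simp add: power_mono)
  qed (use assms(1) in measurable)
  then show ?thesis using assms(1) by (simp add: sq_integrable01_def)
qed

definition prim :: "complex \<Rightarrow> l2 \<Rightarrow> l2" where
  "prim c g = abs_l2 (\<lambda>x. c + primitive (rep_l2 g) x)"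

lemma ac_rep_prim: "ac_rep (\<lambda>x. c + primitive (rep_l2 g) x) (prim c g) g"
proof -
  have "sq_integrable01 (\<lambda>x. c + primitive (rep_l2 g) x)"
  proof (rule sq_integrable01_bounded)
    show "(\<lambda>x. c + primitive (rep_l2 g) x) \<in> borel_measurable leb01"
      using primitive_measurable[OF integrable_rep] by measurable
    show "cmod (c + primitive (rep_l2 g) x) \<le> cmod c + norm g" for x
      using norm_triangle_ineq[of c "primitive (rep_l2 g) x"] cmod_primitive_rep_le[of g x] by linarith
  qed
  from rep_abs_l2[OF this] show ?thesis
    unfolding ac_rep_def prim_def by (simp add: primitive_0 flip: primitive_def)
qed

lemma prim: "prim c g \<in> H1" "h1_deriv (prim c g) = g" "h1_value (prim c g) 0 = c"
  using ac_rep_H1[OF ac_rep_prim] ac_rep_deriv[OF ac_rep_prim] ac_rep_value[OF ac_rep_prim, of 0 c g]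
  by (simp_all add: primitive_0)

lemma H1_diff:
  assumes "\<phi> \<in> H1" "\<eta> \<in> H1"
  shows "\<phi> - \<eta> \<in> H1" "h1_deriv (\<phi> - \<eta>) = h1_deriv \<phi> - h1_deriv \<eta>"
    "x \<in> {0..1} \<Longrightarrow> h1_value (\<phi> - \<eta>) x = h1_value \<phi> x - h1_value \<eta> x"
  using H1_add(1,2)[OF assms(1) H1_scaleC(1)[OF assms(2), of "-1"]] H1_add(3)[OF assms(1) H1_scaleC(1)[OF assms(2), of "-1"], of x]
    H1_scaleC(2)[OF assms(2), of "-1"] H1_scaleC(3)[OF assms(2), of x "-1"]
  by (simp_all flip: minus_scaleC)

lemma H1_eqI:
  assumes "\<phi> \<in> H1" "\<eta> \<in> H1" "h1_deriv \<phi> = h1_deriv \<eta>" "h1_value \<phi> 0 = h1_value \<eta> 0"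
  shows "\<phi> = \<eta>"
  using H1_eq_0[OF H1_diff(1)[OF assms(1,2)]] H1_diff[OF assms(1,2)] assms(3,4) by simp

lemma prim_H1_eq: "\<phi> \<in> H1 \<Longrightarrow> prim (h1_value \<phi> 0) (h1_deriv \<phi>) = \<phi>"
  by (rule H1_eqI) (simp_all add: prim)

text \<open>A total function that agrees with the continuous representative on \<open>[0,1]\<close>.\<close>

definition h1_rep :: "l2 \<Rightarrow> real \<Rightarrow> complex" where
  "h1_rep \<phi> x = h1_value \<phi> 0 + primitive (rep_l2 (h1_deriv \<phi>)) x"

lemma ac_rep_h1_rep: "\<phi> \<in> H1 \<Longrightarrow> ac_rep (h1_rep \<phi>) \<phi> (h1_deriv \<phi>)"
  using ac_rep_prim[of "h1_value \<phi> 0" "h1_deriv \<phi>"]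
  by (simp only: prim_H1_eq h1_rep_def[abs_def])

lemma AE_h1_rep: "\<phi> \<in> H1 \<Longrightarrow> AE x in leb01. rep_l2 \<phi> x = h1_rep \<phi> x"
  using ac_rep_h1_rep unfolding ac_rep_def by blast

lemma h1_value_eq_rep: "\<phi> \<in> H1 \<Longrightarrow> x \<in> {0..1} \<Longrightarrow> h1_value \<phi> x = h1_rep \<phi> x"
  by (rule ac_rep_value[OF ac_rep_h1_rep])

lemma cmod_h1_rep_le: "cmod (h1_rep \<phi> x) \<le> cmod (h1_value \<phi> 0) + norm (h1_deriv \<phi>)"
  unfolding h1_rep_def
  using norm_triangle_ineq[of "h1_value \<phi> 0" "primitive (rep_l2 (h1_deriv \<phi>)) x"]
    cmod_primitive_rep_le[of "h1_deriv \<phi>" x]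
  by linarith

lemma cmod_h1_value_le:
  "\<phi> \<in> H1 \<Longrightarrow> x \<in> {0..1} \<Longrightarrow> cmod (h1_value \<phi> x) \<le> cmod (h1_value \<phi> 0) + norm (h1_deriv \<phi>)"
  unfolding h1_value_eq_rep[of \<phi> x] by (rule cmod_h1_rep_le)

lemma norm_l2_le_if_bounded:
  assumes "AE x in leb01. cmod (rep_l2 f x) \<le> B" "0 \<le> B"
  shows "norm f \<le> B"
proof (rule power2_le_imp_le[OF _ assms(2)])
  have "(norm f)\<^sup>2 \<le> (LINT x|leb01. B\<^sup>2)"
    unfolding norm_l2_sq
  proof (rule integral_mono_AE[OF rep_sq_integrable finite_measure.integrable_const[OF finite_leb01]])
    show "AE x in leb01. (cmod (rep_l2 f x))\<^sup>2 \<le> B\<^sup>2"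
      using assms(1) by eventually_elim (simp add: power_mono)
  qed
  then show "(norm f)\<^sup>2 \<le> B\<^sup>2" unfolding integral_leb01_const .
qed

text \<open>The norm on the left is that of \<open>L\<^sup>2(0,1)\<close>; it is dominated by quantities that the energy norm contains.\<close>

lemma norm_H1_le:
  assumes "\<phi> \<in> H1"
  shows "norm \<phi> \<le> cmod (h1_value \<phi> 0) + norm (h1_deriv \<phi>)"
proof (rule norm_l2_le_if_bounded)
  show "AE x in leb01. cmod (rep_l2 \<phi> x) \<le> cmod (h1_value \<phi> 0) + norm (h1_deriv \<phi>)"
    using AE_h1_rep[OF assms] by eventually_elim (simp add: cmod_h1_rep_le)
qed simp

section \<open>The product rule for indefinite integrals\<close>

lemma integrable_mult_bounded:
  fixes G F :: "real \<Rightarrow> complex"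
  assumes G: "integrable leb01 G" and F: "F \<in> borel_measurable leb01" "\<And>x. cmod (F x) \<le> B"
  shows "integrable leb01 (\<lambda>x. G x * F x)"
proof (rule Bochner_Integration.integrable_bound)
  show "integrable leb01 (\<lambda>x. B * norm (G x))" using G by (intro integrable_mult_right integrable_norm)
  show "(\<lambda>x. G x * F x) \<in> borel_measurable leb01" using G F by measurable
  have "0 \<le> B" using F(2)[of 0] norm_ge_zero order_trans by blast
  then show "AE x in leb01. norm (G x * F x) \<le> norm (B * norm (G x))"
    using F(2) by (auto simp: norm_mult mult.commute intro!: mult_right_mono)
qed

lemma integrable_mult_primitive:
  assumes G: "integrable leb01 G" and E: "integrable leb01 E"
  shows "integrable leb01 (\<lambda>x. G x * (q + primitive E x))"
proof (rule integrable_mult_bounded[OF G])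
  show "(\<lambda>x. q + primitive E x) \<in> borel_measurable leb01" using primitive_measurable[OF E] by measurable
  show "cmod (q + primitive E x) \<le> cmod q + (LINT y|leb01. cmod (E y))" for x
    using norm_triangle_ineq[of q "primitive E x"] cmod_primitive_le[OF E, of x] by linarith
qed

lemma primitive_eq_strict:
  assumes [measurable]: "G \<in> borel_measurable leb01"
  shows "primitive G x = (LINT y|leb01. (if y < x then G y else 0))"
  unfolding primitive_def set_lebesgue_integral_def
proof (rule integral_cong_AE)
  have [measurable]: "(\<lambda>y. y) \<in> borel_measurable leb01" by (rule measurable_restrict_space1) simp
  have [measurable]: "(\<lambda>y. indicator {0..x} y :: real) \<in> borel_measurable leb01"
    by (rule measurable_restrict_space1) simp
  have "AE y in lborel. y \<noteq> x" by (rule AE_lborel_singleton)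
  then have "AE y in leb01. y \<noteq> x" by (subst AE_restrict_space_iff) auto
  moreover have "AE y in leb01. 0 < y" by (rule AE_leb01_I)
  ultimately show "AE y in leb01. indicat_real {0..x} y *\<^sub>R G y = (if y < x then G y else 0)"
    by eventually_elim auto
  show "(\<lambda>y. indicat_real {0..x} y *\<^sub>R G y) \<in> borel_measurable leb01"
    "(\<lambda>y. if y < x then G y else 0) \<in> borel_measurable leb01" by measurable
qed

text \<open>Fubini's theorem on the triangles below and above the diagonal of the unit square. It replaces
  differentiation, which is available almost everywhere only.\<close>

lemma integral_product_primitives:
  assumes G: "integrable leb01 G" and E: "integrable leb01 E"
  shows "(LINT y|leb01. G y) * (LINT y|leb01. E y)
    = (LINT y|leb01. G y * primitive E y + primitive G y * E y)"
proof -
  interpret finite_measure leb01 by (rule finite_leb01)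
  interpret pair_sigma_finite leb01 leb01 by unfold_locales
  have [measurable]: "G \<in> borel_measurable leb01" "E \<in> borel_measurable leb01" using G E by auto
  have id[measurable]: "(\<lambda>y. y) \<in> borel_measurable leb01" by (rule measurable_restrict_space1) simp
  define f where "f y z = (if y < z then G y * E z else 0)" for y z :: real
  have prod: "integrable (leb01 \<Otimes>\<^sub>M leb01) (\<lambda>p. G (fst p) * E (snd p))"
  proof (rule Fubini_integrable)
    show "integrable leb01 (\<lambda>x. LINT y|leb01. norm (G (fst (x, y)) * E (snd (x, y))))"
      using G by (simp add: norm_mult)
    show "AE x in leb01. integrable leb01 (\<lambda>y. G (fst (x, y)) * E (snd (x, y)))"
      using E by simp
  qed measurable
  have f: "integrable (leb01 \<Otimes>\<^sub>M leb01) (case_prod f)"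
  proof (rule Bochner_Integration.integrable_bound[OF prod])
    have [measurable]: "(\<lambda>p. fst p) \<in> borel_measurable (leb01 \<Otimes>\<^sub>M leb01)" "(\<lambda>p. snd p) \<in> borel_measurable (leb01 \<Otimes>\<^sub>M leb01)"
      using measurable_compose[OF measurable_fst id] measurable_compose[OF measurable_snd id] by auto
    show "case_prod f \<in> borel_measurable (leb01 \<Otimes>\<^sub>M leb01)"
      unfolding f_def case_prod_beta by measurable
  qed (auto simp: f_def)
  have inner: "(LINT y|leb01. f y z) = primitive G z * E z" for z
  proof -
    have "(LINT y|leb01. f y z) = (LINT y|leb01. (if y < z then G y else 0) * E z)"
      by (intro Bochner_Integration.integral_cong) (auto simp: f_def)
    then show ?thesis by (simp add: primitive_eq_strict)
  qed
  have outer: "(LINT z|leb01. f y z) = G y * ((LINT z|leb01. E z) - primitive E y)" if "0 < y" "y < 1" for y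
  proof -
    have "(LINT z|leb01. f y z) = (LINT z|leb01. G y * (E z - indicat_real {0..y} z *\<^sub>R E z))"
      using that by (intro integral_leb01_cong) (auto simp: f_def indicator_def)
    also have "\<dots> = G y * (LINT z|leb01. E z - indicat_real {0..y} z *\<^sub>R E z)" by simp
    also have "(LINT z|leb01. E z - indicat_real {0..y} z *\<^sub>R E z) = (LINT z|leb01. E z) - primitive E y"
      unfolding primitive_def set_lebesgue_integral_def
      using set_integrable_leb01[OF _ E, of "{0..y}"]
      by (intro Bochner_Integration.integral_diff E) (simp add: set_integrable_def)
    finally show ?thesis .
  qed
  have 1: "integrable leb01 (\<lambda>y. G y * primitive E y)" "integrable leb01 (\<lambda>y. primitive G y * E y)"
    using integrable_mult_primitive[OF G E, of 0] integrable_mult_primitive[OF E G, of 0] by (simp_all add: mult.commute)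
  have "(LINT z|leb01. primitive G z * E z) = (LINT z|leb01. LINT y|leb01. f y z)" by (simp add: inner)
  also have "\<dots> = (LINT y|leb01. LINT z|leb01. f y z)" by (rule Fubini_integral[OF f])
  also have "\<dots> = (LINT y|leb01. G y * (LINT z|leb01. E z) - G y * primitive E y)"
    by (rule integral_leb01_cong) (simp add: outer algebra_simps)
  also have "\<dots> = (LINT y|leb01. G y) * (LINT z|leb01. E z) - (LINT y|leb01. G y * primitive E y)"
    using G 1 by simp
  finally show ?thesis using 1 by simp
qed

lemma primitive_add:
  assumes "integrable leb01 F" "integrable leb01 H"
  shows "primitive (\<lambda>y. F y + H y) x = primitive F x + primitive H x"
  unfolding primitive_def
  by (rule set_integral_add(2)[OF set_integrable_leb01[OF _ assms(1)] set_integrable_leb01[OF _ assms(2)]]) auto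

lemma primitive_mult: "primitive (\<lambda>y. c * F y) x = c * primitive F x"
  unfolding primitive_def by simp

text \<open>Both functions are cut off at \<open>x\<close>, which keeps their primitives on \<open>[0,x]\<close> and turns an integral
  over \<open>[0,x]\<close> into one over the whole interval.\<close>

lemma primitive_product:
  assumes G: "integrable leb01 G" and E: "integrable leb01 E"
  shows "(p + primitive G x) * (q + primitive E x)
    = p * q + primitive (\<lambda>y. G y * (q + primitive E y) + (p + primitive G y) * E y) x"
proof -
  define cut where "cut H y = indicat_real {0..x} y *\<^sub>R H y" for H :: "real \<Rightarrow> complex" and y
  have cut_int: "integrable leb01 (cut H)" if "integrable leb01 H" for H
    using set_integrable_leb01[OF _ that, of "{0..x}"] by (simp add: cut_def[abs_def] set_integrable_def)
  have prim_cut: "primitive H x = (LINT y|leb01. cut H y)" for H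
    by (simp add: primitive_def set_lebesgue_integral_def cut_def)
  have cut_prim: "primitive (cut H) y = primitive H y" if "y \<le> x" for H y
    unfolding primitive_def set_lebesgue_integral_def cut_def
    using that by (intro Bochner_Integration.integral_cong) (auto simp: indicator_def)
  have "primitive G x * primitive E x = (LINT y|leb01. cut G y * primitive (cut E) y + primitive (cut G) y * cut E y)"
    unfolding prim_cut by (rule integral_product_primitives[OF cut_int[OF G] cut_int[OF E]])
  also have "\<dots> = (LINT y|leb01. cut (\<lambda>y. G y * primitive E y + primitive G y * E y) y)"
  proof (intro Bochner_Integration.integral_cong refl)
    fix y
    show "cut G y * primitive (cut E) y + primitive (cut G) y * cut E y = cut (\<lambda>y. G y * primitive E y + primitive G y * E y) y"
    proof (cases "y \<le> x")
      case True
      show ?thesis unfolding cut_prim[OF True] by (simp add: cut_def scaleR_add_right)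
    qed (simp add: cut_def)
  qed
  also have "\<dots> = primitive (\<lambda>y. G y * primitive E y + primitive G y * E y) x" by (simp add: prim_cut)
  finally have base: "primitive G x * primitive E x = primitive (\<lambda>y. G y * primitive E y + primitive G y * E y) x" .
  have int: "integrable leb01 (\<lambda>y. G y * primitive E y)" "integrable leb01 (\<lambda>y. primitive G y * E y)"
    using integrable_mult_primitive[OF G E, of 0] integrable_mult_primitive[OF E G, of 0] by (simp_all add: mult.commute)
  have "primitive (\<lambda>y. G y * (q + primitive E y) + (p + primitive G y) * E y) x
      = primitive (\<lambda>y. (G y * primitive E y + primitive G y * E y) + (q * G y + p * E y)) x"
    by (simp add: algebra_simps)
  also have "\<dots> = primitive (\<lambda>y. G y * primitive E y + primitive G y * E y) x + (q * primitive G x + p * primitive E x)"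
    using G E int by (simp add: primitive_add primitive_mult)
  finally show ?thesis using base by (simp add: algebra_simps)
qed

lemma primitive_cnj: "primitive (\<lambda>y. cnj (G y)) x = cnj (primitive G x)"
proof -
  have "primitive (\<lambda>y. cnj (G y)) x = (LINT y|leb01. cnj (indicat_real {0..x} y *\<^sub>R G y))"
    by (simp add: primitive_def set_lebesgue_integral_def)
  also have "\<dots> = cnj (primitive G x)"
    unfolding primitive_def set_lebesgue_integral_def by (rule Bochner_Integration.integral_cnj)
  finally show ?thesis .
qed

lemma primitive_const:
  assumes x: "0 \<le> x" "x \<le> 1" shows "primitive (\<lambda>_. c) x = of_real x * c"
proof -
  have m: "measure leb01 ({0..x} \<inter> {0<..<1}) = x"
  proof (cases "x = 1")
    case True
    have "{0..1} \<inter> {0<..<1} = {0<..<1::real}" by auto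
    then show ?thesis using True by (simp add: measure_leb01)
  next
    case False
    then have "{0..x} \<inter> {0<..<1} = {0<..x}" using x by auto
    moreover have "{0<..x} \<subseteq> {0<..<1}" using x False by auto
    ultimately show ?thesis using x by (simp add: measure_restrict_space)
  qed
  have "primitive (\<lambda>_. c) x = (LINT y|leb01. indicat_real ({0..x} \<inter> {0<..<1}) y *\<^sub>R c)"
    unfolding primitive_def set_lebesgue_integral_def by (rule integral_leb01_cong) (simp add: indicator_def)
  also have "\<dots> = (LINT y|leb01. indicat_real ({0..x} \<inter> {0<..<1}) y) *\<^sub>R c"
  proof (rule integral_scaleR_left)
    have "indicat_real ({0..x} \<inter> {0<..<1}) \<in> borel_measurable leb01"
      by (rule measurable_restrict_space1) simp
    then show "integrable leb01 (indicat_real ({0..x} \<inter> {0<..<1}))"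
      by (intro finite_measure.integrable_const_bound[OF finite_leb01, of _ 1]) (auto simp: indicator_def)
  qed
  also have "(LINT y|leb01. indicat_real ({0..x} \<inter> {0<..<1}) y) = x"
    using m by (simp add: leb01_space)
  finally show ?thesis by (simp add: scaleR_conv_of_real)
qed

lemma cnj_measurable: "H \<in> borel_measurable M \<Longrightarrow> (\<lambda>x. cnj (H x)) \<in> borel_measurable M"
  by (erule borel_measurable_continuous_on[rotated]) (intro continuous_intros)

lemma cinner_l2_rep:
  assumes f: "AE x in leb01. rep_l2 f x = F x" and g: "AE x in leb01. rep_l2 g x = G x"
    and m: "F \<in> borel_measurable leb01" "G \<in> borel_measurable leb01"
  shows "cinner f g = (LINT x|leb01. F x * cnj (G x))"
  unfolding cinner_l2.rep_eq
proof (rule integral_cong_AE)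
  show "(\<lambda>x. rep_l2 f x * cnj (rep_l2 g x)) \<in> borel_measurable leb01"
    by (intro borel_measurable_times cnj_measurable rep_measurable)
  show "(\<lambda>x. F x * cnj (G x)) \<in> borel_measurable leb01"
    by (intro borel_measurable_times cnj_measurable m)
  show "AE x in leb01. rep_l2 f x * cnj (rep_l2 g x) = F x * cnj (G x)"
    using f g by eventually_elim simp
qed

lemma h1_rep_measurable: "h1_rep \<phi> \<in> borel_measurable leb01"
  unfolding h1_rep_def[abs_def] by (intro borel_measurable_add primitive_measurable integrable_rep) simp

lemma integrable_cnj_rep: "integrable leb01 (\<lambda>x. cnj (rep_l2 g x))"
  using integrable_rep by simp

lemma H1_integration_by_parts:
  assumes \<phi>: "\<phi> \<in> H1" and \<eta>: "\<eta> \<in> H1"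
  shows "cinner (h1_deriv \<phi>) \<eta> + cinner \<phi> (h1_deriv \<eta>)
    = h1_value \<phi> 1 * cnj (h1_value \<eta> 1) - h1_value \<phi> 0 * cnj (h1_value \<eta> 0)"
proof -
  let ?G = "rep_l2 (h1_deriv \<phi>)" and ?E = "\<lambda>y. cnj (rep_l2 (h1_deriv \<eta>) y)"
  have k: "cnj (h1_rep \<eta> x) = cnj (h1_value \<eta> 0) + primitive ?E x" for x
    by (simp add: h1_rep_def primitive_cnj)
  have h: "h1_rep \<phi> x = h1_value \<phi> 0 + primitive ?G x" for x
    by (simp add: h1_rep_def)
  have "h1_rep \<phi> 1 * cnj (h1_rep \<eta> 1) = h1_value \<phi> 0 * cnj (h1_value \<eta> 0)
      + primitive (\<lambda>y. ?G y * cnj (h1_rep \<eta> y) + h1_rep \<phi> y * ?E y) 1"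
    using primitive_product[OF integrable_rep[of "h1_deriv \<phi>"] integrable_cnj_rep[of "h1_deriv \<eta>"], of "h1_value \<phi> 0" 1 "cnj (h1_value \<eta> 0)"]
    unfolding k[symmetric] h[symmetric] .
  also have "primitive (\<lambda>y. ?G y * cnj (h1_rep \<eta> y) + h1_rep \<phi> y * ?E y) 1
      = (LINT y|leb01. ?G y * cnj (h1_rep \<eta> y) + h1_rep \<phi> y * ?E y)" by (rule primitive_1)
  also have "(LINT y|leb01. ?G y * cnj (h1_rep \<eta> y) + h1_rep \<phi> y * ?E y)
      = (LINT y|leb01. ?G y * cnj (h1_rep \<eta> y)) + (LINT y|leb01. h1_rep \<phi> y * ?E y)"
  proof (rule Bochner_Integration.integral_add)
    show "integrable leb01 (\<lambda>y. ?G y * cnj (h1_rep \<eta> y))"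
      unfolding k by (rule integrable_mult_primitive[OF integrable_rep integrable_cnj_rep])
    show "integrable leb01 (\<lambda>y. h1_rep \<phi> y * ?E y)"
      unfolding h using integrable_mult_primitive[OF integrable_cnj_rep integrable_rep] by (simp add: mult.commute)
  qed
  also have "(LINT y|leb01. ?G y * cnj (h1_rep \<eta> y)) = cinner (h1_deriv \<phi>) \<eta>"
    by (rule cinner_l2_rep[symmetric]) (simp_all add: AE_h1_rep \<eta> h1_rep_measurable)
  also have "(LINT y|leb01. h1_rep \<phi> y * ?E y) = cinner \<phi> (h1_deriv \<eta>)"
    by (rule cinner_l2_rep[symmetric]) (simp_all add: AE_h1_rep \<phi> h1_rep_measurable)
  finally show ?thesis by (simp add: h1_value_eq_rep \<phi> \<eta>)
qed

section \<open>Affine weights\<close>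

text \<open>Multiplication by \<open>\<alpha> + \<beta> x\<close>. The multiplier method uses \<open>x\<close> and \<open>x - 1\<close>, each of which isolates one end
  point of the interval.\<close>

definition weight :: "real \<Rightarrow> real \<Rightarrow> l2 \<Rightarrow> l2" where
  "weight \<alpha> \<beta> f = abs_l2 (\<lambda>x. of_real (\<alpha> + \<beta> * x) * rep_l2 f x)"

lemma weight_measurable: "(\<lambda>x. complex_of_real (\<alpha> + \<beta> * x)) \<in> borel_measurable leb01"
  by (intro measurable_restrict_space1 borel_measurable_of_real) simp

lemma weight_le: "0 < (x::real) \<Longrightarrow> x < 1 \<Longrightarrow> \<bar>\<alpha> + \<beta> * x\<bar> \<le> \<bar>\<alpha>\<bar> + \<bar>\<beta>\<bar>"
  using mult_left_le[of x "\<bar>\<beta>\<bar>"] by (auto simp: abs_mult intro!: order_trans[OF abs_triangle_ineq])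

lemma sq_integrable_weight: "sq_integrable01 (\<lambda>x. of_real (\<alpha> + \<beta> * x) * rep_l2 f x)"
proof -
  have m: "(\<lambda>x. complex_of_real (\<alpha> + \<beta> * x) * rep_l2 f x) \<in> borel_measurable leb01"
    by (intro borel_measurable_times weight_measurable rep_measurable)
  have "integrable leb01 (\<lambda>x. (cmod (complex_of_real (\<alpha> + \<beta> * x) * rep_l2 f x))\<^sup>2)"
  proof (rule Bochner_Integration.integrable_bound)
    show "integrable leb01 (\<lambda>x. (\<bar>\<alpha>\<bar> + \<bar>\<beta>\<bar>)\<^sup>2 * (cmod (rep_l2 f x))\<^sup>2)"
      by (intro integrable_mult_right rep_sq_integrable)
    show "(\<lambda>x. (cmod (complex_of_real (\<alpha> + \<beta> * x) * rep_l2 f x))\<^sup>2) \<in> borel_measurable leb01"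
      using m by (rule borel_measurable_continuous_on[rotated]) (intro continuous_intros)
    show "AE x in leb01. norm ((cmod (complex_of_real (\<alpha> + \<beta> * x) * rep_l2 f x))\<^sup>2)
        \<le> norm ((\<bar>\<alpha>\<bar> + \<bar>\<beta>\<bar>)\<^sup>2 * (cmod (rep_l2 f x))\<^sup>2)"
    proof (rule AE_leb01_I)
      fix x :: real assume "0 < x" "x < 1"
      then have "cmod (complex_of_real (\<alpha> + \<beta> * x)) \<le> \<bar>\<alpha>\<bar> + \<bar>\<beta>\<bar>"
        unfolding norm_of_real by (rule weight_le)
      then have "(cmod (complex_of_real (\<alpha> + \<beta> * x)))\<^sup>2 * (cmod (rep_l2 f x))\<^sup>2 \<le> (\<bar>\<alpha>\<bar> + \<bar>\<beta>\<bar>)\<^sup>2 * (cmod (rep_l2 f x))\<^sup>2"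
        by (intro mult_right_mono power_mono) auto
      then show "norm ((cmod (complex_of_real (\<alpha> + \<beta> * x) * rep_l2 f x))\<^sup>2)
          \<le> norm ((\<bar>\<alpha>\<bar> + \<bar>\<beta>\<bar>)\<^sup>2 * (cmod (rep_l2 f x))\<^sup>2)"
        by (simp only: norm_mult power_mult_distrib real_norm_def abs_power2 abs_mult)
    qed
  qed
  then show ?thesis using m by (simp only: sq_integrable01_def simp_thms)
qed

lemma rep_weight: "AE x in leb01. rep_l2 (weight \<alpha> \<beta> f) x = of_real (\<alpha> + \<beta> * x) * rep_l2 f x"
  unfolding weight_def by (rule rep_abs_l2[OF sq_integrable_weight])

lemma norm_weight_le:
  assumes w: "\<And>x. 0 < x \<Longrightarrow> x < 1 \<Longrightarrow> \<bar>\<alpha> + \<beta> * x\<bar> \<le> 1"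
  shows "norm (weight \<alpha> \<beta> f) \<le> norm f"
proof (rule power2_le_imp_le)
  show "(norm (weight \<alpha> \<beta> f))\<^sup>2 \<le> (norm f)\<^sup>2"
    unfolding norm_l2_sq
  proof (rule integral_mono_AE[OF rep_sq_integrable rep_sq_integrable])
    have "AE x in leb01. \<bar>\<alpha> + \<beta> * x\<bar> \<le> 1" by (rule AE_leb01_I[OF w])
    with rep_weight[of \<alpha> \<beta> f]
    show "AE x in leb01. (cmod (rep_l2 (weight \<alpha> \<beta> f) x))\<^sup>2 \<le> (cmod (rep_l2 f x))\<^sup>2"
    proof eventually_elim
      case (elim x)
      have "cmod (rep_l2 (weight \<alpha> \<beta> f) x) = \<bar>\<alpha> + \<beta> * x\<bar> * cmod (rep_l2 f x)"
        unfolding elim(1) norm_mult norm_of_real ..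
      also have "\<dots> \<le> 1 * cmod (rep_l2 f x)" using elim(2) by (intro mult_right_mono) auto
      finally show ?case by (intro power_mono) auto
    qed
  qed
qed simp

lemma bounded_linear_weight:
  assumes w: "\<And>x. 0 < x \<Longrightarrow> x < 1 \<Longrightarrow> \<bar>\<alpha> + \<beta> * x\<bar> \<le> 1"
  shows "bounded_linear (weight \<alpha> \<beta>)"
proof (rule bounded_linear_intro[where K = 1])
  show "weight \<alpha> \<beta> (f + g) = weight \<alpha> \<beta> f + weight \<alpha> \<beta> g" for f g
    by (rule l2_eqI)
       (use rep_weight[of \<alpha> \<beta> "f + g"] rep_weight[of \<alpha> \<beta> f] rep_weight[of \<alpha> \<beta> g] rep_l2_add[of f g]
         rep_l2_add[of "weight \<alpha> \<beta> f" "weight \<alpha> \<beta> g"] in \<open>eventually_elim, simp only: distrib_left\<close>)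
  show "weight \<alpha> \<beta> (c *\<^sub>R f) = c *\<^sub>R weight \<alpha> \<beta> f" for c f
    unfolding scaleR_scaleC
    by (rule l2_eqI)
       (use rep_weight[of \<alpha> \<beta> "complex_of_real c *\<^sub>C f"] rep_weight[of \<alpha> \<beta> f] rep_l2_scaleC[of "of_real c" f]
         rep_l2_scaleC[of "of_real c" "weight \<alpha> \<beta> f"] in \<open>eventually_elim, simp only: mult.left_commute\<close>)
qed (simp add: norm_weight_le[OF w])

lemma cinner_weight: "cinner (weight \<alpha> \<beta> f) g = (LINT x|leb01. of_real (\<alpha> + \<beta> * x) * rep_l2 f x * cnj (rep_l2 g x))"
  by (rule cinner_l2_rep[OF rep_weight])
     (intro AE_I2 refl rep_measurable borel_measurable_times weight_measurable)+

lemma inner_weight_commute: "inner (weight \<alpha> \<beta> f) g = inner (weight \<alpha> \<beta> g) f"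
proof -
  have "cinner (weight \<alpha> \<beta> f) g = (LINT x|leb01. cnj (of_real (\<alpha> + \<beta> * x) * rep_l2 g x * cnj (rep_l2 f x)))"
    unfolding cinner_weight by (rule Bochner_Integration.integral_cong) (simp_all add: mult_ac)
  also have "\<dots> = cnj (cinner (weight \<alpha> \<beta> g) f)"
    unfolding cinner_weight by (rule Bochner_Integration.integral_cnj)
  finally show ?thesis by (simp add: inner_Re_cinner)
qed

text \<open>This is \<open>\<integral> w (|\<phi>|\<^sup>2)' = [w |\<phi>|\<^sup>2] - \<integral> w' |\<phi>|\<^sup>2\<close> with \<open>w = \<alpha> + \<beta> x\<close>: the product rule is applied to
  \<open>\<phi>\<close> and its conjugate, and then to \<open>|\<phi>|\<^sup>2\<close> and \<open>w\<close>.\<close>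

lemma inner_weight_deriv:
  assumes \<phi>: "\<phi> \<in> H1"
  shows "2 * inner (weight \<alpha> \<beta> (h1_deriv \<phi>)) \<phi>
    = (\<alpha> + \<beta>) * (cmod (h1_value \<phi> 1))\<^sup>2 - \<alpha> * (cmod (h1_value \<phi> 0))\<^sup>2 - \<beta> * (norm \<phi>)\<^sup>2"
proof -
  let ?G = "rep_l2 (h1_deriv \<phi>)" and ?h = "h1_rep \<phi>" and ?p = "h1_value \<phi> 0"
  define W where "W y = ?G y * cnj (?h y) + ?h y * cnj (?G y)" for y
  define w where "w x = complex_of_real (\<alpha> + \<beta> * x)" for x
  have h: "?h x = ?p + primitive ?G x" and hc: "cnj (?h x) = cnj ?p + primitive (\<lambda>y. cnj (?G y)) x" for x
    by (simp_all add: h1_rep_def primitive_cnj)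
  have sq: "?h x * cnj (?h x) = ?p * cnj ?p + primitive W x" for x
    using primitive_product[OF integrable_rep[of "h1_deriv \<phi>"] integrable_cnj_rep[of "h1_deriv \<phi>"], of ?p x "cnj ?p"]
    unfolding hc[symmetric] h[symmetric] W_def[symmetric] .
  have i1: "integrable leb01 (\<lambda>y. ?G y * cnj (?h y))"
    unfolding hc by (rule integrable_mult_primitive[OF integrable_rep integrable_cnj_rep])
  have i2: "integrable leb01 (\<lambda>y. ?h y * cnj (?G y))"
    unfolding h using integrable_mult_primitive[OF integrable_cnj_rep integrable_rep] by (simp add: mult.commute)
  have W: "integrable leb01 W" unfolding W_def[abs_def] using i1 i2 by simp
  have const: "integrable leb01 (\<lambda>_. complex_of_real \<beta>)" by (rule finite_measure.integrable_const[OF finite_leb01])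
  have w: "w y = of_real \<alpha> + primitive (\<lambda>_. of_real \<beta>) y" if "0 \<le> y" "y \<le> 1" for y
    using that by (simp add: w_def primitive_const mult.commute)
  have intw: "integrable leb01 (\<lambda>y. w y * F y)" if F: "integrable leb01 F" for F
  proof (rule Bochner_Integration.integrable_bound[of _ "\<lambda>y. (\<bar>\<alpha>\<bar> + \<bar>\<beta>\<bar>) * norm (F y)"])
    show "(\<lambda>y. w y * F y) \<in> borel_measurable leb01"
      unfolding w_def by (intro borel_measurable_times weight_measurable borel_measurable_integrable F)
    show "AE y in leb01. norm (w y * F y) \<le> norm ((\<bar>\<alpha>\<bar> + \<bar>\<beta>\<bar>) * norm (F y))"
    proof (rule AE_leb01_I)
      fix y :: real assume "0 < y" "y < 1"
      then have "norm (w y) \<le> \<bar>\<alpha>\<bar> + \<bar>\<beta>\<bar>" unfolding w_def norm_of_real by (rule weight_le)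
      then have "norm (w y) * norm (F y) \<le> (\<bar>\<alpha>\<bar> + \<bar>\<beta>\<bar>) * norm (F y)" by (rule mult_right_mono) simp
      then show "norm (w y * F y) \<le> norm ((\<bar>\<alpha>\<bar> + \<bar>\<beta>\<bar>) * norm (F y))" by (simp add: norm_mult)
    qed
  qed (use F in simp)
  have i3: "integrable leb01 (\<lambda>y. ?h y * cnj (?h y) * of_real \<beta>)"
    unfolding sq using integrable_mult_primitive[OF const W, of "?p * cnj ?p"] by (simp add: mult.commute)
  have "(?h 1 * cnj (?h 1)) * w 1 = ?p * cnj ?p * of_real \<alpha> +
      primitive (\<lambda>y. W y * (of_real \<alpha> + primitive (\<lambda>_. of_real \<beta>) y) + (?p * cnj ?p + primitive W y) * of_real \<beta>) 1"
    unfolding sq w[OF zero_le_one order_refl] by (rule primitive_product[OF W const])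
  also have "primitive (\<lambda>y. W y * (of_real \<alpha> + primitive (\<lambda>_. of_real \<beta>) y) + (?p * cnj ?p + primitive W y) * of_real \<beta>) 1
      = (LINT y|leb01. W y * (of_real \<alpha> + primitive (\<lambda>_. of_real \<beta>) y) + (?p * cnj ?p + primitive W y) * of_real \<beta>)"
    by (rule primitive_1)
  also have "(LINT y|leb01. W y * (of_real \<alpha> + primitive (\<lambda>_. of_real \<beta>) y) + (?p * cnj ?p + primitive W y) * of_real \<beta>)
      = (LINT y|leb01. (w y * (?G y * cnj (?h y)) + cnj (w y * (?G y * cnj (?h y)))) + ?h y * cnj (?h y) * of_real \<beta>)"
  proof (rule integral_leb01_cong)
    fix y :: real assume y: "0 < y" "y < 1"
    have wr: "cnj (w y) = w y" by (simp add: w_def)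
    have eq: "of_real \<alpha> + primitive (\<lambda>_. of_real \<beta>) y = w y" using w[of y] y by simp
    show "W y * (of_real \<alpha> + primitive (\<lambda>_. of_real \<beta>) y) + (?p * cnj ?p + primitive W y) * of_real \<beta>
      = (w y * (?G y * cnj (?h y)) + cnj (w y * (?G y * cnj (?h y)))) + ?h y * cnj (?h y) * of_real \<beta>"
      unfolding eq sq[symmetric] unfolding W_def complex_cnj_mult complex_cnj_cnj wr by (simp add: algebra_simps)
  qed
  also have "\<dots> = ((LINT y|leb01. w y * (?G y * cnj (?h y))) + cnj (LINT y|leb01. w y * (?G y * cnj (?h y))))
      + (LINT y|leb01. ?h y * cnj (?h y)) * of_real \<beta>"
    using intw[OF i1] i3 unfolding Bochner_Integration.integral_cnj[symmetric]
    by (subst Bochner_Integration.integral_add, simp_all del: complex_cnj_mult)+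
  also have "(LINT y|leb01. w y * (?G y * cnj (?h y))) = cinner (weight \<alpha> \<beta> (h1_deriv \<phi>)) \<phi>"
  proof -
    have "cinner (weight \<alpha> \<beta> (h1_deriv \<phi>)) \<phi> = (LINT y|leb01. of_real (\<alpha> + \<beta> * y) * ?G y * cnj (?h y))"
      by (rule cinner_l2_rep[OF rep_weight AE_h1_rep[OF \<phi>] _ h1_rep_measurable])
         (intro borel_measurable_times weight_measurable rep_measurable)
    then show ?thesis by (simp add: w_def mult.assoc)
  qed
  also have "(LINT y|leb01. ?h y * cnj (?h y)) = cinner \<phi> \<phi>"
    by (rule cinner_l2_rep[symmetric]) (intro AE_h1_rep \<phi> h1_rep_measurable)+
  finally have "Re ((?h 1 * cnj (?h 1)) * w 1) = Re (?p * cnj ?p * of_real \<alpha> +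
      ((cinner (weight \<alpha> \<beta> (h1_deriv \<phi>)) \<phi> + cnj (cinner (weight \<alpha> \<beta> (h1_deriv \<phi>)) \<phi>)) + cinner \<phi> \<phi> * of_real \<beta>))"
    by (rule arg_cong)
  moreover have "Re (z * cnj z * of_real r) = r * (cmod z)\<^sup>2" for z r
    unfolding complex_norm_square[symmetric] by (simp flip: of_real_mult of_real_power)
  moreover have "Re (cinner \<phi> \<phi> * of_real \<beta>) = \<beta> * (norm \<phi>)\<^sup>2"
    by (simp add: power2_norm_eq_inner inner_Re_cinner)
  moreover have "h1_value \<phi> 1 = ?h 1" by (rule h1_value_eq_rep[OF \<phi>]) simp
  ultimately show ?thesis
    by (simp only: w_def plus_complex.sel complex_cnj inner_Re_cinner cnj.sel mult_1_right)
qed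

section \<open>The state space\<close>

lemma wave_pos_vel:
  "pos (0::wave_state) = 0" "vel (0::wave_state) = 0"
  "pos (z + y) = pos z + pos y" "vel (z + y) = vel z + vel y"
  "pos (c *\<^sub>C z) = c *\<^sub>C pos z" "vel (c *\<^sub>C z) = c *\<^sub>C vel z"
  by (simp_all add: zero_wave_state_def plus_wave_state_def scaleC_wave_state_def
      pos_mk_state vel_mk_state H1_zero H1_add H1_scaleC pos_H1)

definition strain :: "wave_state \<Rightarrow> l2" where "strain z = h1_deriv (pos z)"

definition trace_at :: "wave_state \<Rightarrow> real \<Rightarrow> complex" where "trace_at z x = h1_value (pos z) x"

lemma strain_linear: "strain (z + y) = strain z + strain y" "strain (c *\<^sub>C z) = c *\<^sub>C strain z"
  by (simp_all add: strain_def wave_pos_vel H1_add H1_scaleC pos_H1)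

lemma trace_linear:
  "x \<in> {0..1} \<Longrightarrow> trace_at (z + y) x = trace_at z x + trace_at y x"
  "x \<in> {0..1} \<Longrightarrow> trace_at (c *\<^sub>C z) x = c * trace_at z x"
  by (simp_all add: trace_at_def wave_pos_vel H1_add H1_scaleC pos_H1)

lemma cinner_wave: "cinner z y = cinner (strain z) (strain y) + cinner (vel z) (vel y) + trace_at z 0 * cnj (trace_at y 0)"
  by (simp add: cinner_wave_state_def strain_def trace_at_def)

lemma norm_wave_sq: "(norm z)\<^sup>2 = (norm (strain z))\<^sup>2 + (norm (vel z))\<^sup>2 + (cmod (trace_at z 0))\<^sup>2"
proof -
  have "Re (a * cnj a) = (cmod a)\<^sup>2" for a by (simp add: cmod_power2 flip: power2_eq_square)
  then show ?thesis
    by (simp only: power2_norm_eq_inner inner_Re_cinner cinner_wave plus_complex.sel)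
qed

lemma norm_components: "norm (strain z) \<le> norm z" "norm (vel z) \<le> norm z" "cmod (trace_at z 0) \<le> norm z"
  by (rule power2_le_imp_le; simp add: norm_wave_sq)+

lemma cmod_trace_le:
  assumes x: "x \<in> {0..1}" shows "cmod (trace_at z x) \<le> 2 * norm z"
  using cmod_h1_value_le[OF pos_H1 x, of z] norm_components(1,3)[of z] by (simp add: trace_at_def strain_def)

lemma norm_pos_le: "norm (pos z) \<le> 2 * norm z"
  using norm_H1_le[OF pos_H1, of z] norm_components(1,3)[of z] by (simp add: trace_at_def strain_def)

lemma bounded_linear_strain: "bounded_linear strain"
  by (rule bounded_linear_intro[where K = 1]) (simp_all add: strain_linear scaleR_scaleC norm_components)

lemma bounded_linear_vel: "bounded_linear vel"
  by (rule bounded_linear_intro[where K = 1]) (simp_all add: wave_pos_vel scaleR_scaleC norm_components)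

lemma bounded_linear_trace: "x \<in> {0..1} \<Longrightarrow> bounded_linear (\<lambda>z. trace_at z x)"
  using cmod_trace_le[of x]
  by (intro bounded_linear_intro[where K = 2])
     (simp_all add: trace_linear scaleR_scaleC scaleR_conv_of_real mult.commute)

lemma mk_prim:
  "pos (mk_state (prim c g) \<psi>) = prim c g" "vel (mk_state (prim c g) \<psi>) = \<psi>"
  "strain (mk_state (prim c g) \<psi>) = g" "trace_at (mk_state (prim c g) \<psi>) 0 = c"
  by (simp_all add: strain_def trace_at_def pos_mk_state vel_mk_state prim)

lemma wave_state_eqI':
  assumes "strain z = strain y" "vel z = vel y" "trace_at z 0 = trace_at y 0" shows "z = y"
proof (rule wave_state_eqI)
  show "pos z = pos y"
    by (rule H1_eqI[OF pos_H1 pos_H1]) (use assms in \<open>simp_all add: strain_def trace_at_def\<close>)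
qed (rule assms(2))

lemma wave_state_complete:
  fixes X :: "nat \<Rightarrow> wave_state"
  assumes X: "Cauchy X" shows "convergent X"
proof -
  have "0 \<in> {0..1::real}" by simp
  then have "Cauchy (\<lambda>n. strain (X n))" "Cauchy (\<lambda>n. vel (X n))" "Cauchy (\<lambda>n. trace_at (X n) 0)"
    using X bounded_linear.Cauchy bounded_linear_strain bounded_linear_vel bounded_linear_trace by blast+
  then obtain g \<psi> c where lim: "(\<lambda>n. strain (X n)) \<longlonglongrightarrow> g" "(\<lambda>n. vel (X n)) \<longlonglongrightarrow> \<psi>" "(\<lambda>n. trace_at (X n) 0) \<longlonglongrightarrow> c"
    by (meson Cauchy_convergent convergent_def)
  define z where "z = mk_state (prim c g) \<psi>"
  interpret s: bounded_linear strain by (rule bounded_linear_strain)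
  interpret v: bounded_linear vel by (rule bounded_linear_vel)
  interpret t: bounded_linear "\<lambda>z. trace_at z 0" by (rule bounded_linear_trace) simp
  have "(\<lambda>n. sqrt ((norm (strain (X n) - g))\<^sup>2 + (norm (vel (X n) - \<psi>))\<^sup>2 + (cmod (trace_at (X n) 0 - c))\<^sup>2))
      \<longlonglongrightarrow> sqrt ((norm (g - g))\<^sup>2 + (norm (\<psi> - \<psi>))\<^sup>2 + (cmod (c - c))\<^sup>2)"
    by (intro tendsto_intros lim)
  moreover have "sqrt ((norm (strain (X n) - g))\<^sup>2 + (norm (vel (X n) - \<psi>))\<^sup>2 + (cmod (trace_at (X n) 0 - c))\<^sup>2) = norm (X n - z)" for n
  proof -
    have "norm (X n - z) = sqrt ((norm (X n - z))\<^sup>2)" by simp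
    then show ?thesis unfolding norm_wave_sq by (simp add: s.diff v.diff t.diff z_def mk_prim)
  qed
  ultimately have "(\<lambda>n. norm (X n - z)) \<longlonglongrightarrow> 0" by simp
  then have "X \<longlonglongrightarrow> z" by (simp add: tendsto_norm_zero_iff LIM_zero_iff)
  then show ?thesis by (auto simp: convergent_def)
qed

instance wave_state :: banach
  by standard (rule wave_state_complete)

section \<open>The inverse of the wave operator\<close>

lemma h1_value_prim_1: "h1_value (prim c g) 1 = c + primitive (rep_l2 g) 1"
  using ac_rep_value[OF ac_rep_prim, of 1 c g] by simp

lemma prim_linear:
  "prim c g + prim d e = prim (c + d) (g + e)" "a *\<^sub>C prim c g = prim (a * c) (a *\<^sub>C g)"
  by (rule H1_eqI; simp add: prim H1_add H1_scaleC)+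

text \<open>The mean value of \<open>g\<close>, in a form that inherits linearity from that of \<open>prim\<close>.\<close>

definition mean :: "l2 \<Rightarrow> complex" where "mean g = h1_value (prim 0 g) 1"

lemma mean_linear: "mean (g + e) = mean g + mean e" "mean (c *\<^sub>C g) = c * mean g"
  using prim_linear(1)[of 0 g 0 e] prim_linear(2)[of c 0 g] H1_add(3)[of "prim 0 g" "prim 0 e" 1] H1_scaleC(3)[of "prim 0 g" 1 c]
  by (simp_all add: mean_def prim)

lemma h1_value_prim: "h1_value (prim c g) 1 = c + mean g"
  by (simp add: mean_def h1_value_prim_1)

lemma cmod_mean_le: "cmod (mean g) \<le> norm g"
  using cmod_h1_value_le[of "prim 0 g" 1] by (simp add: mean_def prim)

text \<open>Solves \<open>\<psi> = pos z\<close>, \<open>\<phi>'' = vel z\<close>. The condition at \<open>1\<close> fixes the constant of the first integration, and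
  the condition \<open>\<phi>(0) = \<phi>'(0)\<close> makes the second constant equal to the first.\<close>

definition wave_inv :: "wave_state \<Rightarrow> wave_state" where
  "wave_inv z = mk_state (prim (- mean (vel z)) (prim (- mean (vel z)) (vel z))) (pos z)"

lemma wave_inv:
  "vel (wave_inv z) = pos z" "strain (wave_inv z) = prim (- mean (vel z)) (vel z)"
  "trace_at (wave_inv z) 0 = - mean (vel z)"
  by (simp_all add: wave_inv_def mk_prim)

lemma wave_dom_iff: "z \<in> wave_dom \<longleftrightarrow>
  strain z \<in> H1 \<and> vel z \<in> H1 \<and> h1_value (strain z) 0 = trace_at z 0 \<and> h1_value (strain z) 1 = 0"
  by (auto simp: wave_dom_def H2_def pos_H1 strain_def trace_at_def)

lemma wave_inv_dom: "wave_inv z \<in> wave_dom"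
  by (simp add: wave_dom_iff wave_inv prim h1_value_prim pos_H1)

lemma wave_op_inv: "wave_op (wave_inv z) = z"
proof (rule wave_state_eqI)
  have d: "h1_deriv (pos (wave_inv z)) = prim (- mean (vel z)) (vel z)" using wave_inv(2) by (simp add: strain_def)
  show "pos (wave_op (wave_inv z)) = pos z" "vel (wave_op (wave_inv z)) = vel z"
    by (simp_all add: wave_op_def d wave_inv(1) pos_mk_state vel_mk_state pos_H1 prim)
qed

lemma wave_inv_op:
  assumes z: "z \<in> wave_dom" shows "wave_inv (wave_op z) = z"
proof -
  have H1: "strain z \<in> H1" "vel z \<in> H1" and bc: "h1_value (strain z) 0 = trace_at z 0" "h1_value (strain z) 1 = 0"
    using z by (auto simp: wave_dom_iff)
  have op: "pos (wave_op z) = vel z" "vel (wave_op z) = h1_deriv (strain z)"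
    using H1(2) by (simp_all add: wave_op_def pos_mk_state vel_mk_state strain_def)
  have "strain z = prim (trace_at z 0) (h1_deriv (strain z))" using prim_H1_eq[OF H1(1)] bc(1) by simp
  moreover from this have "trace_at z 0 = - mean (h1_deriv (strain z))"
    using bc(2) h1_value_prim[of "trace_at z 0" "h1_deriv (strain z)"] by (simp add: eq_neg_iff_add_eq_0)
  ultimately show ?thesis
    by (intro wave_state_eqI') (simp_all add: wave_inv op)
qed

lemma wave_dom_eq_range: "wave_dom = range wave_inv"
proof
  show "wave_dom \<subseteq> range wave_inv" 
  proof
    fix z assume "z \<in> wave_dom"
    then have "z = wave_inv (wave_op z)" by (rule wave_inv_op[symmetric])
    then show "z \<in> range wave_inv" by (rule range_eqI)
  qed
  show "range wave_inv \<subseteq> wave_dom" using wave_inv_dom by blast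
qed

lemma wave_inv_linear: "wave_inv (x + y) = wave_inv x + wave_inv y" "wave_inv (c *\<^sub>C x) = c *\<^sub>C wave_inv x"
proof -
  have add: "- mean (vel x + vel y) = - mean (vel x) + - mean (vel y)"
    and scale: "- mean (c *\<^sub>C vel x) = c * - mean (vel x)"
    by (simp_all add: mean_linear)
  show "wave_inv (x + y) = wave_inv x + wave_inv y"
    by (rule wave_state_eqI')
       (simp_all only: wave_inv wave_pos_vel strain_linear trace_linear add prim_linear atLeastAtMost_iff order_refl zero_le_one simp_thms)
  show "wave_inv (c *\<^sub>C x) = c *\<^sub>C wave_inv x"
    by (rule wave_state_eqI')
       (simp_all only: wave_inv wave_pos_vel strain_linear trace_linear scale prim_linear atLeastAtMost_iff order_refl zero_le_one simp_thms)
qed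

lemma norm_wave_inv_le: "norm (wave_inv z) \<le> norm z * 3"
proof (rule power2_le_imp_le)
  have m: "cmod (mean (vel z)) \<le> norm z"
    using cmod_mean_le[of "vel z"] norm_components(2)[of z] by (rule order_trans)
  have p: "norm (prim (- mean (vel z)) (vel z)) \<le> 2 * norm z"
    using norm_H1_le[OF prim(1), of "- mean (vel z)" "vel z"] m norm_components(2)[of z]
    unfolding prim norm_minus_cancel by linarith
  have "(norm (wave_inv z))\<^sup>2 = (norm (prim (- mean (vel z)) (vel z)))\<^sup>2 + (norm (pos z))\<^sup>2 + (cmod (mean (vel z)))\<^sup>2"
    unfolding norm_wave_sq[of "wave_inv z"] wave_inv norm_minus_cancel ..
  also have "\<dots> \<le> (2 * norm z)\<^sup>2 + (2 * norm z)\<^sup>2 + (norm z)\<^sup>2"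
    using power_mono[OF p norm_ge_zero, of 2] power_mono[OF norm_pos_le norm_ge_zero, of z 2] power_mono[OF m norm_ge_zero, of 2]
    by (intro add_mono)
  also have "\<dots> = (norm z * 3)\<^sup>2" by (simp add: power_mult_distrib)
  finally show "(norm (wave_inv z))\<^sup>2 \<le> (norm z * 3)\<^sup>2" .
qed simp

lemma bounded_linear_wave_inv: "bounded_linear wave_inv"
proof (rule bounded_linear_intro[where K = 3])
  show "wave_inv (r *\<^sub>R z) = r *\<^sub>R wave_inv z" for r z
    unfolding scaleR_scaleC by (rule wave_inv_linear)
qed (rule wave_inv_linear norm_wave_inv_le)+

text \<open>For \<open>y = wave_inv x\<close>, integration by parts of the strain of \<open>y\<close> against \<open>pos x\<close> produces the boundary term
  at \<open>0\<close> that the third summand of the inner product cancels. What is left is a number minus its conjugate.\<close>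

lemma skew_op_wave_inv: "skew_op wave_inv"
proof -
  have "inner (wave_inv x) x = 0" for x
  proof -
    define \<phi> where "\<phi> = strain (wave_inv x)"
    have \<phi>: "\<phi> \<in> H1" "h1_deriv \<phi> = vel x" "h1_value \<phi> 0 = trace_at (wave_inv x) 0" "h1_value \<phi> 1 = 0"
      by (simp_all add: \<phi>_def wave_inv prim h1_value_prim)
    have "cinner (vel x) (pos x) + cinner \<phi> (strain x) = - (trace_at (wave_inv x) 0 * cnj (trace_at x 0))"
      using H1_integration_by_parts[OF \<phi>(1) pos_H1, of x] by (simp add: \<phi> strain_def trace_at_def)
    then have "cinner \<phi> (strain x) = - (trace_at (wave_inv x) 0 * cnj (trace_at x 0)) - cinner (vel x) (pos x)"
      by (metis add_diff_cancel_left')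
    moreover have "cinner (vel x) (pos x) = cnj (cinner (pos x) (vel x))" by (rule cinner_commute)
    ultimately have "cinner (wave_inv x) x = cinner (pos x) (vel x) - cnj (cinner (pos x) (vel x))"
      unfolding cinner_wave[of "wave_inv x"] \<phi>_def[symmetric] wave_inv(1) by simp
    then show ?thesis by (simp add: inner_Re_cinner)
  qed
  then show ?thesis by (simp add: skew_op_def bounded_linear_wave_inv)
qed

lemma injective_skew_wave_inv: "injective_skew wave_inv"
proof
  show "skew_op wave_inv" by (rule skew_op_wave_inv)
  show "x = 0" if "wave_inv x = 0" for x
  proof -
    have "wave_inv x = wave_inv 0" using that linear_0[OF bounded_linear.linear[OF bounded_linear_wave_inv]] by simp
    then have "wave_op (wave_inv x) = wave_op (wave_inv 0)" by (rule arg_cong)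
    then show ?thesis unfolding wave_op_inv .
  qed
qed

definition wave_flow :: "real \<Rightarrow> wave_state \<Rightarrow> wave_state" where
  "wave_flow = injective_skew.flow wave_inv"

lemma skew_flow_wave: "skew_flow wave_inv wave_flow"
  unfolding wave_flow_def by (rule injective_skew.skew_flow_exists[OF injective_skew_wave_inv])

lemma complex_skew_flow_wave: "complex_skew_flow wave_inv wave_flow"
  by (intro complex_skew_flow.intro complex_skew_flow_axioms.intro skew_flow_wave wave_inv_linear)

lemmas wave_flow_K = skew_flow.flow_K[OF skew_flow_wave]
  and wave_flow_derivative = skew_flow.flow_derivative[OF skew_flow_wave]
  and wave_flow_continuous = skew_flow.flow_continuous[OF skew_flow_wave]
  and norm_wave_flow = skew_flow.norm_flow[OF skew_flow_wave]

section \<open>Boundary observations\<close>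

text \<open>The multiplier identity. With \<open>w = wave_flow t (wave_inv x)\<close>, the velocity of \<open>w\<close> is \<open>pos (wave_flow t x)\<close>, so
  \<open>trace_at (wave_flow t x)\<close> is the boundary velocity of \<open>w\<close>. The strain of \<open>w\<close> contributes only at \<open>0\<close>, where
  it equals the displacement, because it vanishes at \<open>1\<close>.\<close>

lemma weighted_energy_derivative:
  assumes w: "\<And>x. 0 < x \<Longrightarrow> x < 1 \<Longrightarrow> \<bar>\<alpha> + \<beta> * x\<bar> \<le> 1"
  shows "((\<lambda>t. 2 * inner (weight \<alpha> \<beta> (strain (wave_flow t (wave_inv x)))) (vel (wave_flow t (wave_inv x)))) has_vector_derivative
    (\<alpha> + \<beta>) * (cmod (trace_at (wave_flow t x) 1))\<^sup>2
    - \<alpha> * ((cmod (trace_at (wave_flow t x) 0))\<^sup>2 + (cmod (trace_at (wave_flow t (wave_inv x)) 0))\<^sup>2)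
    - \<beta> * ((norm (strain (wave_flow t (wave_inv x))))\<^sup>2 + (norm (vel (wave_flow t (wave_inv x))))\<^sup>2)) (at t)"
proof -
  let ?y = "wave_flow t x" and ?u = "wave_flow t (wave_inv x)"
  have u: "?u = wave_inv ?y" by (rule wave_flow_K)
  have vel_u: "vel ?u = pos ?y" by (simp add: u wave_inv)
  have \<phi>: "strain ?u \<in> H1" "h1_deriv (strain ?u) = vel ?y" "h1_value (strain ?u) 0 = trace_at ?u 0" "h1_value (strain ?u) 1 = 0"
    by (simp_all add: u wave_inv prim h1_value_prim)
  have d1: "((\<lambda>t. weight \<alpha> \<beta> (strain (wave_flow t (wave_inv x)))) has_vector_derivative weight \<alpha> \<beta> (strain ?y)) (at t)"
    by (rule bounded_linear.has_vector_derivative[OF bounded_linear_weight[OF w]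
          bounded_linear.has_vector_derivative[OF bounded_linear_strain wave_flow_derivative]])
  have d2: "((\<lambda>t. vel (wave_flow t (wave_inv x))) has_vector_derivative vel ?y) (at t)"
    by (rule bounded_linear.has_vector_derivative[OF bounded_linear_vel wave_flow_derivative])
  have "((\<lambda>t. 2 * inner (weight \<alpha> \<beta> (strain (wave_flow t (wave_inv x)))) (vel (wave_flow t (wave_inv x)))) has_vector_derivative
      2 * (inner (weight \<alpha> \<beta> (strain ?u)) (vel ?y) + inner (weight \<alpha> \<beta> (strain ?y)) (vel ?u))) (at t)"
    by (rule bounded_linear.has_vector_derivative[OF bounded_linear_mult_right
          bounded_bilinear.has_vector_derivative[OF bounded_bilinear_inner d1 d2]])
  moreover have "2 * inner (weight \<alpha> \<beta> (strain ?y)) (vel ?u) =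
      (\<alpha> + \<beta>) * (cmod (trace_at ?y 1))\<^sup>2 - \<alpha> * (cmod (trace_at ?y 0))\<^sup>2 - \<beta> * (norm (vel ?u))\<^sup>2"
    unfolding vel_u strain_def trace_at_def by (rule inner_weight_deriv[OF pos_H1])
  moreover have "2 * inner (weight \<alpha> \<beta> (strain ?u)) (vel ?y) = - \<alpha> * (cmod (trace_at ?u 0))\<^sup>2 - \<beta> * (norm (strain ?u))\<^sup>2"
    using inner_weight_deriv[OF \<phi>(1), of \<alpha> \<beta>] inner_weight_commute[of \<alpha> \<beta> "strain ?u" "vel ?y"] by (simp add: \<phi>)
  ultimately show ?thesis by (simp add: algebra_simps)
qed

lemma abs_weighted_energy_le:
  assumes w: "\<And>x. 0 < x \<Longrightarrow> x < 1 \<Longrightarrow> \<bar>\<alpha> + \<beta> * x\<bar> \<le> 1"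
  shows "\<bar>2 * inner (weight \<alpha> \<beta> (strain z)) (vel z)\<bar> \<le> (norm z)\<^sup>2"
proof -
  have "\<bar>inner (weight \<alpha> \<beta> (strain z)) (vel z)\<bar> \<le> norm (weight \<alpha> \<beta> (strain z)) * norm (vel z)"
    by (rule Cauchy_Schwarz_ineq2)
  also have "\<dots> \<le> norm (strain z) * norm (vel z)" by (intro mult_right_mono norm_weight_le[OF w]) auto
  finally have "\<bar>2 * inner (weight \<alpha> \<beta> (strain z)) (vel z)\<bar> \<le> 2 * (norm (strain z) * norm (vel z))" by simp
  also have "\<dots> \<le> (norm (strain z))\<^sup>2 + (norm (vel z))\<^sup>2"
    using sum_squares_bound[of "norm (strain z)" "norm (vel z)"] by (simp add: mult.assoc)
  also have "\<dots> \<le> (norm z)\<^sup>2" by (simp add: norm_wave_sq)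
  finally show ?thesis .
qed

text \<open>The weight \<open>x - (1 - a)\<close> vanishes at the other end point and has slope \<open>1\<close>. In the derivative of the
  weighted energy it leaves the squared boundary velocity at \<open>a\<close>, up to a nonnegative term, minus a part of the
  conserved energy. The summand \<open>2\<close> accounts for the weighted energies at times \<open>0\<close> and \<open>\<tau>\<close>.\<close>

lemma trace_energy:
  assumes \<tau>: "0 \<le> \<tau>" and a: "a = 0 \<or> a = 1"
  shows "integral {0..\<tau>} (\<lambda>s. (cmod (trace_at (wave_flow s x) a))\<^sup>2) \<le> (2 + \<tau>) * (norm (wave_inv x))\<^sup>2"
proof -
  define \<alpha> \<beta> :: real where "\<alpha> = a - 1" and "\<beta> = 1"
  have w: "\<bar>\<alpha> + \<beta> * x\<bar> \<le> 1" if "0 < x" "x < 1" for x using a that by (auto simp: \<alpha>_def \<beta>_def)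
  let ?u = "\<lambda>s. wave_flow s (wave_inv x)"
  let ?E = "\<lambda>s. 2 * inner (weight \<alpha> \<beta> (strain (?u s))) (vel (?u s))"
  define dE where "dE s = (\<alpha> + \<beta>) * (cmod (trace_at (wave_flow s x) 1))\<^sup>2
    - \<alpha> * ((cmod (trace_at (wave_flow s x) 0))\<^sup>2 + (cmod (trace_at (?u s) 0))\<^sup>2)
    - \<beta> * ((norm (strain (?u s)))\<^sup>2 + (norm (vel (?u s)))\<^sup>2)" for s
  have norm_u: "norm (?u s) = norm (wave_inv x)" for s by (rule norm_wave_flow)
  have "(dE has_integral ?E \<tau> - ?E 0) {0..\<tau>}"
    unfolding dE_def
    by (rule fundamental_theorem_of_calculus[OF \<tau>])
       (rule has_vector_derivative_at_within[OF weighted_energy_derivative[OF w]])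
  moreover have "((\<lambda>s. (norm (wave_inv x))\<^sup>2) has_integral (norm (wave_inv x))\<^sup>2 * \<tau>) {0..\<tau>}"
    using has_integral_const_real[of "(norm (wave_inv x))\<^sup>2" 0 \<tau>] \<tau> by (simp add: mult.commute)
  ultimately have I: "((\<lambda>s. dE s + (norm (wave_inv x))\<^sup>2) has_integral (?E \<tau> - ?E 0) + (norm (wave_inv x))\<^sup>2 * \<tau>) {0..\<tau>}"
    by (rule has_integral_add)
  have a01: "a \<in> {0..1}" using a by auto
  have cont: "continuous_on {0..\<tau>} (\<lambda>s. trace_at (wave_flow s x) a)"
    by (intro bounded_linear.continuous_on[OF bounded_linear_trace[OF a01]] continuous_on_subset[OF wave_flow_continuous]) auto
  have "((\<lambda>s. (cmod (trace_at (wave_flow s x) a))\<^sup>2) has_integral integral {0..\<tau>} (\<lambda>s. (cmod (trace_at (wave_flow s x) a))\<^sup>2)) {0..\<tau>}"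
    by (intro integrable_integral integrable_continuous_real continuous_intros cont)
  moreover have "(cmod (trace_at (wave_flow s x) a))\<^sup>2 \<le> dE s + (norm (wave_inv x))\<^sup>2" for s
    using a unfolding norm_u[of s, symmetric] norm_wave_sq[of "?u s"] by (auto simp: dE_def \<alpha>_def \<beta>_def)
  ultimately have "integral {0..\<tau>} (\<lambda>s. (cmod (trace_at (wave_flow s x) a))\<^sup>2) \<le> (?E \<tau> - ?E 0) + (norm (wave_inv x))\<^sup>2 * \<tau>"
    using has_integral_le[OF _ I] by blast
  also have "?E \<tau> - ?E 0 \<le> 2 * (norm (wave_inv x))\<^sup>2"
  proof -
    have "\<bar>?E s\<bar> \<le> (norm (wave_inv x))\<^sup>2" for s
      unfolding norm_u[of s, symmetric] by (rule abs_weighted_energy_le[OF w])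
    from this[of \<tau>] this[of 0] show ?thesis by linarith
  qed
  finally show ?thesis by (simp add: algebra_simps)
qed

definition obs1 :: "wave_state \<Rightarrow> complex" where "obs1 z = - h1_value (vel z) 0"
definition obs2 :: "wave_state \<Rightarrow> complex" where "obs2 z = h1_value (vel z) 1"

lemma obs_wave_inv: "obs1 (wave_inv x) = - trace_at x 0" "obs2 (wave_inv x) = trace_at x 1"
  by (simp_all add: obs1_def obs2_def wave_inv trace_at_def)

lemma observed_flow_1: "observed_flow wave_inv wave_flow obs1"
proof (intro observed_flow.intro complex_skew_flow_wave observed_flow_axioms.intro)
  show "bounded_linear (\<lambda>x. obs1 (wave_inv x))"
    unfolding obs_wave_inv by (intro bounded_linear_minus bounded_linear_trace) simp
  show "obs1 (wave_inv (c *\<^sub>C x)) = c * obs1 (wave_inv x)" for c x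
    by (simp add: obs_wave_inv trace_linear)
  show "integral {0..\<tau>} (\<lambda>s. (cmod (obs1 (wave_flow s (wave_inv x))))\<^sup>2) \<le> (2 + \<tau>) * (norm (wave_inv x))\<^sup>2"
    if "0 \<le> \<tau>" for \<tau> x
    using trace_energy[OF that, of 0 x] by (simp add: wave_flow_K obs_wave_inv)
qed

lemma observed_flow_2: "observed_flow wave_inv wave_flow obs2"
proof (intro observed_flow.intro complex_skew_flow_wave observed_flow_axioms.intro)
  show "bounded_linear (\<lambda>x. obs2 (wave_inv x))"
    unfolding obs_wave_inv by (intro bounded_linear_trace) simp
  show "obs2 (wave_inv (c *\<^sub>C x)) = c * obs2 (wave_inv x)" for c x
    by (simp add: obs_wave_inv trace_linear)
  show "integral {0..\<tau>} (\<lambda>s. (cmod (obs2 (wave_flow s (wave_inv x))))\<^sup>2) \<le> (2 + \<tau>) * (norm (wave_inv x))\<^sup>2"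
    if "0 \<le> \<tau>" for \<tau> x
    using trace_energy[OF that, of 1 x] by (simp add: wave_flow_K obs_wave_inv)
qed

section \<open>Well-posedness\<close>

lemma mk_state_0: "cinner (vel x) \<eta> = cinner x (mk_state 0 \<eta>)" "norm (mk_state 0 \<eta>) = norm \<eta>"
proof -
  have m: "vel (mk_state 0 \<eta>) = \<eta>" "pos (mk_state 0 \<eta>) = 0" by (simp_all add: vel_mk_state pos_mk_state H1_zero)
  have s: "strain (mk_state 0 \<eta>) = 0" "trace_at (mk_state 0 \<eta>) 0 = 0" by (simp_all add: strain_def trace_at_def m H1_zero)
  have "cinner y 0 = 0" for y :: l2 using cinner_add_right[of y 0 0] by simp
  then show "cinner (vel x) \<eta> = cinner x (mk_state 0 \<eta>)" by (simp add: cinner_wave m s)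
  have "(norm (mk_state 0 \<eta>))\<^sup>2 = (norm \<eta>)\<^sup>2" unfolding norm_wave_sq by (simp add: m s)
  then show "norm (mk_state 0 \<eta>) = norm \<eta>" by (simp add: power2_eq_iff_nonneg)
qed

text \<open>The displacement is the velocity component of \<open>wave_inv X\<close>. States \<open>mk_state 0 \<eta>\<close> represent the adjoint of
  \<open>vel\<close>; their images under \<open>wave_inv\<close> have zero velocity and so are not observed.\<close>

lemma wave_well_posed:
  fixes f :: "wave_state \<Rightarrow> real"
  assumes f: "L-lipschitz_on UNIV f" and u: "L2_loc u" and d: "L2_loc d"
  shows "\<exists>X. mild_solution wave_flow q f u d X0 X \<and>
    (\<forall>t\<ge>0. ((\<lambda>s. pos (X s)) has_vector_derivative vel (X t)) (at t within {0..})) \<and>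
    (\<forall>Y. mild_solution wave_flow q f u d X0 Y \<longrightarrow> (\<forall>t\<ge>0. Y t = X t))"
proof -
  define F1 where "F1 z = - (of_real (q + 1) * trace_at z 0)" for z
  define F2 where "F2 z = complex_of_real (f z)" for z
  \<comment> \<open>The factor \<open>2\<close> is that of the trace bound \<open>cmod_trace_le\<close>.\<close>
  define M where "M = max (2 * \<bar>q + 1\<bar>) L"
  interpret cl: closed_loop wave_inv wave_flow obs1 obs2 F1 F2 M "\<lambda>s. 0" "\<lambda>s. u s + d s" X0
  proof (intro closed_loop.intro closed_loop_axioms.intro observed_flow_1 observed_flow_2)
    interpret t: bounded_linear "\<lambda>z. trace_at z 0" by (rule bounded_linear_trace) simp
    fix x y
    have "cmod (F1 x - F1 y) = \<bar>q + 1\<bar> * cmod (trace_at (y - x) 0)"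
      unfolding F1_def t.diff norm_of_real[symmetric, where ?'a = complex] norm_mult[symmetric] by (simp add: algebra_simps)
    also have "\<dots> \<le> \<bar>q + 1\<bar> * (2 * norm (y - x))" by (intro mult_left_mono cmod_trace_le) auto
    also have "\<dots> = (2 * \<bar>q + 1\<bar>) * norm (x - y)" by (simp add: norm_minus_commute)
    also have "\<dots> \<le> M * norm (x - y)" by (intro mult_right_mono) (auto simp: M_def)
    finally show "cmod (F1 x - F1 y) \<le> M * norm (x - y)" .
    have "cmod (F2 x - F2 y) = dist (f x) (f y)"
      unfolding F2_def of_real_diff[symmetric] norm_of_real dist_real_def ..
    also have "\<dots> \<le> L * norm (x - y)" using lipschitz_onD[OF f] by (simp add: dist_norm)
    also have "\<dots> \<le> M * norm (x - y)" by (intro mult_right_mono) (auto simp: M_def)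
    finally show "cmod (F2 x - F2 y) \<le> M * norm (x - y)" .
    show "L2_loc (\<lambda>s. 0)" by (intro L2_loc_continuous) simp
    show "L2_loc (\<lambda>s. u s + d s)" by (rule L2_loc_add[OF u d])
  qed
  have inputs: "(\<lambda>z. - B1 (of_real (q + 1) * h1_value (pos (X s)) 0) z + B2 (of_real (f (X s)) + u s + d s) z)
      = (\<lambda>z. control_op obs1 (cl.in1 X s) z + control_op obs2 (cl.in2 X s) z)" for X s
    by (simp add: B1_def B2_def obs1_def[abs_def] obs2_def[abs_def] control_op_def cl.in1_def cl.in2_def
        F1_def F2_def trace_at_def add.assoc)
  have mild: "mild_solution wave_flow q f u d X0 X \<longleftrightarrow> continuous_on {0..} X \<and> (\<forall>t\<ge>0. X t = cl.P X t)" for X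
  proof (cases "continuous_on {0..} X")
    case True
    have "(\<forall>t\<ge>0. X t = cl.P X t) \<longrightarrow> X 0 = X0" using cl.P_0[OF True] by auto
    then show ?thesis
      unfolding mild_solution_def inputs
      using True cl.mild_iff_fixed_point[OF wave_dom_eq_range wave_op_inv True] by blast
  qed (simp add: mild_solution_def)
  obtain X where X: "continuous_on {0..} X" "\<And>t. 0 \<le> t \<Longrightarrow> X t = cl.P X t"
    using cl.fixed_point_exists by blast
  have deriv: "((\<lambda>s. pos (X s)) has_vector_derivative vel (X t)) (at t within {0..})" if t: "0 \<le> t" for t
  proof -
    have "pos (mk_state 0 \<eta>) = 0" for \<eta> by (simp add: pos_mk_state H1_zero)
    then have unobs: "obs1 (wave_inv (mk_state 0 \<eta>)) = 0" "obs2 (wave_inv (mk_state 0 \<eta>)) = 0" for \<eta>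
      by (simp_all add: obs_wave_inv trace_at_def H1_zero)
    have "((\<lambda>s. vel (wave_inv (X s))) has_vector_derivative vel (X t)) (at t within {0..})"
      by (rule cl.position_derivative[OF bounded_linear_vel mk_state_0(1) _ unobs X t])
         (simp add: mk_state_0(2))
    then show ?thesis by (simp add: wave_inv)
  qed
  show ?thesis
  proof (intro exI[of _ X] conjI allI impI)
    show "mild_solution wave_flow q f u d X0 X" using X by (simp add: mild)
    show "((\<lambda>s. pos (X s)) has_vector_derivative vel (X t)) (at t within {0..})" if "0 \<le> t" for t
      by (rule deriv[OF that])
    show "Y t = X t" if "mild_solution wave_flow q f u d X0 Y" "0 \<le> t" for Y t
      using that cl.fixed_point_unique[of Y X t] X by (simp add: mild)
  qed
qed

theorem proposition1p1:
  fixes q :: real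
  assumes "q > 0"
  shows "\<exists>T. unitary_group T \<and> generates wave_dom wave_op T \<and>
    admissible wave_dom wave_op T B1 \<and> admissible wave_dom wave_op T B2 \<and>
    (\<forall>f :: wave_state \<Rightarrow> real. (\<exists>L. L-lipschitz_on UNIV f) \<longrightarrow> f (mk_state 0 0) = 0 \<longrightarrow>
      (\<forall>w0\<in>H1. \<forall>w1 u d. L2_loc u \<longrightarrow> L2_loc d \<longrightarrow>
        (\<exists>X. mild_solution T q f u d (mk_state w0 w1) X \<and>
             (\<forall>t\<ge>0. ((\<lambda>s. pos (X s)) has_vector_derivative vel (X t)) (at t within {0..})) \<and>
             (\<forall>Y. mild_solution T q f u d (mk_state w0 w1) Y \<longrightarrow> (\<forall>t\<ge>0. Y t = X t)))))"
proof (intro exI[of _ wave_flow] conjI allI impI ballI)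
  show "unitary_group wave_flow" by (rule complex_skew_flow.unitary_group_flow[OF complex_skew_flow_wave])
  show "generates wave_dom wave_op wave_flow"
    by (rule complex_skew_flow.generates_flow[OF complex_skew_flow_wave wave_dom_eq_range wave_op_inv])
  show "admissible wave_dom wave_op wave_flow B1" "admissible wave_dom wave_op wave_flow B2"
    using observed_flow.admissible_obs[OF observed_flow_1 wave_dom_eq_range wave_op_inv] observed_flow.admissible_obs[OF observed_flow_2 wave_dom_eq_range wave_op_inv]
    by (simp_all add: B1_def B2_def obs1_def[abs_def] obs2_def[abs_def])
  fix f :: "wave_state \<Rightarrow> real" and w0 w1 u d
  assume "\<exists>L. L-lipschitz_on UNIV f"
  then obtain L where L: "L-lipschitz_on UNIV f" ..
  assume "L2_loc u" "L2_loc d"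
  then show "\<exists>X. mild_solution wave_flow q f u d (mk_state w0 w1) X \<and>
      (\<forall>t\<ge>0. ((\<lambda>s. pos (X s)) has_vector_derivative vel (X t)) (at t within {0..})) \<and>
      (\<forall>Y. mild_solution wave_flow q f u d (mk_state w0 w1) Y \<longrightarrow> (\<forall>t\<ge>0. Y t = X t))"
    by (rule wave_well_posed[OF L])
qed

end
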